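(* Let $d\ge2$, $K\ge 2$ be integers and $\alpha>\beta>0$ be constants with $\frac{(\sqrt{\alpha}-\sqrt{\beta})^2}{K^{d-1}(d-1)!}>1$. Let $\mathcal{A}$ be generated by the symmetric $d$-HSBM with parameters $(n,d,K,p,q)$ and $\boldsymbol{H}^*\in\mathcal{H}$, where $p=\alpha\log n/n^{d-1}$, $q=\beta\log n/n^{d-1}$. There exist constants $\gamma>0$ and $C>0$, with properties (G) and (M) of the context respectively, such that the following holds. Put $$\phi=\frac{CK^{d-3/2}}{64(d-1)(\alpha-\beta)},\qquad \theta=\frac14\min\left\{\frac{1}{\sqrt{K(d-1)}},\ \frac{\gamma K^{d-3/2}}{16(d-1)(\alpha-\beta)}\right\}.$$ Suppose that $$n>\exp\left(\max\left\{\frac{64C^2}{\gamma^2},\ \frac{\gamma^2}{C^2},\ \frac{\phi^2}{\theta^2},\ 2\phi^2,\ \frac{256C^4}{\gamma^4}\right\}\right)$$ and $n$ is sufficiently large that the bound in (G) holds. Then the following statement holds with probability at least $1-n^{-\Omega(1)}$: if the initial point $\boldsymbol{H}^0$ satisfies $\boldsymbol{H}^0\in\mathbb{M}_{n,K}$ and $\min_{\boldsymbol{Q}\in\Pi_K}\|\boldsymbol{H}^0-\boldsymbol{H}^*\boldsymbol{Q}\|_F\le\theta\sqrt n$, then the projected tensor power method (PTPM) outputs $\boldsymbol{H}^*\boldsymbol{Q}$ for some $\boldsymbol{Q}\in\Pi_K$ within $\left(\lceil2\log\log n\rceil+\left\lceil\frac{2\log n}{\log\log n}\right\rceil+2\right)$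 projected tensor power iterations.
   Context: Notation: $[n]=\{1,\dots,n\}$; $\boldsymbol{1}_n$ is the all-one vector in $\mathbb{R}^n$; $\Pi_K$ is the set of $K\times K$ permutation matrices; $\mathbf{Bern}(p)$ is the Bernoulli distribution; $\|\cdot\|_F$ is the Frobenius norm. $K$ divides $n$ and $m=n/K$. The set of balanced assignments is $\mathcal{H}=\{\boldsymbol{H}\in\{0,1\}^{n\times K}:\boldsymbol{H}\boldsymbol{1}_K=\boldsymbol{1}_n,\ \boldsymbol{H}^\top\boldsymbol{1}_n=m\boldsymbol{1}_K\}$; nodes $i,j$ are in the same community of $\boldsymbol{H}$ if rows $i$ and $j$ of $\boldsymbol{H}$ are equal. $\mathbb{M}_{n,K}$ is the set of $n\times K$ matrices each of whose rows is all zero except for one entry equal to $1$. Symmetric $d$-HSBM with parameters $(n,d,K,p,q)$ and $\boldsymbol{H}^*\in\mathcal{H}$: a random symmetric order-$d$ tensor $\mathcal{A}$ of size $n\times\cdots\times n$ (invariant under permutations of indices) whose entries $\mathcal{A}_{i_1,\dots,i_d}$, $1\le i_1<\dots<i_d\le n$, are independent, with $\mathcal{A}_{i_1,\dots,i_d}\sim\mathbf{Bern}(p)$ if $i_1,\dots,i_d$ all belong to the same community of $\boldsymbol{H}^*$ and $\sim\mathbf{Bern}(q)$ otherwise; entries with two equal indices are $0$. For $\boldsymbol{H}\in\mathbb{R}^{n\times K}$, $\mathcal{A}[\boldsymbol{H}^{\otimes(d-1)}]$ is the $n\times K$ matrix with $(i,k)$ entry $\sum_{1\le i_2,\dots,i_d\le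 n}\mathcal{A}_{i,i_2,\dots,i_d}H_{i_2k}\cdots H_{i_dk}$. For $\boldsymbol{C}\in\mathbb{R}^{n\times K}$, $\mathcal{T}(\boldsymbol{C})=\arg\min\{\|\boldsymbol{H}-\boldsymbol{C}\|_F:\boldsymbol{H}\in\mathcal{H}\}$ (set-valued). PTPM: given $\mathcal{A}$, a positive integer $N$ and an initial point $\boldsymbol{H}^0$, choose $\boldsymbol{H}^1\in\mathcal{T}(\boldsymbol{H}^0)$, then for $t=1,\dots,N$ choose $\boldsymbol{H}^{t+1}\in\mathcal{T}(\mathcal{A}[(\boldsymbol{H}^t)^{\otimes(d-1)}])$ (one projected tensor power iteration), and output $\boldsymbol{H}^{N+1}$. Property (G) of $\gamma$: $\gamma$ depends only on $\alpha,\beta,d,K$ and, for all sufficiently large $n$, with probability at least $1-n^{-\Omega(1)}$ the matrix $\boldsymbol{B}=\mathcal{A}[(\boldsymbol{H}^* )^{\otimes(d-1)}]$ satisfies $B_{ik}-B_{i\ell}\ge\gamma\log n$ for all $1\le k\ne\ell\le K$ and all $i$ with $H^*_{ik}=1$. Property (M) of $C$: $C$ does not depend on $n$ and, for all sufficiently large $n$, every $\varepsilon\in(0,1/\sqrt{K(d-1)})$ and every $\boldsymbol{H}\in\mathcal{H}$, $\boldsymbol{Q}\in\Pi_K$ with $\|\boldsymbol{H}-\boldsymbol{H}^*\boldsymbol{Q}\|_F\le\varepsilon\sqrt n$, with probability at least $1-n^{-10}$ one has $\|\mathcal{A}[\boldsymbol{H}^{\otimes(d-1)}]-\mathcal{A}[(\boldsymbol{H}^*\boldsymbol{Q})^{\otimes(d-1)}]\|_F\le\left(\frac{4(d-1)m^{d-2}\varepsilon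 n}{\sqrt K}(p-q)+C\sqrt{\log n}\right)\|\boldsymbol{H}-\boldsymbol{H}^*\boldsymbol{Q}\|_F$. $n^{-\Omega(1)}$ denotes a quantity at most $n^{-c}$ with a constant $c>0$ not depending on $n$ ($d,K,\alpha,\beta$ are fixed). *)

theory Defs
  imports "HOL-Probability.Probability" "HOL-Combinatorics.Permutations"
    "Jordan_Normal_Form.Matrix"
begin

text \<open>
  Nodes and communities are numbered from 0: the nodes are \<open>{..<n}\<close> and the communities \<open>{..<K}\<close>.
  A real tensor of order \<open>d\<close> is a function on index lists, of which only the values at lists of
  length \<open>d\<close> with entries below \<open>n\<close> matter.
\<close>

type_synonym tensor = "nat list \<Rightarrow> real"

definition frob_norm :: "real mat \<Rightarrow> real" where
  "frob_norm X = sqrt (\<Sum>i<dim_row X. \<Sum>j<dim_col X. (X $$ (i, j))\<^sup>2)"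

definition ones_vec :: "nat \<Rightarrow> real vec" where
  "ones_vec r = vec r (\<lambda>_. 1)"

definition perm_mats :: "nat \<Rightarrow> real mat set" where
  "perm_mats K = {mat K K (\<lambda>(i, j). if i = \<pi> j then 1 else 0) | \<pi>. \<pi> permutes {..<K}}"

definition balanced_assignments :: "nat \<Rightarrow> nat \<Rightarrow> real mat set" where
  "balanced_assignments n K = {H \<in> carrier_mat n K. elements_mat H \<subseteq> {0, 1} \<and>
     H *\<^sub>v ones_vec K = ones_vec n \<and>
     transpose_mat H *\<^sub>v ones_vec n = real (n div K) \<cdot>\<^sub>v ones_vec K}"

definition assignment_mats :: "nat \<Rightarrow> nat \<Rightarrow> real mat set" where
  "assignment_mats n K = {H \<in> carrier_mat n K.
     \<forall>i<n. \<exists>k<K. H $$ (i, k) = 1 \<and> (\<forall>l<K. l \<noteq> k \<longrightarrow> H $$ (i, l) = 0)}"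

definition same_community :: "real mat \<Rightarrow> nat set \<Rightarrow> bool" where
  "same_community H e \<longleftrightarrow> (\<forall>i\<in>e. \<forall>j\<in>e. row H i = row H j)"

text \<open>
  An index tuple \<open>i\<^sub>1 < \<dots> < i\<^sub>d\<close> is identified with the set of its \<open>d\<close> members, so that an
  assignment of Boolean values to the \<open>d\<close>-element sets of nodes extends uniquely to a symmetric
  0/1-tensor which vanishes at every tuple with two equal indices.
\<close>

definition node_sets :: "nat \<Rightarrow> nat \<Rightarrow> nat set set" where
  "node_sets n d = {e. e \<subseteq> {..<n} \<and> card e = d}"

definition adjacency_tensor :: "nat \<Rightarrow> nat \<Rightarrow> (nat set \<Rightarrow> bool) \<Rightarrow> tensor" where
  "adjacency_tensor n d x is =
     (if length is = d \<and> distinct is \<and> set is \<subseteq> {..<n} then of_bool (x (set is)) else 0)"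

text \<open>
  The law of the tensor in the symmetric \<open>d\<close>-HSBM; \<open>Pi_pmf\<close> makes the entries independent.
  \<open>bernoulli_pmf\<close> truncates its parameter to \<open>[0,1]\<close>; this has no effect in the regime of
  \<open>hsbm_log\<close> below once \<open>n\<close> is large.
\<close>

definition hsbm :: "nat \<Rightarrow> nat \<Rightarrow> real \<Rightarrow> real \<Rightarrow> real mat \<Rightarrow> tensor pmf" where
  "hsbm n d p q Hs = map_pmf (adjacency_tensor n d)
     (Pi_pmf (node_sets n d) False
       (\<lambda>e. bernoulli_pmf (if same_community Hs e then p else q)))"

definition log_param :: "real \<Rightarrow> nat \<Rightarrow> nat \<Rightarrow> real" where
  "log_param a d n = a * ln (real n) / real n ^ (d - 1)"

definition hsbm_log :: "nat \<Rightarrow> nat \<Rightarrow> real \<Rightarrow> real \<Rightarrow> real mat \<Rightarrow> tensor pmf" where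
  "hsbm_log n d \<alpha> \<beta> Hs = hsbm n d (log_param \<alpha> d n) (log_param \<beta> d n) Hs"

text \<open>The matrix \<open>\<A>[H\<^bsup>\<otimes>(d-1)\<^esup>]\<close>.\<close>

definition tensor_power :: "nat \<Rightarrow> nat \<Rightarrow> nat \<Rightarrow> tensor \<Rightarrow> real mat \<Rightarrow> real mat" where
  "tensor_power n d K A H = mat n K (\<lambda>(i, k).
     \<Sum>is | length is = d - 1 \<and> set is \<subseteq> {..<n}. A (i # is) * (\<Prod>j\<leftarrow>is. H $$ (j, k)))"

definition balanced_proj :: "nat \<Rightarrow> nat \<Rightarrow> real mat \<Rightarrow> real mat set" where
  "balanced_proj n K C =
     {H. is_arg_min (\<lambda>H. frob_norm (H - C)) (\<lambda>H. H \<in> balanced_assignments n K) H}"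

text \<open>
  The projections are set-valued, so PTPM with \<open>N\<close> iterations may have several outputs:
  \<open>X\<close> is an output if some admissible sequence of choices leads to it.
\<close>

definition ptpm_output ::
    "nat \<Rightarrow> nat \<Rightarrow> nat \<Rightarrow> tensor \<Rightarrow> nat \<Rightarrow> real mat \<Rightarrow> real mat \<Rightarrow> bool" where
  "ptpm_output n d K A N H0 X \<longleftrightarrow> (\<exists>H :: nat \<Rightarrow> real mat.
     H 0 = H0 \<and> H 1 \<in> balanced_proj n K (H 0) \<and>
     (\<forall>t\<in>{1..N}. H (t + 1) \<in> balanced_proj n K (tensor_power n d K A (H t))) \<and>
     X = H (N + 1))"

text \<open>
  The probability bound of property (G) for one \<open>n\<close> and one \<open>Hs\<close>, with \<open>c\<close> the constant hidden
  in \<open>n\<^bsup>-\<Omega>(1)\<^esup>\<close>.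
\<close>

definition gap_bound ::
    "nat \<Rightarrow> nat \<Rightarrow> real \<Rightarrow> real \<Rightarrow> real \<Rightarrow> real \<Rightarrow> nat \<Rightarrow> real mat \<Rightarrow> bool" where
  "gap_bound d K \<alpha> \<beta> \<gamma> c n Hs \<longleftrightarrow>
     measure_pmf.prob (hsbm_log n d \<alpha> \<beta> Hs)
       {A. let B = tensor_power n d K A Hs in
           \<forall>k<K. \<forall>l<K. k \<noteq> l \<longrightarrow>
             (\<forall>i<n. Hs $$ (i, k) = 1 \<longrightarrow> B $$ (i, k) - B $$ (i, l) \<ge> \<gamma> * ln (real n))}
     \<ge> 1 - real n powr (- c)"

definition property_G :: "nat \<Rightarrow> nat \<Rightarrow> real \<Rightarrow> real \<Rightarrow> real \<Rightarrow> bool" where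
  "property_G d K \<alpha> \<beta> \<gamma> \<longleftrightarrow>
     (\<exists>c>0. \<forall>\<^sub>F n in sequentially. K dvd n \<longrightarrow>
        (\<forall>Hs\<in>balanced_assignments n K. gap_bound d K \<alpha> \<beta> \<gamma> c n Hs))"

definition property_M :: "nat \<Rightarrow> nat \<Rightarrow> real \<Rightarrow> real \<Rightarrow> real \<Rightarrow> bool" where
  "property_M d K \<alpha> \<beta> C \<longleftrightarrow>
     (\<forall>\<^sub>F n in sequentially. K dvd n \<longrightarrow>
        (\<forall>Hs\<in>balanced_assignments n K.
         \<forall>\<epsilon>\<in>{0 <..< 1 / sqrt (real (K * (d - 1)))}.
         \<forall>H\<in>balanced_assignments n K. \<forall>Q\<in>perm_mats K.
           frob_norm (H - Hs * Q) \<le> \<epsilon> * sqrt (real n) \<longrightarrow>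
           measure_pmf.prob (hsbm_log n d \<alpha> \<beta> Hs)
             {A. frob_norm (tensor_power n d K A H - tensor_power n d K A (Hs * Q))
                 \<le> (4 * real (d - 1) * real (n div K) ^ (d - 2) * \<epsilon> * real n / sqrt (real K)
                       * (log_param \<alpha> d n - log_param \<beta> d n)
                     + C * sqrt (ln (real n)))
                   * frob_norm (H - Hs * Q)}
           \<ge> 1 - real n powr (- 10)))"

definition phi_const :: "nat \<Rightarrow> nat \<Rightarrow> real \<Rightarrow> real \<Rightarrow> real \<Rightarrow> real" where
  "phi_const d K \<alpha> \<beta> C =
     C * real K powr (real d - 3 / 2) / (64 * real (d - 1) * (\<alpha> - \<beta>))"

definition theta_const :: "nat \<Rightarrow> nat \<Rightarrow> real \<Rightarrow> real \<Rightarrow> real \<Rightarrow> real" where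
  "theta_const d K \<alpha> \<beta> \<gamma> =
     1 / 4 * min (1 / sqrt (real (K * (d - 1))))
                 (\<gamma> * real K powr (real d - 3 / 2) / (16 * real (d - 1) * (\<alpha> - \<beta>)))"

end

theory Submission
  imports Defs "HOL-Combinatorics.Multiset_Permutations" "HOL-Real_Asymp.Real_Asymp"
begin

text \<open>
  Assignment matrices are treated as labellings of the nodes, and a right factor in \<open>perm_mats\<close> renames
  the labels. The \<open>(i, k)\<close> entry of the tensor power is then \<open>fact (d - 1)\<close> times the number of
  hyperedges of the random hypergraph that consist of \<open>i\<close> and of \<open>d - 1\<close> further nodes with label \<open>k\<close>.

  \<^bold>\<open>Recovery.\<close> Let \<open>S\<close> and \<open>T\<close> be the sets of mislabelled nodes before and after one iteration.
  If the labels are correct, the entry of the right community exceeds all others in its row by a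
  multiple of \<open>ln n\<close>. The projection maximises an inner product, so what the nodes of \<open>T\<close> lose
  against this gap must be won back through hyperedges that join a node of \<open>T\<close> to a node of \<open>S\<close>
  (\<open>projection_step_mismatches\<close>); hence there are at least \<open>\<tau> * card T * ln n\<close> such incidences. For fixed
  \<open>S\<close> and \<open>T\<close> with \<open>card S \<le> \<kappa> * n\<close> Chernoff's bound makes this so unlikely that one can afford the union
  over all \<open>S\<close> and all \<open>T\<close> with \<open>card S \<le> sqrt (ln n) * card T\<close> (\<open>prob_not_scattered_le\<close>). So with high
  probability every iteration, from every labelling with few errors, divides the number of errors by
  at least \<open>sqrt (ln n)\<close>, and after \<open>2 * ln n / ln (ln n)\<close> iterations less than one error remains. The uniformity in \<open>S\<close>
  matters, because the iterates depend on the tensor. The first projection, of the initial point, at most doubles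
  the number of errors.

  \<^bold>\<open>The gap.\<close> Property (G) is Chernoff's bound for the difference of two binomial variables; the
  assumption on \<open>\<alpha>\<close> and \<open>\<beta>\<close> says that the exponent exceeds the \<open>1\<close> that the union over the nodes costs
  (\<open>prob_no_gap_le\<close>).

  \<^bold>\<open>The perturbation bound.\<close> In property (M) the mean of the difference is controlled by counting
  (\<open>tensor_difference_bound\<close>). The centred part consists of row sums over the hyperedges that touch \<open>S\<close>.
  The rows are not independent, but they become so once the hyperedges are sorted by the rank of
  the row index among their nodes. A truncated exponential moment bound for a sum of independent squares
  (\<open>sum_squares_blocks_tail\<close>) then gives the order \<open>card S * ln n\<close>.

  \<^bold>\<open>The constants.\<close> Decreasing \<open>\<gamma>\<close> preserves (G) and shrinks \<open>\<theta>\<close>, and increasing \<open>C\<close> preserves (M) and raises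
  the lower bound on \<open>n\<close>. So \<open>\<gamma>\<close> is taken small enough for the contraction, which uses the original
  larger gap, and \<open>C\<close> large enough for all asymptotic inequalities to hold.
\<close>

section \<open>Tail bounds for independent Bernoulli variables\<close>

lemma finite_set_Pi_bernoulli:
  assumes "finite A"
  shows "finite (set_pmf (Pi_pmf A False (\<lambda>e. bernoulli_pmf (P e))))"
proof (rule finite_subset)
  show "set_pmf (Pi_pmf A False (\<lambda>e. bernoulli_pmf (P e))) \<subseteq> PiE_dflt A False (\<lambda>_. UNIV)"
    by (rule set_Pi_pmf_subset'[OF assms, THEN order_trans]) (auto simp: PiE_dflt_def)
  show "finite (PiE_dflt A False (\<lambda>_. UNIV :: bool set))"
    using assms by (intro finite_PiE_dflt) auto
qed

lemma integrable_Pi_bernoulli: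
  fixes F :: "('a \<Rightarrow> bool) \<Rightarrow> real"
  assumes "finite A"
  shows "integrable (measure_pmf (Pi_pmf A False (\<lambda>e. bernoulli_pmf (P e)))) F"
  by (rule integrable_measure_pmf_finite[OF finite_set_Pi_bernoulli[OF assms]])

lemma expectation_exp_Pi_bernoulli_le:
  fixes w :: "'a \<Rightarrow> real"
  assumes "finite A" and P: "\<And>e. e \<in> A \<Longrightarrow> 0 \<le> P e \<and> P e \<le> 1"
  shows "measure_pmf.expectation (Pi_pmf A False (\<lambda>e. bernoulli_pmf (P e)))
           (\<lambda>x. exp (\<Sum>e\<in>A. w e * of_bool (x e))) \<le> exp (\<Sum>e\<in>A. P e * (exp (w e) - 1))"
proof -
  have "measure_pmf.expectation (Pi_pmf A False (\<lambda>e. bernoulli_pmf (P e)))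
           (\<lambda>x. exp (\<Sum>e\<in>A. w e * of_bool (x e)))
      = measure_pmf.expectation (Pi_pmf A False (\<lambda>e. bernoulli_pmf (P e)))
           (\<lambda>x. \<Prod>e\<in>A. exp (w e * of_bool (x e)))"
    by (simp only: exp_sum[OF assms(1)])
  also have "\<dots> = (\<Prod>e\<in>A. measure_pmf.expectation (bernoulli_pmf (P e)) (\<lambda>v. exp (w e * of_bool v)))"
    by (rule expectation_prod_Pi_pmf[OF assms(1)]) (auto intro!: integrable_measure_pmf_finite)
  also have "\<dots> \<le> (\<Prod>e\<in>A. exp (P e * (exp (w e) - 1)))"
  proof (rule prod_mono, safe)
    fix e assume e: "e \<in> A"
    have "measure_pmf.expectation (bernoulli_pmf (P e)) (\<lambda>v. exp (w e * of_bool v))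
        = 1 + P e * (exp (w e) - 1)" using P[OF e] by (simp add: algebra_simps)
    also have "\<dots> \<le> exp (P e * (exp (w e) - 1))" by (rule exp_ge_add_one_self)
    finally show "measure_pmf.expectation (bernoulli_pmf (P e)) (\<lambda>v. exp (w e * of_bool v))
        \<le> exp (P e * (exp (w e) - 1))" .
    show "0 \<le> measure_pmf.expectation (bernoulli_pmf (P e)) (\<lambda>v. exp (w e * of_bool v))"
      by (rule integral_nonneg_AE) auto
  qed
  also have "\<dots> = exp (\<Sum>e\<in>A. P e * (exp (w e) - 1))"
    by (simp add: exp_sum assms(1))
  finally show ?thesis .
qed

lemma prob_exp_Markov:
  fixes F :: "('a \<Rightarrow> bool) \<Rightarrow> real"
  assumes "finite A"
  shows "measure_pmf.prob (Pi_pmf A False (\<lambda>e. bernoulli_pmf (P e))) {x. a \<le> F x}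
         \<le> measure_pmf.expectation (Pi_pmf A False (\<lambda>e. bernoulli_pmf (P e))) (\<lambda>x. exp (F x)) / exp a"
    (is "measure_pmf.prob ?M _ \<le> _")
proof -
  have "{x. a \<le> F x} = {x \<in> space ?M. exp a \<le> exp (F x)}" by auto
  then show ?thesis
    using integral_Markov_inequality_measure[OF integrable_Pi_bernoulli[OF assms], where A="space ?M" and c="exp a"
       and u="\<lambda>x. exp (F x)"]
    by (simp add: )
qed

text \<open>
  Every tail estimate below for a linear function of the hyperedges comes from this bound. The weights carry
  the Laplace parameter: negative weights give lower tails, and weights of both signs compare two sums.
\<close>

lemma Chernoff_weighted:
  fixes w :: "'a \<Rightarrow> real"
  assumes "finite A" and P: "\<And>e. e \<in> A \<Longrightarrow> 0 \<le> P e \<and> P e \<le> 1"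
    and b: "(\<Sum>e\<in>A. P e * (exp (w e) - 1)) \<le> b"
  shows "measure_pmf.prob (Pi_pmf A False (\<lambda>e. bernoulli_pmf (P e)))
           {x. a \<le> (\<Sum>e\<in>A. w e * of_bool (x e))} \<le> exp (b - a)"
proof -
  have "measure_pmf.prob (Pi_pmf A False (\<lambda>e. bernoulli_pmf (P e)))
           {x. a \<le> (\<Sum>e\<in>A. w e * of_bool (x e))} \<le> exp (\<Sum>e\<in>A. P e * (exp (w e) - 1)) / exp a"
    using prob_exp_Markov[OF assms(1), of P a "\<lambda>x. \<Sum>e\<in>A. w e * of_bool (x e)"]
      divide_right_mono[OF expectation_exp_Pi_bernoulli_le[where P=P and w=w, OF assms(1) P], of "exp a"]
    by fastforce
  also have "\<dots> \<le> exp b / exp a" using b by (intro divide_right_mono) auto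
  finally show ?thesis by (simp add: exp_diff)
qed

lemma Chernoff_count:
  assumes "finite A" and P: "\<And>e. e \<in> A \<Longrightarrow> 0 \<le> P e \<and> P e \<le> 1"
    and "E \<subseteq> A" and "(\<Sum>e\<in>E. P e) \<le> \<mu>" and "s \<ge> 0"
  shows "measure_pmf.prob (Pi_pmf A False (\<lambda>e. bernoulli_pmf (P e)))
           {x. l \<le> (\<Sum>e\<in>E. of_bool (x e))} \<le> exp (\<mu> * (exp s - 1) - s * l)"
proof -
  define w where "w e = (if e \<in> E then s else 0)" for e
  have "(\<Sum>e\<in>A. P e * (exp (w e) - 1)) = (\<Sum>e\<in>E. P e * (exp (w e) - 1))"
    by (rule sum.mono_neutral_right) (use assms in \<open>auto simp: w_def\<close>)
  also have "\<dots> = (\<Sum>e\<in>E. P e) * (exp s - 1)"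
    by (simp add: w_def sum_distrib_right)
  also have "\<dots> \<le> \<mu> * (exp s - 1)"
    using assms(4,5) by (intro mult_right_mono) auto
  finally have b: "(\<Sum>e\<in>A. P e * (exp (w e) - 1)) \<le> \<mu> * (exp s - 1)" .
  have s: "(\<Sum>e\<in>A. w e * of_bool (x e)) = s * (\<Sum>e\<in>E. of_bool (x e))" for x
  proof -
    have "(\<Sum>e\<in>A. w e * of_bool (x e)) = (\<Sum>e\<in>E. w e * of_bool (x e))"
      by (rule sum.mono_neutral_right) (use assms in \<open>auto simp: w_def\<close>)
    also have "\<dots> = s * (\<Sum>e\<in>E. of_bool (x e))"
      unfolding sum_distrib_left by (rule sum.cong) (auto simp: w_def)
    finally show ?thesis .
  qed
  have "measure_pmf.prob (Pi_pmf A False (\<lambda>e. bernoulli_pmf (P e))) {x. l \<le> (\<Sum>e\<in>E. of_bool (x e))}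
     \<le> measure_pmf.prob (Pi_pmf A False (\<lambda>e. bernoulli_pmf (P e)))
           {x. s * l \<le> (\<Sum>e\<in>A. w e * of_bool (x e))}"
    unfolding s using assms(5) by (intro measure_pmf.finite_measure_mono) (auto intro: mult_left_mono)
  also have "\<dots> \<le> exp (\<mu> * (exp s - 1) - s * l)"
    by (rule Chernoff_weighted[OF assms(1) P b])
  finally show ?thesis .
qed

lemma expectation_Pi_bernoulli_insert:
  fixes F :: "('a \<Rightarrow> bool) \<Rightarrow> real"
  assumes "finite A" "a \<notin> A" "0 \<le> P a" "P a \<le> 1"
  shows "measure_pmf.expectation (Pi_pmf (insert a A) False (\<lambda>e. bernoulli_pmf (P e))) F
    = P a * measure_pmf.expectation (Pi_pmf A False (\<lambda>e. bernoulli_pmf (P e))) (\<lambda>x. F (x(a := True)))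
      + (1 - P a) * measure_pmf.expectation (Pi_pmf A False (\<lambda>e. bernoulli_pmf (P e))) (\<lambda>x. F (x(a := False)))"
proof -
  let ?M = "Pi_pmf A False (\<lambda>e. bernoulli_pmf (P e))"
  have fin: "finite (set_pmf ?M)"
    by (rule finite_set_Pi_bernoulli[OF assms(1)])
  have "measure_pmf.expectation (Pi_pmf (insert a A) False (\<lambda>e. bernoulli_pmf (P e))) F
     = measure_pmf.expectation (bind_pmf (bernoulli_pmf (P a)) (\<lambda>y. map_pmf (\<lambda>f. f(a := y)) ?M)) F"
    by (simp add: Pi_pmf_insert'[OF assms(1,2)] map_pmf_def)
  also have "\<dots> = (\<Sum>y\<in>UNIV. pmf (bernoulli_pmf (P a)) y *\<^sub>R measure_pmf.expectation (map_pmf (\<lambda>f. f(a := y)) ?M) F)"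
    by (rule pmf_expectation_bind) (auto simp: fin)
  also have "\<dots> = P a * measure_pmf.expectation ?M (\<lambda>x. F (x(a := True)))
      + (1 - P a) * measure_pmf.expectation ?M (\<lambda>x. F (x(a := False)))"
    using assms(3,4) by (simp add: UNIV_bool)
  finally show ?thesis .
qed

lemma second_moment_Pi_bernoulli_le:
  fixes c :: "'a \<Rightarrow> real"
  assumes "finite A" and P: "\<And>e. e \<in> A \<Longrightarrow> 0 \<le> P e \<and> P e \<le> 1"
  shows "measure_pmf.expectation (Pi_pmf A False (\<lambda>e. bernoulli_pmf (P e)))
           (\<lambda>x. (\<Sum>e\<in>A. c e * (of_bool (x e) - P e))\<^sup>2) \<le> (\<Sum>e\<in>A. (c e)\<^sup>2 * P e)"
    (is "measure_pmf.expectation (?M A) (\<lambda>x. (?Z A x)\<^sup>2) \<le> _")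
proof -
  \<comment> \<open>The first moment is carried along because the cross terms of the square contain it.\<close>
  have "measure_pmf.expectation (?M A) (?Z A) = 0 \<and>
        measure_pmf.expectation (?M A) (\<lambda>x. (?Z A x)\<^sup>2) \<le> (\<Sum>e\<in>A. (c e)\<^sup>2 * P e)"
    using assms
  proof (induction A rule: finite_induct)
    case empty
    then show ?case by simp
  next
    case (insert a A)
    have pa: "0 \<le> P a" "P a \<le> 1" using insert.prems by auto
    have IH: "measure_pmf.expectation (?M A) (?Z A) = 0"
      "measure_pmf.expectation (?M A) (\<lambda>x. (?Z A x)\<^sup>2) \<le> (\<Sum>e\<in>A. (c e)\<^sup>2 * P e)"
      using insert by auto
    have upd: "?Z A (x(a := b)) = ?Z A x" for x b
      using insert.hyps by (intro sum.cong) auto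
    have Zi: "?Z (insert a A) (x(a := b)) = c a * (of_bool b - P a) + ?Z A x" for x b
      using insert.hyps upd by simp
    note int[simp] = integrable_Pi_bernoulli[OF insert.hyps(1)]
    have lin: "measure_pmf.expectation (?M A) (\<lambda>x. t + ?Z A x) = t" for t
      using IH(1) by (subst Bochner_Integration.integral_add) (auto intro: int)
    have sq: "measure_pmf.expectation (?M A) (\<lambda>x. (t + ?Z A x)\<^sup>2)
       = t\<^sup>2 + measure_pmf.expectation (?M A) (\<lambda>x. (?Z A x)\<^sup>2)" for t
    proof -
      have "(\<lambda>x. (t + ?Z A x)\<^sup>2) = (\<lambda>x. t\<^sup>2 + (2 * t * ?Z A x + (?Z A x)\<^sup>2))"
        by (auto simp: power2_eq_square algebra_simps)
      then have "measure_pmf.expectation (?M A) (\<lambda>x. (t + ?Z A x)\<^sup>2)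
        = measure_pmf.expectation (?M A) (\<lambda>x. t\<^sup>2 + (2 * t * ?Z A x + (?Z A x)\<^sup>2))" by simp
      also have "\<dots> = t\<^sup>2 + (2 * t * measure_pmf.expectation (?M A) (?Z A)
           + measure_pmf.expectation (?M A) (\<lambda>x. (?Z A x)\<^sup>2))"
        by (simp add: int)
      finally show ?thesis using IH(1) by simp
    qed
    have 1: "measure_pmf.expectation (?M (insert a A)) (?Z (insert a A)) = 0"
      unfolding expectation_Pi_bernoulli_insert[where P=P and a=a and A=A, OF insert.hyps pa] Zi lin
      by (simp add: algebra_simps)
    have "measure_pmf.expectation (?M (insert a A)) (\<lambda>x. (?Z (insert a A) x)\<^sup>2)
      = (c a)\<^sup>2 * P a * (1 - P a) + measure_pmf.expectation (?M A) (\<lambda>x. (?Z A x)\<^sup>2)"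
      unfolding expectation_Pi_bernoulli_insert[where P=P and a=a and A=A, OF insert.hyps pa] Zi sq
      by (simp add: power2_eq_square algebra_simps)
    also have "\<dots> \<le> (c a)\<^sup>2 * P a + (\<Sum>e\<in>A. (c e)\<^sup>2 * P e)"
      using pa by (intro add_mono IH(2)) (simp add: mult_left_le)
    finally show ?case using 1 insert.hyps by simp
  qed
  then show ?thesis by simp
qed

lemma expectation_prod_blocks:
  fixes F :: "'i \<Rightarrow> ('a \<Rightarrow> bool) \<Rightarrow> real"
  assumes "finite A" "finite I" and sub: "\<And>i. i \<in> I \<Longrightarrow> E i \<subseteq> A" and dis: "disjoint_family_on E I"
    and loc: "\<And>i x. i \<in> I \<Longrightarrow> F i (restrict x (E i)) = F i x"
  shows "measure_pmf.expectation (Pi_pmf A False (\<lambda>e. bernoulli_pmf (P e))) (\<lambda>x. \<Prod>i\<in>I. F i x)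
       = (\<Prod>i\<in>I. measure_pmf.expectation (Pi_pmf A False (\<lambda>e. bernoulli_pmf (P e))) (F i))"
proof -
  let ?M = "Pi_pmf A False (\<lambda>e. bernoulli_pmf (P e))"
  have fE: "finite (E i)" if "i \<in> I" for i using sub[OF that] assms(1) finite_subset by blast
  have "prob_space.indep_vars (measure_pmf ?M) (\<lambda>i. PiM (E i) (\<lambda>_. count_space UNIV))
          (\<lambda>i x. restrict (\<lambda>e. x e) (E i)) I"
    by (rule prob_space.indep_vars_restrict[OF measure_pmf.prob_space_axioms indep_vars_Pi_pmf[OF assms(1)] sub dis])
  then have "prob_space.indep_vars (measure_pmf ?M) (\<lambda>_. borel) (\<lambda>i x. F i (restrict (\<lambda>e. x e) (E i))) I"
  proof (rule prob_space.indep_vars_compose2[OF measure_pmf.prob_space_axioms])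
    fix i assume "i \<in> I"
    have "PiM (E i) (\<lambda>_. count_space (UNIV :: bool set)) = count_space (PiE (E i) (\<lambda>_. UNIV))"
      using fE[OF \<open>i \<in> I\<close>] by (intro count_space_PiM_finite) auto
    then show "F i \<in> borel_measurable (PiM (E i) (\<lambda>_. count_space UNIV))" by simp
  qed
  then have "prob_space.indep_vars (measure_pmf ?M) (\<lambda>_. borel) F I"
    by (rule prob_space.indep_vars_cong[OF measure_pmf.prob_space_axioms, THEN iffD1, rotated -1]) (auto simp: loc fun_eq_iff)
  then show ?thesis
    by (intro prob_space.indep_vars_lebesgue_integral[OF measure_pmf.prob_space_axioms] assms integrable_Pi_bernoulli)
qed

text \<open>
  The sum of squares has no useful exponential moment, because one block may see many events. So the
  squares are truncated at \<open>L\<^sup>2\<close>, which is harmless unless some block sees more than \<open>l\<close> events, and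
  the truncated squares have the same mean bound \<open>\<mu>\<close>.
\<close>

lemma sum_squares_blocks_tail:
  fixes c :: "'i \<Rightarrow> 'a \<Rightarrow> real" and \<mu> s l b :: real
  assumes "finite A" "finite I" and sub: "\<And>i. i \<in> I \<Longrightarrow> E i \<subseteq> A" and dis: "disjoint_family_on E I"
    and P: "\<And>e. e \<in> A \<Longrightarrow> 0 \<le> P e \<and> P e \<le> 1"
    and c: "\<And>i e. i \<in> I \<Longrightarrow> e \<in> E i \<Longrightarrow> \<bar>c i e\<bar> \<le> 1"
    and \<mu>: "\<And>i. i \<in> I \<Longrightarrow> (\<Sum>e\<in>E i. P e) \<le> \<mu>" "\<mu> \<ge> 0"
    and "s \<ge> 0" "l > 0"
  shows "measure_pmf.prob (Pi_pmf A False (\<lambda>e. bernoulli_pmf (P e)))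
           {x. b \<le> (\<Sum>i\<in>I. (\<Sum>e\<in>E i. c i e * (of_bool (x e) - P e))\<^sup>2)}
     \<le> card I * exp (\<mu> * (exp s - 1) - s * l) + exp ((2 * card I * \<mu> - b) / (l + \<mu>)\<^sup>2)"
proof -
  define M where "M = Pi_pmf A False (\<lambda>e. bernoulli_pmf (P e))"
  define Z where "Z i x = (\<Sum>e\<in>E i. c i e * (of_bool (x e) - P e))" for i and x :: "'a \<Rightarrow> bool"
  define L where "L = l + \<mu>"
  define Y where "Y i x = min ((Z i x)\<^sup>2) (L\<^sup>2) / L\<^sup>2" for i x
  have L: "L > 0" using assms by (simp add: L_def)
  have fE: "finite (E i)" if "i \<in> I" for i using sub[OF that] assms(1) finite_subset by blast
  have P': "0 \<le> P e \<and> P e \<le> 1" if "i \<in> I" "e \<in> E i" for i e using sub P that by blast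
  have int: "integrable (measure_pmf M) F" for F :: "('a \<Rightarrow> bool) \<Rightarrow> real"
    unfolding M_def by (rule integrable_Pi_bernoulli[OF assms(1)])
  have Zl: "\<bar>Z i x\<bar> \<le> L" if "i \<in> I" "(\<Sum>e\<in>E i. of_bool (x e)) < l" for i x
  proof -
    have "\<bar>Z i x\<bar> \<le> (\<Sum>e\<in>E i. of_bool (x e) + P e)"
      unfolding Z_def
    proof (rule order_trans[OF sum_abs], rule sum_mono)
      fix e assume e: "e \<in> E i"
      have "\<bar>c i e * (of_bool (x e) - P e)\<bar> \<le> 1 * \<bar>of_bool (x e) - P e\<bar>"
        unfolding abs_mult by (intro mult_right_mono c that e) auto
      also have "\<dots> \<le> of_bool (x e) + P e" using P'[OF that(1) e] by auto
      finally show "\<bar>c i e * (of_bool (x e) - P e)\<bar> \<le> of_bool (x e) + P e" .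
    qed
    also have "\<dots> \<le> L" using that(2) \<mu>(1)[OF that(1)] unfolding sum.distrib L_def by linarith
    finally show ?thesis .
  qed
  have EY: "measure_pmf.expectation M (\<lambda>x. exp (Y i x)) \<le> exp (2 * \<mu> / L\<^sup>2)" if i: "i \<in> I" for i
  proof -
    define c' where "c' e = (if e \<in> E i then c i e else 0)" for e
    have "measure_pmf.expectation M (\<lambda>x. exp (Y i x)) \<le> measure_pmf.expectation M (\<lambda>x. 1 + 2 / L\<^sup>2 * (Z i x)\<^sup>2)"
    proof (rule integral_mono[OF int int])
      fix x
      have Y01: "0 \<le> Y i x" "Y i x \<le> 1" using L by (auto simp: Y_def divide_simps)
      have "exp (Y i x) \<le> 1 + 2 * Y i x"
        using exp_bound[OF Y01] mult_left_le[of "Y i x" "Y i x"] Y01 by (simp add: power2_eq_square)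
      also have "\<dots> \<le> 1 + 2 / L\<^sup>2 * (Z i x)\<^sup>2" using L by (auto simp: Y_def divide_simps)
      finally show "exp (Y i x) \<le> 1 + 2 / L\<^sup>2 * (Z i x)\<^sup>2" .
    qed
    also have "\<dots> = 1 + 2 / L\<^sup>2 * measure_pmf.expectation M (\<lambda>x. (Z i x)\<^sup>2)"
      by (subst Bochner_Integration.integral_add) (auto simp: int)
    finally have 1: "measure_pmf.expectation M (\<lambda>x. exp (Y i x))
        \<le> 1 + 2 / L\<^sup>2 * measure_pmf.expectation M (\<lambda>x. (Z i x)\<^sup>2)" .
    have "measure_pmf.expectation M (\<lambda>x. (Z i x)\<^sup>2)
        = measure_pmf.expectation M (\<lambda>x. (\<Sum>e\<in>A. c' e * (of_bool (x e) - P e))\<^sup>2)"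
    proof -
      have "Z i x = (\<Sum>e\<in>A. c' e * (of_bool (x e) - P e))" for x
        unfolding Z_def c'_def by (rule sum.mono_neutral_cong_left) (use assms(1) sub[OF i] in auto)
      then show ?thesis by simp
    qed
    also have "\<dots> \<le> (\<Sum>e\<in>A. (c' e)\<^sup>2 * P e)"
      unfolding M_def by (rule second_moment_Pi_bernoulli_le[OF assms(1) P])
    also have "(\<Sum>e\<in>A. (c' e)\<^sup>2 * P e) = (\<Sum>e\<in>E i. (c i e)\<^sup>2 * P e)"
      unfolding c'_def by (rule sum.mono_neutral_cong_right) (use assms(1) sub[OF i] in auto)
    also have "\<dots> \<le> (\<Sum>e\<in>E i. P e)"
    proof (rule sum_mono)
      fix e assume e: "e \<in> E i"
      have "(c i e)\<^sup>2 \<le> 1" using c[OF i e] by (simp add: abs_square_le_1)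
      then show "(c i e)\<^sup>2 * P e \<le> P e" using P'[OF i e] by (simp add: mult_left_le_one_le)
    qed
    also have "\<dots> \<le> \<mu>" by (rule \<mu>(1)[OF i])
    finally have "2 / L\<^sup>2 * measure_pmf.expectation M (\<lambda>x. (Z i x)\<^sup>2) \<le> 2 / L\<^sup>2 * \<mu>"
      by (rule mult_left_mono) simp
    with 1 have "measure_pmf.expectation M (\<lambda>x. exp (Y i x)) \<le> 1 + 2 / L\<^sup>2 * \<mu>" by linarith
    also have "\<dots> \<le> exp (2 * \<mu> / L\<^sup>2)" using exp_ge_add_one_self[of "2 * \<mu> / L\<^sup>2"] by simp
    finally show ?thesis .
  qed
  have "measure_pmf.prob M {x. b / L\<^sup>2 \<le> (\<Sum>i\<in>I. Y i x)}
      \<le> measure_pmf.expectation M (\<lambda>x. exp (\<Sum>i\<in>I. Y i x)) / exp (b / L\<^sup>2)"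
    unfolding M_def by (rule prob_exp_Markov[OF assms(1)])
  also have "measure_pmf.expectation M (\<lambda>x. exp (\<Sum>i\<in>I. Y i x))
      = measure_pmf.expectation M (\<lambda>x. \<Prod>i\<in>I. exp (Y i x))"
    by (simp add: exp_sum assms(2))
  also have "\<dots> = (\<Prod>i\<in>I. measure_pmf.expectation M (\<lambda>x. exp (Y i x)))"
    unfolding M_def by (rule expectation_prod_blocks[OF assms(1,2) sub dis]) (auto simp: Y_def Z_def)
  also have "\<dots> \<le> (\<Prod>i\<in>I. exp (2 * \<mu> / L\<^sup>2))"
    by (intro prod_mono conjI EY integral_nonneg_AE) auto
  also have "\<dots> = exp (card I * (2 * \<mu> / L\<^sup>2))" by (simp only: prod_constant exp_of_nat_mult)
  finally have t1: "measure_pmf.prob M {x. b / L\<^sup>2 \<le> (\<Sum>i\<in>I. Y i x)} \<le> exp ((2 * card I * \<mu> - b) / L\<^sup>2)"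
    by (simp add: divide_right_mono exp_diff[symmetric] diff_divide_distrib mult_ac)
  have t2: "measure_pmf.prob M (\<Union>i\<in>I. {x. l \<le> (\<Sum>e\<in>E i. of_bool (x e))})
      \<le> (\<Sum>i\<in>I. exp (\<mu> * (exp s - 1) - s * l))"
    by (rule order_trans[OF measure_pmf.finite_measure_subadditive_finite[OF assms(2)]], simp, rule sum_mono)
       (use assms(9) in \<open>auto simp: M_def intro!: Chernoff_count[OF assms(1) P sub \<mu>(1)]\<close>)
  have "{x. b \<le> (\<Sum>i\<in>I. (Z i x)\<^sup>2)}
      \<subseteq> (\<Union>i\<in>I. {x. l \<le> (\<Sum>e\<in>E i. of_bool (x e))}) \<union> {x. b / L\<^sup>2 \<le> (\<Sum>i\<in>I. Y i x)}"
  proof (rule subsetI, rule ccontr)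
    fix x assume "x \<in> {x. b \<le> (\<Sum>i\<in>I. (Z i x)\<^sup>2)}"
      and out: "x \<notin> (\<Union>i\<in>I. {x. l \<le> (\<Sum>e\<in>E i. of_bool (x e))}) \<union> {x. b / L\<^sup>2 \<le> (\<Sum>i\<in>I. Y i x)}"
    then have bx: "b \<le> (\<Sum>i\<in>I. (Z i x)\<^sup>2)" and n: "\<not> b / L\<^sup>2 \<le> (\<Sum>i\<in>I. Y i x)" by auto
    from out have "x \<notin> (\<Union>i\<in>I. {x. l \<le> (\<Sum>e\<in>E i. of_bool (x e))})" by blast
      then have small: "\<bar>Z i x\<bar> \<le> L" if "i \<in> I" for i using Zl[OF that, of x] that by force
      have "(Z i x)\<^sup>2 \<le> L\<^sup>2" if "i \<in> I" for i
        using small[OF that] L by (simp add: abs_le_square_iff[symmetric])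
      then have "(\<Sum>i\<in>I. Y i x) = (\<Sum>i\<in>I. (Z i x)\<^sup>2 / L\<^sup>2)"
        by (intro sum.cong) (auto simp: Y_def min_def)
      also have "\<dots> \<ge> b / L\<^sup>2" using bx unfolding sum_divide_distrib[symmetric] by (intro divide_right_mono) auto
      finally show False using n by simp
  qed
  then have "measure_pmf.prob M {x. b \<le> (\<Sum>i\<in>I. (Z i x)\<^sup>2)}
      \<le> measure_pmf.prob M (\<Union>i\<in>I. {x. l \<le> (\<Sum>e\<in>E i. of_bool (x e))})
        + measure_pmf.prob M {x. b / L\<^sup>2 \<le> (\<Sum>i\<in>I. Y i x)}"
    by (intro order_trans[OF measure_pmf.finite_measure_mono measure_Un_le]) auto
  also have "\<dots> \<le> card I * exp (\<mu> * (exp s - 1) - s * l) + exp ((2 * card I * \<mu> - b) / L\<^sup>2)"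
    using t1 t2 by simp
  finally show ?thesis by (simp add: M_def Z_def L_def)
qed

section \<open>Labellings and assignment matrices\<close>

definition label_mat :: "nat \<Rightarrow> nat \<Rightarrow> (nat \<Rightarrow> nat) \<Rightarrow> real mat" where
  "label_mat n K h = mat n K (\<lambda>(i, k). of_bool (h i = k))"

definition labellings :: "nat \<Rightarrow> nat \<Rightarrow> (nat \<Rightarrow> nat) set" where
  "labellings n K = {h. \<forall>i<n. h i < K}"

definition balanced_labellings :: "nat \<Rightarrow> nat \<Rightarrow> (nat \<Rightarrow> nat) set" where
  "balanced_labellings n K = {h \<in> labellings n K. \<forall>k<K. card {i. i < n \<and> h i = k} = n div K}"

definition mismatches :: "nat \<Rightarrow> (nat \<Rightarrow> nat) \<Rightarrow> (nat \<Rightarrow> nat) \<Rightarrow> nat set" where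
  "mismatches n g h = {i. i < n \<and> h i \<noteq> g i}"

lemma mismatches_subset: "mismatches n g h \<subseteq> {..<n}"
  by (auto simp: mismatches_def)

lemma finite_mismatches [simp]: "finite (mismatches n g h)"
  by (auto simp: mismatches_def)

lemma label_mat_carrier [simp]: "label_mat n K h \<in> carrier_mat n K"
  by (simp add: label_mat_def)

lemma label_mat_dims [simp]: "dim_row (label_mat n K h) = n" "dim_col (label_mat n K h) = K"
  by (simp_all add: label_mat_def)

lemma label_mat_index [simp]: "i < n \<Longrightarrow> k < K \<Longrightarrow> label_mat n K h $$ (i, k) = of_bool (h i = k)"
  by (simp add: label_mat_def)

lemma label_mat_cong: "(\<And>i. i < n \<Longrightarrow> g i = h i) \<Longrightarrow> label_mat n K g = label_mat n K h"
  by (auto simp: label_mat_def)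

lemma assignment_mats_label:
  assumes "H \<in> assignment_mats n K"
  obtains h where "h \<in> labellings n K" "H = label_mat n K h"
proof -
  have "\<forall>i. \<exists>k. i < n \<longrightarrow> k < K \<and> H $$ (i, k) = 1 \<and> (\<forall>l<K. l \<noteq> k \<longrightarrow> H $$ (i, l) = 0)"
    using assms by (auto simp: assignment_mats_def)
  then obtain h where h: "\<And>i. i < n \<Longrightarrow> h i < K \<and> H $$ (i, h i) = 1 \<and> (\<forall>l<K. l \<noteq> h i \<longrightarrow> H $$ (i, l) = 0)"
    by metis
  have "H = label_mat n K h"
    using assms h by (intro eq_matI) (auto simp: assignment_mats_def)
  with h that show thesis by (auto simp: labellings_def)
qed

lemma sum_of_bool_class:
  assumes "finite A" shows "(\<Sum>i\<in>A. of_bool (P i) :: real) = card {i \<in> A. P i}"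
  using assms by (auto simp: of_bool_def sum.If_cases Int_def)

lemma balanced_label_mat:
  assumes "h \<in> balanced_labellings n K"
  shows "label_mat n K h \<in> balanced_assignments n K"
proof -
  have h: "h i < K" if "i < n" for i using assms that by (auto simp: balanced_labellings_def labellings_def)
  have c: "card {i. i < n \<and> h i = k} = n div K" if "k < K" for k
    using assms that by (auto simp: balanced_labellings_def)
  have r: "(\<Sum>k<K. of_bool (h i = k) :: real) = 1" if "i < n" for i
  proof -
    have "{k \<in> {..<K}. h i = k} = {h i}" using h[OF that] by auto
    then show ?thesis by (simp add: sum_of_bool_class del: sum_of_bool_eq)
  qed
  have s: "(\<Sum>i<n. of_bool (h i = k) :: real) = n div K" if "k < K" for k
    using c[OF that] by (simp add: sum_of_bool_class del: sum_of_bool_eq)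
  have "label_mat n K h *\<^sub>v ones_vec K = ones_vec n"
    using r by (intro eq_vecI) (simp_all add: ones_vec_def scalar_prod_def lessThan_atLeast0 del: sum_of_bool_eq)
  moreover have "transpose_mat (label_mat n K h) *\<^sub>v ones_vec n = real (n div K) \<cdot>\<^sub>v ones_vec K"
    using s by (intro eq_vecI) (simp_all add: ones_vec_def scalar_prod_def lessThan_atLeast0 del: sum_of_bool_eq)
  ultimately show ?thesis
    unfolding balanced_assignments_def by (auto simp: elements_mat_def)
qed

lemma balanced_assignments_label:
  assumes "H \<in> balanced_assignments n K"
  obtains h where "h \<in> balanced_labellings n K" "H = label_mat n K h"
proof -
  have car: "H \<in> carrier_mat n K" and el: "elements_mat H \<subseteq> {0, 1}"
    and r: "H *\<^sub>v ones_vec K = ones_vec n"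
    and c: "transpose_mat H *\<^sub>v ones_vec n = real (n div K) \<cdot>\<^sub>v ones_vec K"
    using assms by (auto simp: balanced_assignments_def)
  have ent: "H $$ (i, k) = 0 \<or> H $$ (i, k) = 1" if "i < n" "k < K" for i k
    using el car that by (force simp: elements_mat_def)
  have row: "(\<Sum>k<K. H $$ (i, k)) = 1" if "i < n" for i
    using arg_cong[OF r, of "\<lambda>v. v $ i"] car that
    by (simp add: ones_vec_def scalar_prod_def lessThan_atLeast0)
  have col: "(\<Sum>i<n. H $$ (i, k)) = real (n div K)" if "k < K" for k
    using arg_cong[OF c, of "\<lambda>v. v $ k"] car that
    by (simp add: ones_vec_def scalar_prod_def lessThan_atLeast0)
  have "H \<in> assignment_mats n K"
    unfolding assignment_mats_def
  proof (intro CollectI conjI allI impI car)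
    fix i assume i: "i < n"
    have "(\<Sum>k<K. H $$ (i, k)) = (\<Sum>k<K. of_bool (H $$ (i, k) = 1))"
      using ent[OF i] by (intro sum.cong) auto
    also have "\<dots> = card {k\<in>{..<K}. H $$ (i, k) = 1}" by (rule sum_of_bool_class) simp
    finally have "card {k\<in>{..<K}. H $$ (i, k) = 1} = 1" using row[OF i] by simp
    then obtain k where k: "{k\<in>{..<K}. H $$ (i, k) = 1} = {k}" by (rule card_1_singletonE)
    then show "\<exists>k<K. H $$ (i, k) = 1 \<and> (\<forall>l<K. l \<noteq> k \<longrightarrow> H $$ (i, l) = 0)"
      using ent[OF i] by (intro exI[of _ k]) (auto simp: set_eq_iff)
  qed
  then obtain h where h: "h \<in> labellings n K" and H: "H = label_mat n K h"
    by (rule assignment_mats_label)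
  have "card {i. i < n \<and> h i = k} = n div K" if k: "k < K" for k
  proof -
    have "real (card {i\<in>{..<n}. h i = k}) = (\<Sum>i<n. of_bool (h i = k))" by (rule sum_of_bool_class[symmetric]) simp
    also have "\<dots> = (\<Sum>i<n. H $$ (i, k))" using H k by (intro sum.cong) auto
    also have "\<dots> = real (n div K)" by (rule col[OF k])
    finally show ?thesis by simp
  qed
  with h H that show thesis by (auto simp: balanced_labellings_def)
qed

lemma perm_mats_cases:
  assumes "Q \<in> perm_mats K"
  obtains \<sigma> where "\<sigma> permutes {..<K}"
    "\<And>n h. h \<in> labellings n K \<Longrightarrow> label_mat n K h * Q = label_mat n K (\<sigma> \<circ> h)"
proof -
  from assms obtain \<pi> where \<pi>: "\<pi> permutes {..<K}" and Q: "Q = mat K K (\<lambda>(i, j). if i = \<pi> j then 1 else 0)"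
    by (auto simp: perm_mats_def)
  have "label_mat n K h * Q = label_mat n K (inv_into UNIV \<pi> \<circ> h)" if h: "h \<in> labellings n K" for n h
  proof (rule eq_matI)
    fix i j assume ij: "i < dim_row (label_mat n K (inv_into UNIV \<pi> \<circ> h))" "j < dim_col (label_mat n K (inv_into UNIV \<pi> \<circ> h))"
    then have hi: "h i < K" using h by (auto simp: labellings_def)
    have pj: "\<pi> j < K" using permutes_in_image[OF \<pi>] ij by auto
    have "(label_mat n K h * Q) $$ (i, j) = (\<Sum>l<K. of_bool (h i = l) * (if l = \<pi> j then 1 else 0))"
      using ij Q by (auto simp: times_mat_def scalar_prod_def lessThan_atLeast0 intro!: sum.cong)
    also have "\<dots> = (\<Sum>l<K. if l = \<pi> j then of_bool (h i = l) else 0)"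
      by (intro sum.cong) auto
    also have "\<dots> = of_bool (h i = \<pi> j)" using pj by simp
    also have "(h i = \<pi> j) = (inv_into UNIV \<pi> (h i) = j)" using permutes_inv_eq[OF \<pi>] by metis
    finally show "(label_mat n K h * Q) $$ (i, j) = label_mat n K (inv_into UNIV \<pi> \<circ> h) $$ (i, j)"
      using ij by simp
  qed (use Q in auto)
  then show thesis using that permutes_inv[OF \<pi>] by blast
qed

lemma labellings_permute: "h \<in> labellings n K \<Longrightarrow> \<sigma> permutes {..<K} \<Longrightarrow> \<sigma> \<circ> h \<in> labellings n K"
  using permutes_in_image[of \<sigma> "{..<K}"] by (auto simp: labellings_def)

lemma balanced_labellings_permute:
  assumes "h \<in> balanced_labellings n K" and \<sigma>: "\<sigma> permutes {..<K}"
  shows "\<sigma> \<circ> h \<in> balanced_labellings n K"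
proof -
  have "card {i. i < n \<and> (\<sigma> \<circ> h) i = k} = n div K" if k: "k < K" for k
  proof -
    have "{i. i < n \<and> (\<sigma> \<circ> h) i = k} = {i. i < n \<and> h i = inv_into UNIV \<sigma> k}"
      using permutes_inverses[OF \<sigma>] by auto
    moreover have "inv_into UNIV \<sigma> k < K" using permutes_in_image[OF permutes_inv[OF \<sigma>], of k] k by simp
    ultimately show ?thesis using assms by (auto simp: balanced_labellings_def)
  qed
  then show ?thesis using assms labellings_permute by (auto simp: balanced_labellings_def)
qed

lemma sum_squares_label_diff:
  fixes a b K :: nat
  assumes "a < K" "b < K"
  shows "(\<Sum>k<K. (of_bool (a = k) - of_bool (b = k) :: real)\<^sup>2) = 2 * of_bool (a \<noteq> b)"
proof -
  have "(\<Sum>k<K. (of_bool (a = k) - of_bool (b = k) :: real)\<^sup>2)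
      = (\<Sum>k<K. (if k = a then of_bool (a \<noteq> b) else 0) + (if k = b then of_bool (a \<noteq> b) else 0))"
    by (intro sum.cong) auto
  also have "\<dots> = 2 * of_bool (a \<noteq> b)" using assms by (simp add: sum.distrib)
  finally show ?thesis .
qed

lemma frob_norm_label_diff:
  assumes "g \<in> labellings n K" "h \<in> labellings n K"
  shows "frob_norm (label_mat n K h - label_mat n K g) = sqrt (2 * card (mismatches n g h))"
proof -
  have "(\<Sum>i<n. \<Sum>k<K. ((label_mat n K h - label_mat n K g) $$ (i, k))\<^sup>2)
     = (\<Sum>i<n. \<Sum>k<K. (of_bool (h i = k) - of_bool (g i = k))\<^sup>2)"
    by (intro sum.cong arg_cong[of _ _ "\<lambda>x. x\<^sup>2"]) auto
  also have "\<dots> = (\<Sum>i<n. 2 * of_bool (h i \<noteq> g i))"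
    using assms by (intro sum.cong sum_squares_label_diff) (auto simp: labellings_def)
  also have "\<dots> = 2 * real (card {i\<in>{..<n}. h i \<noteq> g i})"
    unfolding sum_distrib_left[symmetric] by (subst sum_of_bool_class) auto
  finally show ?thesis by (simp add: frob_norm_def mismatches_def)
qed

section \<open>The tensor as a sum over hyperedges\<close>

definition stars :: "nat \<Rightarrow> nat \<Rightarrow> nat \<Rightarrow> nat set \<Rightarrow> nat set set" where
  "stars n d i V = {e \<in> node_sets n d. i \<in> e \<and> e - {i} \<subseteq> V}"

lemma finite_node_sets [simp]: "finite (node_sets n d)"
  unfolding node_sets_def by (rule finite_subset[of _ "Pow {..<n}"]) auto

lemma finite_stars [simp]: "finite (stars n d i V)"
  unfolding stars_def by simp

text \<open>
  The tensor vanishes on tuples with repetitions, and each hyperedge through \<open>i\<close> is reached from the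
  \<open>fact (d - 1)\<close> orderings of its other nodes.
\<close>

lemma tensor_power_label_mat:
  assumes "i < n" "k < K" "d \<ge> 1"
  shows "tensor_power n d K (adjacency_tensor n d x) (label_mat n K h) $$ (i, k)
       = fact (d - 1) * (\<Sum>e\<in>stars n d i {j. j < n \<and> h j = k}. of_bool (x e))"
proof -
  let ?V = "{j. j < n \<and> h j = k}"
  define T where "T = {js. length js = d - 1 \<and> set js \<subseteq> {..<n}}"
  define L where "L = {js \<in> T. distinct (i # js) \<and> set js \<subseteq> ?V}"
  have fT: "finite T" unfolding T_def using finite_lists_length_eq[of "{..<n}" "d - 1"] by (simp add: conj_commute)
  have "tensor_power n d K (adjacency_tensor n d x) (label_mat n K h) $$ (i, k)
      = (\<Sum>js\<in>T. adjacency_tensor n d x (i # js) * (\<Prod>j\<leftarrow>js. label_mat n K h $$ (j, k)))"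
    using assms by (simp add: tensor_power_def T_def)
  also have "\<dots> = (\<Sum>js\<in>T. if js \<in> L then of_bool (x (insert i (set js))) else 0)"
  proof (rule sum.cong)
    fix js assume js: "js \<in> T"
    have "(\<Prod>j\<leftarrow>js. label_mat n K h $$ (j, k)) = (\<Prod>j\<leftarrow>js. of_bool (h j = k))"
      using js assms by (intro arg_cong[of _ _ prod_list] map_cong) (auto simp: T_def)
    also have "\<dots> = of_bool (\<forall>j\<in>set js. h j = k)" by (induction js) auto
    finally show "adjacency_tensor n d x (i # js) * (\<Prod>j\<leftarrow>js. label_mat n K h $$ (j, k))
      = (if js \<in> L then of_bool (x (insert i (set js))) else 0)"
      using js assms by (auto simp: adjacency_tensor_def L_def T_def)
  qed simp
  also have "\<dots> = (\<Sum>js\<in>L. of_bool (x (insert i (set js))))"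
    using fT by (intro sum.mono_neutral_cong_right) (auto simp: L_def)
  also have "\<dots> = (\<Sum>e\<in>stars n d i ?V. \<Sum>js | js \<in> L \<and> insert i (set js) = e. of_bool (x (insert i (set js))))"
  proof (rule sum.group[symmetric])
    show "finite L" using fT by (simp add: L_def)
    show "(\<lambda>js. insert i (set js)) ` L \<subseteq> stars n d i ?V"
    proof safe
      fix js assume js: "js \<in> L"
      then have "card (insert i (set js)) = d"
        using assms(3) distinct_card[of "i # js"] by (auto simp: L_def T_def)
      then show "insert i (set js) \<in> stars n d i ?V"
        using js assms by (auto simp: L_def T_def stars_def node_sets_def)
    qed
  qed simp
  also have "\<dots> = (\<Sum>e\<in>stars n d i ?V. fact (d - 1) * of_bool (x e))"
  proof (rule sum.cong[OF refl])
    fix e assume e: "e \<in> stars n d i ?V"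
    then have fe: "finite e" and ce: "card e = d" by (auto simp: stars_def node_sets_def intro: finite_subset)
    have "{js. js \<in> L \<and> insert i (set js) = e} = permutations_of_set (e - {i})"
    proof (rule Set.set_eqI)
      fix js
      have "length js = d - 1" if "distinct js" "set js = e - {i}"
        using that e ce fe distinct_card[of js] by (auto simp: stars_def)
      then show "js \<in> {js. js \<in> L \<and> insert i (set js) = e} \<longleftrightarrow> js \<in> permutations_of_set (e - {i})"
        using e by (auto simp: L_def T_def permutations_of_set_def stars_def node_sets_def)
    qed
    then have "card {js. js \<in> L \<and> insert i (set js) = e} = fact (d - 1)"
      using e fe ce by (simp add: stars_def)
    moreover have "(\<Sum>js | js \<in> L \<and> insert i (set js) = e. of_bool (x (insert i (set js))) :: real)
       = (\<Sum>js | js \<in> L \<and> insert i (set js) = e. of_bool (x e))" by (rule sum.cong[OF refl]) simp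
    ultimately show "(\<Sum>js | js \<in> L \<and> insert i (set js) = e. of_bool (x (insert i (set js))) :: real)
       = fact (d - 1) * of_bool (x e)" by (simp only: sum_constant of_nat_fact)
  qed
  also have "\<dots> = fact (d - 1) * (\<Sum>e\<in>stars n d i ?V. of_bool (x e))" by (rule sum_distrib_left[symmetric])
  finally show ?thesis .
qed

section \<open>One projected power iteration\<close>

definition community :: "nat \<Rightarrow> (nat \<Rightarrow> nat) \<Rightarrow> nat \<Rightarrow> nat set" where
  "community n h k = {j. j < n \<and> h j = k}"

definition touching :: "nat \<Rightarrow> nat \<Rightarrow> nat \<Rightarrow> nat set \<Rightarrow> nat set set" where
  "touching n d i S = {e \<in> node_sets n d. i \<in> e \<and> (e - {i}) \<inter> S \<noteq> {}}"

definition touch_count :: "nat \<Rightarrow> nat \<Rightarrow> nat set \<Rightarrow> (nat set \<Rightarrow> bool) \<Rightarrow> nat \<Rightarrow> real" where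
  "touch_count n d S x i = (\<Sum>e\<in>touching n d i S. of_bool (x e))"

lemma finite_touching [simp]: "finite (touching n d i S)"
  unfolding touching_def by simp

lemma touch_count_empty [simp]: "touch_count n d {} x i = 0"
  by (simp add: touch_count_def touching_def)

lemma stars_community_diff:
  "stars n d i (community n h k) - stars n d i (community n g k) \<subseteq> touching n d i (mismatches n g h)"
  "stars n d i (community n g k) - stars n d i (community n h k) \<subseteq> touching n d i (mismatches n g h)"
  by (fastforce simp: stars_def community_def touching_def mismatches_def node_sets_def)+

lemma sum_stars_diff_le:
  fixes f :: "nat set \<Rightarrow> real"
  assumes "\<And>e. f e \<ge> 0"
  shows "\<bar>(\<Sum>e\<in>stars n d i (community n h k). f e) - (\<Sum>e\<in>stars n d i (community n g k). f e)\<bar>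
       \<le> (\<Sum>e\<in>touching n d i (mismatches n g h). f e)"
proof -
  have le: "(\<Sum>e\<in>A. f e) - (\<Sum>e\<in>B. f e) \<le> (\<Sum>e\<in>C. f e)"
    if "A - B \<subseteq> C" "finite A" "finite B" "finite C" for A B C
  proof -
    have "(\<Sum>e\<in>A. f e) \<le> (\<Sum>e\<in>B \<union> C. f e)" using that assms by (intro sum_mono2) auto
    also have "\<dots> \<le> (\<Sum>e\<in>B. f e) + (\<Sum>e\<in>C. f e)"
      using that assms by (subst sum.union_inter[symmetric]) (auto intro!: sum_nonneg)
    finally show ?thesis by simp
  qed
  show ?thesis
    using le[OF stars_community_diff(1)[of n d i h k g]] le[OF stars_community_diff(2)[of n d i g k h]]
    by (simp add: abs_le_iff)
qed

lemma frob_norm_label_sub_sq: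
  assumes "h \<in> labellings n K" "C \<in> carrier_mat n K"
  shows "(frob_norm (label_mat n K h - C))\<^sup>2
       = n + (\<Sum>i<n. \<Sum>k<K. (C $$ (i, k))\<^sup>2) - 2 * (\<Sum>i<n. C $$ (i, h i))"
proof -
  have "(frob_norm (label_mat n K h - C))\<^sup>2 = (\<Sum>i<n. \<Sum>k<K. ((label_mat n K h - C) $$ (i, k))\<^sup>2)"
    using assms(2) by (simp add: frob_norm_def sum_nonneg)
  also have "\<dots> = (\<Sum>i<n. 1 + (\<Sum>k<K. (C $$ (i, k))\<^sup>2) - 2 * C $$ (i, h i))"
  proof (rule sum.cong[OF refl])
    fix i assume "i \<in> {..<n}"
    then have i: "i < n" "h i < K" using assms(1) by (auto simp: labellings_def)
    have "(\<Sum>k<K. ((label_mat n K h - C) $$ (i, k))\<^sup>2)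
        = (\<Sum>k<K. (C $$ (i, k))\<^sup>2 + (if k = h i then 1 - 2 * C $$ (i, k) else 0))"
      using assms(2) i by (intro sum.cong) (auto simp: power2_eq_square algebra_simps)
    also have "\<dots> = 1 + (\<Sum>k<K. (C $$ (i, k))\<^sup>2) - 2 * C $$ (i, h i)"
      using i by (simp add: sum.distrib)
    finally show "(\<Sum>k<K. ((label_mat n K h - C) $$ (i, k))\<^sup>2) = 1 + (\<Sum>k<K. (C $$ (i, k))\<^sup>2) - 2 * C $$ (i, h i)" .
  qed
  also have "\<dots> = n + (\<Sum>i<n. \<Sum>k<K. (C $$ (i, k))\<^sup>2) - 2 * (\<Sum>i<n. C $$ (i, h i))"
    by (simp add: sum.distrib sum_subtractf sum_distrib_left)
  finally show ?thesis .
qed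

text \<open>
  All labelling matrices have the same norm, so the nearest balanced one maximises the inner product.
\<close>

lemma balanced_proj_optimal:
  assumes "label_mat n K h \<in> balanced_proj n K C" "h \<in> labellings n K"
    and "g \<in> balanced_labellings n K" "C \<in> carrier_mat n K"
  shows "(\<Sum>i<n. C $$ (i, g i)) \<le> (\<Sum>i<n. C $$ (i, h i))"
proof -
  have "frob_norm (label_mat n K h - C) \<le> frob_norm (label_mat n K g - C)"
    using assms(1) balanced_label_mat[OF assms(3)]
    by (auto simp: balanced_proj_def is_arg_min_def not_less)
  then have "(frob_norm (label_mat n K h - C))\<^sup>2 \<le> (frob_norm (label_mat n K g - C))\<^sup>2"
    by (intro power_mono) (auto simp: frob_norm_def intro!: sum_nonneg)
  moreover have "g \<in> labellings n K" using assms(3) by (simp add: balanced_labellings_def)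
  ultimately show ?thesis using assms by (simp add: frob_norm_label_sub_sq)
qed

lemma balanced_proj_label:
  assumes "H \<in> balanced_proj n K C"
  obtains h where "h \<in> balanced_labellings n K" "H = label_mat n K h"
  using assms balanced_assignments_label[of H n K] by (auto simp: balanced_proj_def is_arg_min_def)

text \<open>
  The true labelling competes in the projection of \<open>h\<close>, so that the result is at least as close to \<open>h\<close>;
  the factor \<open>2\<close> is the triangle inequality for the Hamming distance.
\<close>

lemma mismatches_balanced_proj_label_mat:
  assumes "h \<in> labellings n K" "label_mat n K h' \<in> balanced_proj n K (label_mat n K h)"
    "h' \<in> labellings n K" "g \<in> balanced_labellings n K"
  shows "card (mismatches n g h') \<le> 2 * card (mismatches n g h)"
proof -
  have g: "g \<in> labellings n K" using assms(4) by (simp add: balanced_labellings_def)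
  have c: "(\<Sum>i<n. label_mat n K h $$ (i, f i)) = n - real (card (mismatches n h f))"
    if "f \<in> labellings n K" for f
  proof -
    have "(\<Sum>i<n. label_mat n K h $$ (i, f i)) = (\<Sum>i<n. 1 - of_bool (f i \<noteq> h i))"
      using that by (intro sum.cong) (auto simp: labellings_def)
    also have "\<dots> = n - real (card {i\<in>{..<n}. f i \<noteq> h i})"
      unfolding sum_subtractf by (subst sum_of_bool_class) auto
    finally show ?thesis by (simp add: mismatches_def)
  qed
  have "card (mismatches n h h') \<le> card (mismatches n h g)"
    using balanced_proj_optimal[OF assms(2,3,4)] c[OF assms(3)] c[OF g] by simp
  moreover have "card (mismatches n g h') \<le> card (mismatches n h h' \<union> mismatches n h g)"
    by (intro card_mono) (auto simp: mismatches_def)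
  moreover have "\<dots> \<le> card (mismatches n h h') + card (mismatches n h g)" by (rule card_Un_le)
  moreover have "mismatches n h g = mismatches n g h" by (auto simp: mismatches_def)
  ultimately show ?thesis by simp
qed

text \<open>The gap of property (G), in terms of hyperedge counts.\<close>

definition has_gap :: "nat \<Rightarrow> nat \<Rightarrow> nat \<Rightarrow> (nat set \<Rightarrow> bool) \<Rightarrow> (nat \<Rightarrow> nat) \<Rightarrow> real \<Rightarrow> bool" where
  "has_gap n d K x g \<Delta> \<longleftrightarrow> (\<forall>i<n. \<forall>l<K. l \<noteq> g i \<longrightarrow>
     \<Delta> \<le> fact (d - 1) * ((\<Sum>e\<in>stars n d i (community n g (g i)). of_bool (x e))
                         - (\<Sum>e\<in>stars n d i (community n g l). of_bool (x e))))"

text \<open>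
  A node on which the new labelling \<open>h'\<close> errs loses at least \<open>\<Delta>\<close> in the noiseless objective, and
  it can only win this back through the hyperedges that contain an error of the old labelling \<open>h\<close>.
\<close>

lemma projection_step_mismatches:
  assumes "d \<ge> 1" and g: "g \<in> balanced_labellings n K" and h': "h' \<in> labellings n K"
    and opt: "label_mat n K h' \<in> balanced_proj n K (tensor_power n d K (adjacency_tensor n d x) (label_mat n K h))"
    and gap: "has_gap n d K x g \<Delta>"
  shows "\<Delta> * card (mismatches n g h')
       \<le> 2 * fact (d - 1) * (\<Sum>i\<in>mismatches n g h'. touch_count n d (mismatches n g h) x i)"
proof -
  define C where "C = tensor_power n d K (adjacency_tensor n d x) (label_mat n K h)"
  define B where "B f i k = (\<Sum>e\<in>stars n d i (community n f k). of_bool (x e) :: real)" for f i k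
  let ?T = "mismatches n g h'" and ?N = "\<lambda>i. touch_count n d (mismatches n g h) x i"
  have C: "C $$ (i, k) = fact (d - 1) * B h i k" if "i < n" "k < K" for i k
    using tensor_power_label_mat[OF that assms(1)] by (simp add: C_def B_def community_def)
  have carC: "C \<in> carrier_mat n K" by (simp add: C_def tensor_power_def)
  have gl: "g i < K" "h' i < K" if "i < n" for i
    using g h' that by (auto simp: balanced_labellings_def labellings_def)
  have "0 \<le> (\<Sum>i<n. C $$ (i, h' i) - C $$ (i, g i))"
    using balanced_proj_optimal[OF opt[folded C_def] h' g carC] by (simp add: sum_subtractf)
  also have "\<dots> = (\<Sum>i\<in>?T. C $$ (i, h' i) - C $$ (i, g i))"
    by (rule sum.mono_neutral_right) (auto simp: mismatches_def)
  also have "\<dots> \<le> (\<Sum>i\<in>?T. 2 * fact (d - 1) * ?N i - \<Delta>)"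
  proof (rule sum_mono)
    fix i assume "i \<in> ?T"
    then have i: "i < n" "h' i \<noteq> g i" by (auto simp: mismatches_def)
    have BN: "\<bar>B h i k - B g i k\<bar> \<le> ?N i" for k
      unfolding B_def touch_count_def by (rule sum_stars_diff_le) simp
    have "\<Delta> \<le> fact (d - 1) * (B g i (g i) - B g i (h' i))"
      using gap i gl unfolding has_gap_def B_def by blast
    moreover have "fact (d - 1) * (B h i (h' i) - B h i (g i))
        \<le> fact (d - 1) * (2 * ?N i - (B g i (g i) - B g i (h' i)))"
      using BN[of "g i"] BN[of "h' i"] by (intro mult_left_mono) (auto simp: abs_le_iff)
    ultimately show "C $$ (i, h' i) - C $$ (i, g i) \<le> 2 * fact (d - 1) * ?N i - \<Delta>"
      using i gl C by (simp add: algebra_simps)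
  qed
  also have "\<dots> = 2 * fact (d - 1) * (\<Sum>i\<in>?T. ?N i) - \<Delta> * card ?T"
    by (simp add: sum_subtractf sum_distrib_left mult.commute)
  finally show ?thesis by simp
qed

text \<open>
  With \<open>S\<close> and \<open>T\<close> as the errors before and after an iteration, the bound contradicts the gain that
  the errors in \<open>T\<close> would require. The quantification over all \<open>S\<close> is what makes the later statements uniform in the
  starting point and applicable to iterates that depend on the tensor.
\<close>

definition scattered :: "nat \<Rightarrow> nat \<Rightarrow> (nat set \<Rightarrow> bool) \<Rightarrow> real \<Rightarrow> real \<Rightarrow> real \<Rightarrow> bool" where
  "scattered n d x \<tau> \<kappa> \<rho> \<longleftrightarrow> (\<forall>S T. S \<subseteq> {..<n} \<and> T \<subseteq> {..<n} \<and> S \<noteq> {} \<and> T \<noteq> {} \<and>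
      real (card S) \<le> \<kappa> * real n \<and> \<rho> * real (card S) \<le> real (card T) \<longrightarrow>
      (\<Sum>i\<in>T. touch_count n d S x i) < \<tau> * real (card T))"

lemma projection_step_contracts:
  assumes "d \<ge> 1" and g: "g \<in> balanced_labellings n K" and h': "h' \<in> labellings n K"
    and opt: "label_mat n K h' \<in> balanced_proj n K (tensor_power n d K (adjacency_tensor n d x) (label_mat n K h))"
    and gap: "has_gap n d K x g (2 * fact (d - 1) * \<tau>)" and "\<tau> > 0"
    and sc: "scattered n d x \<tau> \<kappa> \<rho>" and small: "real (card (mismatches n g h)) \<le> \<kappa> * real n" and "\<rho> \<ge> 0"
  shows "real (card (mismatches n g h')) \<le> \<rho> * real (card (mismatches n g h))"
proof (cases "mismatches n g h' = {}")
  case True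
  then show ?thesis using assms by simp
next
  case False
  let ?S = "mismatches n g h" and ?T = "mismatches n g h'"
  have T: "card ?T > 0" using False by (simp add: card_gt_0_iff)
  have "2 * fact (d - 1) * (\<tau> * card ?T) \<le> 2 * fact (d - 1) * (\<Sum>i\<in>?T. touch_count n d ?S x i)"
    using projection_step_mismatches[OF assms(1) g h' opt gap] by (simp add: mult_ac)
  then have le: "\<tau> * card ?T \<le> (\<Sum>i\<in>?T. touch_count n d ?S x i)" by simp
  then have "?S \<noteq> {}" using T \<open>\<tau> > 0\<close> by (auto simp: mult_le_0_iff)
  then show ?thesis
    using sc le small False mismatches_subset unfolding scattered_def by (meson linear not_less)
qed

text \<open>
  The first projection leaves at most \<open>\<kappa> * n\<close> errors, each iteration multiplies their number by at
  most \<open>\<rho>\<close>, and the number of errors is an integer.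
\<close>

lemma ptpm_output_exact:
  assumes "d \<ge> 1" and g: "g \<in> balanced_labellings n K" and h0: "h0 \<in> labellings n K"
    and gap: "has_gap n d K x g (2 * fact (d - 1) * \<tau>)" and "\<tau> > 0"
    and sc: "scattered n d x \<tau> \<kappa> \<rho>" and \<rho>: "0 \<le> \<rho>" "\<rho> \<le> 1"
    and init: "2 * real (card (mismatches n g h0)) \<le> \<kappa> * real n"
    and N: "\<rho> ^ N * (\<kappa> * real n) < 1"
    and out: "ptpm_output n d K (adjacency_tensor n d x) N (label_mat n K h0) X"
  shows "X = label_mat n K g"
proof -
  let ?A = "adjacency_tensor n d x"
  from out obtain H where H: "H 0 = label_mat n K h0" "H 1 \<in> balanced_proj n K (H 0)"
    "\<And>t. t \<in> {1..N} \<Longrightarrow> H (t + 1) \<in> balanced_proj n K (tensor_power n d K ?A (H t))" "X = H (N + 1)"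
    by (auto simp: ptpm_output_def)
  have \<kappa>n: "0 \<le> \<kappa> * real n" using init by linarith
  have "\<exists>h. h \<in> balanced_labellings n K \<and> H (t + 1) = label_mat n K h
      \<and> real (card (mismatches n g h)) \<le> \<rho> ^ t * (\<kappa> * real n)" if "t \<le> N" for t
    using that
  proof (induction t)
    case 0
    obtain h where h: "h \<in> balanced_labellings n K" "H 1 = label_mat n K h"
      using balanced_proj_label[OF H(2)] by blast
    have "real (card (mismatches n g h)) \<le> 2 * card (mismatches n g h0)"
      using H(1,2) h g h0 by (intro of_nat_mono mismatches_balanced_proj_label_mat) (auto simp: balanced_labellings_def)
    then have "real (card (mismatches n g h)) \<le> \<kappa> * real n" using init by linarith
    then show ?case using h by (intro exI[of _ h]) simp
  next
    case (Suc t)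
    then obtain h where h: "h \<in> balanced_labellings n K" "H (t + 1) = label_mat n K h"
      and c: "real (card (mismatches n g h)) \<le> \<rho> ^ t * (\<kappa> * real n)" by auto
    have st: "H (Suc t + 1) \<in> balanced_proj n K (tensor_power n d K ?A (label_mat n K h))"
      using H(3)[of "t + 1"] Suc.prems h by simp
    obtain h' where h': "h' \<in> balanced_labellings n K" "H (Suc t + 1) = label_mat n K h'"
      using balanced_proj_label[OF st] by blast
    have "\<rho> ^ t * (\<kappa> * real n) \<le> \<kappa> * real n" using \<rho> \<kappa>n by (simp add: mult_left_le_one_le power_le_one)
    then have "real (card (mismatches n g h)) \<le> \<kappa> * real n" using c by linarith
    then have "real (card (mismatches n g h')) \<le> \<rho> * real (card (mismatches n g h))"
      using assms h' st by (intro projection_step_contracts[OF assms(1) g _ _ gap \<open>\<tau> > 0\<close> sc])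
        (auto simp: balanced_labellings_def)
    also have "\<dots> \<le> \<rho> * (\<rho> ^ t * (\<kappa> * real n))" using c \<rho> by (intro mult_left_mono) auto
    finally show ?case using h' by (auto simp: mult_ac)
  qed
  from this[of N] obtain h where h: "H (N + 1) = label_mat n K h"
    and "real (card (mismatches n g h)) \<le> \<rho> ^ N * (\<kappa> * real n)" by auto
  with N have "card (mismatches n g h) = 0" by linarith
  then have "h i = g i" if "i < n" for i using that by (auto simp: mismatches_def)
  then show ?thesis using H(4) h label_mat_cong by metis
qed

section \<open>Hyperedges between two small sets of nodes\<close>

lemma finite_hyperedge: "e \<in> node_sets n d \<Longrightarrow> finite e"
  unfolding node_sets_def by (auto intro: finite_subset)

text \<open>
  Choose a node \<open>j\<close> of \<open>S\<close> on the hyperedge first, and then the \<open>d - 2\<close> nodes other than \<open>i\<close> and \<open>j\<close>.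
\<close>

lemma card_touching_in:
  assumes "finite V" "d \<ge> 2"
  shows "card {e \<in> touching n d i S. e - {i} \<subseteq> V} \<le> card (S \<inter> V) * (card V choose (d - 2))"
proof -
  let ?F = "\<lambda>j. {e \<in> node_sets n d. i \<in> e \<and> j \<in> e \<and> j \<noteq> i \<and> e - {i} \<subseteq> V}"
  have "card {e \<in> touching n d i S. e - {i} \<subseteq> V} \<le> card (\<Union>j\<in>S \<inter> V. ?F j)"
    using assms by (intro card_mono) (auto simp: touching_def)
  also have "\<dots> \<le> (\<Sum>j\<in>S \<inter> V. card (?F j))" using assms by (intro card_UN_le) auto
  also have "\<dots> \<le> (\<Sum>j\<in>S \<inter> V. card V choose (d - 2))"
  proof (rule sum_mono)
    fix j
    have "card (?F j) \<le> card {f. f \<subseteq> V \<and> card f = d - 2}"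
    proof (rule card_inj_on_le)
      show "inj_on (\<lambda>e. e - {i, j}) (?F j)"
        by (rule inj_on_inverseI[where g="\<lambda>f. insert i (insert j f)"]) auto
      show "(\<lambda>e. e - {i, j}) ` ?F j \<subseteq> {f. f \<subseteq> V \<and> card f = d - 2}"
      proof safe
        fix e assume e: "e \<in> node_sets n d" "i \<in> e" "j \<in> e" "j \<noteq> i"
        then have "card (e - {i, j}) = card e - card {i, j}"
            using finite_hyperedge by (intro card_Diff_subset) auto
        then show "card (e - {i, j}) = d - 2" using e by (simp add: node_sets_def)
      qed (use assms in auto)
      show "finite {f. f \<subseteq> V \<and> card f = d - 2}" 
        by (rule finite_subset[of _ "Pow V"]) (use assms in auto)
    qed
    then show "card (?F j) \<le> card V choose (d - 2)" using n_subsets[OF assms(1)] by simp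
  qed
  finally show ?thesis by simp
qed

lemma choose_le_power: "n choose k \<le> n ^ k"
proof -
  have "n choose k \<le> (n choose k) * fact k" by simp
  also have "\<dots> \<le> n ^ k" by (rule binomial_fact_pow)
  finally show ?thesis .
qed

lemma card_touching_le:
  assumes "S \<subseteq> {..<n}" "d \<ge> 2"
  shows "card (touching n d i S) \<le> card S * n ^ (d - 2)"
proof -
  have eq: "{e \<in> touching n d i S. e - {i} \<subseteq> {..<n}} = touching n d i S"
    by (auto simp: touching_def node_sets_def)
  have "card (touching n d i S) \<le> card (S \<inter> {..<n}) * (card {..<n} choose (d - 2))"
    using card_touching_in[OF finite_lessThan assms(2), of n i S n] unfolding eq .
  also have "\<dots> \<le> card S * n ^ (d - 2)"
    using choose_le_power finite_subset[OF assms(1)] by (intro mult_mono card_mono) auto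
  finally show ?thesis .
qed

text \<open>
  A hyperedge is counted once for each of its nodes in \<open>T\<close>, hence at most \<open>d\<close> times, and at most
  \<open>card T * card S * n ^ (d - 2)\<close> hyperedges are counted at all.
\<close>

lemma touch_sum_tail:
  assumes P: "\<And>e. e \<in> node_sets n d \<Longrightarrow> 0 \<le> P e \<and> P e \<le> 1" "\<And>e. e \<in> node_sets n d \<Longrightarrow> P e \<le> p"
    and "0 \<le> p" "S \<subseteq> {..<n}" "T \<subseteq> {..<n}" "d \<ge> 2" "0 \<le> s"
  shows "measure_pmf.prob (Pi_pmf (node_sets n d) False (\<lambda>e. bernoulli_pmf (P e)))
           {x. a \<le> (\<Sum>i\<in>T. touch_count n d S x i)}
       \<le> exp (p * exp (s * d) * (real (card T) * (real (card S) * real n ^ (d - 2))) - s * a)"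
proof -
  define w where "w e = card {i \<in> T. e \<in> touching n d i S}" for e
  have fT: "finite T" using assms(5) finite_subset by blast
  have X: "(\<Sum>i\<in>T. touch_count n d S x i) = (\<Sum>e\<in>node_sets n d. real (w e) * of_bool (x e))" for x
  proof -
    have "(\<Sum>i\<in>T. touch_count n d S x i)
        = (\<Sum>i\<in>T. \<Sum>e\<in>node_sets n d. of_bool (e \<in> touching n d i S) * of_bool (x e))"
      unfolding touch_count_def
      by (intro sum.cong[OF refl] sum.mono_neutral_cong_left) (auto simp: touching_def)
    also have "\<dots> = (\<Sum>e\<in>node_sets n d. (\<Sum>i\<in>T. of_bool (e \<in> touching n d i S)) * of_bool (x e))"
      unfolding sum_distrib_right by (rule sum.swap)
    also have "\<dots> = (\<Sum>e\<in>node_sets n d. real (w e) * of_bool (x e))"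
      unfolding w_def using sum_of_bool_class[OF fT] by simp
    finally show ?thesis .
  qed
  have wd: "w e \<le> d" if "e \<in> node_sets n d" for e
  proof -
    have "w e \<le> card e" unfolding w_def using that finite_hyperedge by (intro card_mono) (auto simp: touching_def)
    then show ?thesis using that by (simp add: node_sets_def)
  qed
  have "(\<Sum>e\<in>node_sets n d. P e * (exp (s * w e) - 1))
      \<le> (\<Sum>e\<in>node_sets n d. p * exp (s * d) * real (w e))"
  proof (rule sum_mono)
    fix e assume e: "e \<in> node_sets n d"
    show "P e * (exp (s * w e) - 1) \<le> p * exp (s * d) * real (w e)"
    proof (cases "w e = 0")
      case False
      have "P e * (exp (s * w e) - 1) \<le> p * exp (s * d)"
      proof (rule mult_mono)
        have "s * w e \<le> s * d" using wd[OF e] assms(7) by (intro mult_left_mono) auto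
        then show "exp (s * w e) - 1 \<le> exp (s * d)" by (simp add: add_increasing2 diff_le_eq)
        show "0 \<le> exp (s * w e) - 1" using assms(7) by simp
      qed (use P e assms in auto)
      also have "\<dots> \<le> p * exp (s * d) * real (w e)"
        using False assms(3) mult_left_mono[of 1 "real (w e)" "p * exp (s * d)"] by simp
      finally show ?thesis .
    qed simp
  qed
  also have "\<dots> = p * exp (s * d) * (\<Sum>e\<in>node_sets n d. real (w e))" by (simp add: sum_distrib_left)
  also have "\<dots> \<le> p * exp (s * d) * (real (card T) * (real (card S) * real n ^ (d - 2)))"
  proof (rule mult_left_mono)
    have "(\<Sum>e\<in>node_sets n d. real (w e)) = (\<Sum>i\<in>T. touch_count n d S (\<lambda>_. True) i)"
      by (simp add: X)
    also have "\<dots> \<le> (\<Sum>i\<in>T. real (card S * n ^ (d - 2)))"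
      using card_touching_le[OF assms(4,6)] unfolding touch_count_def
      by (intro sum_mono) (simp only: of_bool_eq sum_constant mult_1_right, rule of_nat_mono, blast)
    finally show "(\<Sum>e\<in>node_sets n d. real (w e)) \<le> real (card T) * (real (card S) * real n ^ (d - 2))" by simp
  qed (use assms(3) in simp)
  finally have b: "(\<Sum>e\<in>node_sets n d. P e * (exp (s * w e) - 1))
     \<le> p * exp (s * d) * (real (card T) * (real (card S) * real n ^ (d - 2)))" .
  have "measure_pmf.prob (Pi_pmf (node_sets n d) False (\<lambda>e. bernoulli_pmf (P e)))
           {x. a \<le> (\<Sum>i\<in>T. touch_count n d S x i)}
     \<le> measure_pmf.prob (Pi_pmf (node_sets n d) False (\<lambda>e. bernoulli_pmf (P e)))
           {x. s * a \<le> (\<Sum>e\<in>node_sets n d. (s * w e) * of_bool (x e))}"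
    unfolding X using assms(7)
    by (intro measure_pmf.finite_measure_mono) (auto simp: mult.assoc sum_distrib_left[symmetric] intro: mult_left_mono)
  also have "\<dots> \<le> exp (p * exp (s * d) * (real (card T) * (real (card S) * real n ^ (d - 2))) - s * a)"
    by (rule Chernoff_weighted[OF finite_node_sets P(1) b])
  finally show ?thesis .
qed

lemma self_power_le_fact_mult_exp: "real r ^ r \<le> fact r * exp (real r)"
proof -
  have "real r ^ r / fact r \<le> (\<Sum>k. real r ^ k / fact k)"
    using sum_le_suminf[of "\<lambda>k. real r ^ k / fact k" "{r}"] summable_exp[of "real r"]
    by (simp add: divide_inverse mult.commute)
  also have "\<dots> = exp (real r)" by (simp add: exp_def scaleR_conv_of_real divide_inverse mult.commute)
  finally show ?thesis by (simp add: divide_simps mult.commute)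
qed
lemma sum_Pow_card:
  assumes "finite A"
  shows "(\<Sum>S\<in>Pow A. f (card S) :: real) = (\<Sum>k\<le>card A. real (card A choose k) * f k)"
proof -
  have "(\<Sum>S\<in>Pow A. f (card S)) = (\<Sum>k\<in>{..card A}. \<Sum>S | S \<in> Pow A \<and> card S = k. f (card S))"
    by (rule sum.group[symmetric]) (use assms in \<open>auto intro: card_mono\<close>)
  also have "\<dots> = (\<Sum>k\<le>card A. real (card A choose k) * f k)"
    using n_subsets[OF assms] by (intro sum.cong) auto
  finally show ?thesis .
qed

text \<open>
  The weight of a set of size \<open>r\<close> is the reciprocal of the usual bound \<open>(exp 1 * n / r) ^ r\<close> for the number
  of such sets, so that each size contributes at most \<open>1\<close>.
\<close>

lemma sum_Pow_entropy_le:
  assumes "n > 0"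
  shows "(\<Sum>S\<in>Pow {..<n}. exp (- (real (card S) * (1 + ln (real n / card S))))) \<le> real n + 1"
proof -
  have "(\<Sum>S\<in>Pow {..<n}. exp (- (real (card S) * (1 + ln (real n / card S)))))
      = (\<Sum>r\<le>n. real (n choose r) * exp (- (real r * (1 + ln (real n / r)))))"
    using sum_Pow_card[of "{..<n}" "\<lambda>r. exp (- (real r * (1 + ln (real n / r))))"] by simp
  also have "\<dots> \<le> (\<Sum>r\<le>n. 1)"
  proof (rule sum_mono)
    fix r
    show "real (n choose r) * exp (- (real r * (1 + ln (real n / r)))) \<le> 1"
    proof (cases "r = 0")
      case False
      have "exp (real r * (1 + ln (real n / r))) = exp r * (real n / r) ^ r"
        using False assms by (simp add: distrib_left exp_add exp_of_nat_mult)
      also have "\<dots> \<ge> real (n choose r)"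
      proof -
        have "real (n choose r) * real r ^ r \<le> real (n choose r) * (fact r * exp r)"
          by (intro mult_left_mono self_power_le_fact_mult_exp) simp
        also have "\<dots> = real ((n choose r) * fact r) * exp r" by simp
        also have "\<dots> \<le> real (n ^ r) * exp r"
          by (intro mult_right_mono of_nat_mono binomial_fact_pow) simp
        finally show ?thesis using False by (simp add: power_divide divide_simps mult_ac)
      qed
      finally show ?thesis by (simp add: exp_minus divide_simps)
    qed simp
  qed
  finally show ?thesis by simp
qed

lemma sum_Pow_power_le:
  assumes "n > 0"
  shows "(\<Sum>T\<in>Pow {..<n}. exp (- (real (card T) * ln (real n)))) \<le> real n + 1"
proof -
  have "(\<Sum>T\<in>Pow {..<n}. exp (- (real (card T) * ln (real n))))
      = (\<Sum>t\<le>n. real (n choose t) * exp (- (real t * ln (real n))))"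
    using sum_Pow_card[of "{..<n}" "\<lambda>t. exp (- (real t * ln (real n)))"] by simp
  also have "\<dots> \<le> (\<Sum>t\<le>n. 1)"
  proof (rule sum_mono)
    fix t
    have "real (n choose t) \<le> real n ^ t"
      using choose_le_power[of n t] of_nat_mono by fastforce
    then show "real (n choose t) * exp (- (real t * ln (real n))) \<le> 1"
      using assms by (simp add: exp_minus exp_of_nat_mult divide_simps)
  qed
  finally show ?thesis by simp
qed

text \<open>
  Let \<open>r\<close> and \<open>t\<close> be the sizes of \<open>S\<close> and \<open>T\<close>. With \<open>exp (s * d) = n / r\<close> the mean term in the Chernoff
  bound is only \<open>\<alpha> * t * ln n\<close>, while the exponent gains \<open>(\<tau> / d) * t * ln n * ln (n / r)\<close>. The number of pairs is about
  \<open>exp (r * (1 + ln (n / r)) + t * ln n)\<close>, which is smaller because \<open>r \<le> t * sqrt (ln n)\<close> and because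
  \<open>r \<le> \<kappa> * n\<close> makes \<open>ln (n / r)\<close> large.
\<close>

lemma prob_not_scattered_le:
  fixes \<alpha> \<tau> :: real
  assumes "d \<ge> 2" "\<alpha> > 0" "\<tau> > 0" "n \<ge> 4" and nl: "4 * d / \<tau> \<le> sqrt (ln n)"
    and P: "\<And>e. e \<in> node_sets n d \<Longrightarrow> 0 \<le> P e \<and> P e \<le> 1"
    and Pp: "\<And>e. e \<in> node_sets n d \<Longrightarrow> P e \<le> log_param \<alpha> d n"
    and \<kappa>: "\<kappa> = exp (- (1 + 2 * d * (\<alpha> + 5) / \<tau>))"
  shows "measure_pmf.prob (Pi_pmf (node_sets n d) False (\<lambda>e. bernoulli_pmf (P e)))
           {x. \<not> scattered n d x (\<tau> * ln n) \<kappa> (1 / sqrt (ln n))} \<le> 1 / n"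
proof -
  let ?M = "Pi_pmf (node_sets n d) False (\<lambda>e. bernoulli_pmf (P e))"
  define L where "L = ln (real n)"
  define \<rho> where "\<rho> = 1 / sqrt L"
  have L: "L > 0" using \<open>n \<ge> 4\<close> by (simp add: L_def)
  define Adm where "Adm = {(S, T). S \<subseteq> {..<n} \<and> T \<subseteq> {..<n} \<and> S \<noteq> {} \<and> T \<noteq> {} \<and>
      real (card S) \<le> \<kappa> * real n \<and> \<rho> * real (card S) \<le> real (card T)}"
  define Ev where "Ev ST = {x. \<tau> * L * card (snd ST) \<le> (\<Sum>i\<in>snd ST. touch_count n d (fst ST) x i)}" for ST
  define f where "f S = exp (- (real (card S) * (1 + ln (real n / card S))))" for S :: "nat set"
  define g where "g T = exp (- (real (card T) * L))" for T :: "nat set"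
  have sub: "Adm \<subseteq> Pow {..<n} \<times> Pow {..<n}" by (auto simp: Adm_def)
  then have fin: "finite Adm" by (rule finite_subset) auto
  have "scattered n d x (\<tau> * ln n) \<kappa> (1 / sqrt (ln n)) \<longleftrightarrow> (\<forall>ST\<in>Adm. x \<notin> Ev ST)" for x
    unfolding scattered_def Adm_def Ev_def L_def \<rho>_def by (simp add: Ball_def not_le mult.assoc)
  then have "{x. \<not> scattered n d x (\<tau> * ln n) \<kappa> (1 / sqrt (ln n))} = (\<Union>ST\<in>Adm. Ev ST)" by blast
  then have "measure_pmf.prob ?M {x. \<not> scattered n d x (\<tau> * ln n) \<kappa> (1 / sqrt (ln n))}
      \<le> (\<Sum>ST\<in>Adm. measure_pmf.prob ?M (Ev ST))"
    using measure_pmf.finite_measure_subadditive_finite[OF fin, of Ev ?M] by simp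
  also have "\<dots> \<le> (\<Sum>(S, T)\<in>Adm. f S * g T * exp (- (4 * L)))"
  proof (rule sum_mono, clarify)
    fix S T assume "(S, T) \<in> Adm"
    then have S: "S \<subseteq> {..<n}" "S \<noteq> {}" "real (card S) \<le> \<kappa> * real n"
      and T: "T \<subseteq> {..<n}" "T \<noteq> {}" and ST: "\<rho> * real (card S) \<le> real (card T)"
      by (auto simp: Adm_def)
    define r t where "r = real (card S)" and "t = real (card T)"
    have r1: "r \<ge> 1" and t1: "t \<ge> 1"
      using S T finite_subset[OF S(1)] finite_subset[OF T(1)]
      by (auto simp: r_def t_def Suc_le_eq card_gt_0_iff)
    define y where "y = n / r"
    define s where "s = ln y / d"
    have y0: "y > 0" using r1 \<open>n \<ge> 4\<close> by (simp add: y_def)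
    have "1 + 2 * d * (\<alpha> + 5) / \<tau> = ln (1 / \<kappa>)" by (simp add: \<kappa> ln_div)
    also have "\<dots> \<le> ln y"
    proof (rule ln_mono)
      show "1 / \<kappa> \<le> y" using S(3) r1 by (simp add: y_def r_def \<kappa> divide_simps mult_ac)
    qed (use y0 in \<open>auto simp: \<kappa>\<close>)
    finally have ly: "1 + 2 * d * (\<alpha> + 5) / \<tau> \<le> ln y" .
    have "0 \<le> 2 * d * (\<alpha> + 5) / \<tau>" using assms by simp
    then have ly1: "ly \<ge> 1" if "ly = ln y" for ly using ly that by linarith
    have ly2: "2 * d * (\<alpha> + 5) \<le> \<tau> * ln y"
    proof -
      have "2 * d * (\<alpha> + 5) / \<tau> \<le> ln y" using ly by linarith
      then show ?thesis using \<open>\<tau> > 0\<close> by (simp add: divide_simps mult_ac)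
    qed
    have s0: "s \<ge> 0" using ly1 by (simp add: s_def)
    have es: "exp (s * d) = n / r" using assms(1) y0 by (simp add: s_def y_def)
    have p: "log_param \<alpha> d n * exp (s * d) * (t * (r * real n ^ (d - 2))) = \<alpha> * L * t"
    proof -
      have "d - 1 = Suc (d - 2)" using assms(1) by simp
      then have "real n ^ (d - 1) = real n * real n ^ (d - 2)" by simp
      then show ?thesis using r1 \<open>n \<ge> 4\<close> by (simp add: es log_param_def L_def)
    qed
    have "measure_pmf.prob ?M (Ev (S, T))
        \<le> exp (log_param \<alpha> d n * exp (s * d) * (t * (r * real n ^ (d - 2))) - s * (\<tau> * L * card T))"
      unfolding Ev_def fst_conv snd_conv r_def t_def
      by (rule touch_sum_tail[OF P Pp _ S(1) T(1) assms(1) s0])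
         (use assms in \<open>auto simp: log_param_def\<close>)
    also have "\<dots> = exp (\<alpha> * L * t - s * (\<tau> * L * t))" unfolding t_def[symmetric] p ..
    also have "\<dots> \<le> exp (- (r * (1 + ln y)) - t * L - 4 * L)"
    proof -
      \<comment> \<open>Half of the gain pays for the choice of \<open>S\<close>, since \<open>r \<le> t * sqrt L\<close>,\<close>
      have "r * (1 + ln y) \<le> (t * sqrt L) * (2 * ln y)"
      proof (rule mult_mono)
        show "r \<le> t * sqrt L" using ST L by (simp add: r_def t_def \<rho>_def divide_simps)
      qed (use ly1 t1 L in auto)
      also have "\<dots> \<le> t * (\<tau> / (4 * d) * L) * (2 * ln y)"
      proof (intro mult_right_mono mult_left_mono)
        have "4 * d \<le> \<tau> * sqrt L" using nl \<open>\<tau> > 0\<close> by (simp add: L_def divide_simps mult_ac)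
        then have "4 * d * sqrt L \<le> \<tau> * sqrt L * sqrt L" using L by (intro mult_right_mono) auto
        then show "sqrt L \<le> \<tau> / (4 * d) * L" using L assms(1) by (simp add: divide_simps mult_ac)
      qed (use ly1 t1 in auto)
      also have "\<dots> = s * (\<tau> * L * t) / 2" by (simp add: s_def mult_ac)
      finally have 1: "r * (1 + ln y) \<le> s * (\<tau> * L * t) / 2" .
      \<comment> \<open>and the other half for the mean, for the choice of \<open>T\<close> and for the final bound.\<close>
      have "(\<alpha> + 5) * (L * t) = (2 * d * (\<alpha> + 5)) * (L * t) / (2 * d)" using assms(1) by simp
      also have "\<dots> \<le> (\<tau> * ln y) * (L * t) / (2 * d)"
        using ly2 L t1 by (intro divide_right_mono mult_right_mono) auto
      also have "\<dots> = s * (\<tau> * L * t) / 2" by (simp add: s_def mult_ac)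
      finally have 2: "(\<alpha> + 5) * (L * t) \<le> s * (\<tau> * L * t) / 2" .
      have 3: "L \<le> L * t" using L t1 by simp
      have 4: "(\<alpha> + 5) * (L * t) = \<alpha> * L * t + t * L + 4 * (L * t)" by (simp add: algebra_simps)
      show ?thesis using 1 2 3 4 mult.commute[of t L] unfolding exp_le_cancel_iff by linarith
    qed
    also have "\<dots> = f S * g T * exp (- (4 * L))"
      unfolding f_def g_def y_def r_def t_def exp_add[symmetric] by (rule arg_cong[of _ _ exp]) simp
    finally show "measure_pmf.prob ?M (Ev (S, T)) \<le> f S * g T * exp (- (4 * L))" .
  qed
  also have "\<dots> \<le> (\<Sum>(S, T)\<in>Pow {..<n} \<times> Pow {..<n}. f S * g T * exp (- (4 * L)))"
    by (rule sum_mono2[OF _ sub]) (auto simp: f_def g_def)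
  also have "\<dots> = (\<Sum>S\<in>Pow {..<n}. f S) * (\<Sum>T\<in>Pow {..<n}. g T) * exp (- (4 * L))"
    by (simp only: sum_product sum.cartesian_product sum_distrib_right[of _ _ "exp (- (4 * L))"] split_def)
  also have "\<dots> \<le> (2 * real n) * (2 * real n) * exp (- (4 * L))"
    using sum_Pow_entropy_le[of n] sum_Pow_power_le[of n] \<open>n \<ge> 4\<close> unfolding f_def g_def L_def
    by (intro mult_right_mono mult_mono) (auto intro: sum_nonneg)
  also have "\<dots> \<le> 1 / n"
  proof -
    have "exp (- (4 * L)) = 1 / real n ^ 4"
      using \<open>n \<ge> 4\<close> exp_of_nat_mult[of 4 L] by (simp add: L_def exp_minus divide_inverse)
    then have "(2 * real n) * (2 * real n) * exp (- (4 * L)) = 4 / (real n * real n)"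
      using \<open>n \<ge> 4\<close> by (simp add: power4_eq_xxxx)
    also have "\<dots> \<le> 1 / n" using \<open>n \<ge> 4\<close> by (simp add: divide_simps)
    finally show ?thesis .
  qed
  finally show ?thesis by simp
qed

section \<open>The gap at the planted assignment\<close>

definition monochromatic :: "(nat \<Rightarrow> nat) \<Rightarrow> nat set \<Rightarrow> bool" where
  "monochromatic g e \<longleftrightarrow> (\<forall>i\<in>e. \<forall>j\<in>e. g i = g j)"

definition edge_prob :: "(nat \<Rightarrow> nat) \<Rightarrow> real \<Rightarrow> real \<Rightarrow> nat set \<Rightarrow> real" where
  "edge_prob h p q e = (if monochromatic h e then p else q)"

definition hyperedge_law :: "nat \<Rightarrow> nat \<Rightarrow> (nat \<Rightarrow> nat) \<Rightarrow> real \<Rightarrow> real \<Rightarrow> (nat set \<Rightarrow> bool) pmf" where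
  "hyperedge_law n d h p q = Pi_pmf (node_sets n d) False (\<lambda>e. bernoulli_pmf (edge_prob h p q e))"

lemma same_community_label_mat:
  assumes "h \<in> labellings n K" "e \<subseteq> {..<n}"
  shows "same_community (label_mat n K h) e \<longleftrightarrow> monochromatic h e"
proof -
  have "row (label_mat n K h) i = row (label_mat n K h) j \<longleftrightarrow> h i = h j" if "i < n" "j < n" for i j
  proof
    assume eq: "row (label_mat n K h) i = row (label_mat n K h) j"
    have hi: "h i < K" using assms(1) that by (auto simp: labellings_def)
    show "h i = h j" using arg_cong[OF eq, of "\<lambda>v. v $ h i"] that hi by (auto split: if_splits)
  next
    assume "h i = h j"
    then show "row (label_mat n K h) i = row (label_mat n K h) j"
      using that by (intro eq_vecI) auto
  qed
  then show ?thesis using assms(2) unfolding same_community_def monochromatic_def by (meson lessThan_iff subsetD)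
qed

lemma prob_hsbm_label_mat:
  assumes "h \<in> labellings n K"
  shows "measure_pmf.prob (hsbm n d p q (label_mat n K h)) {A. \<Phi> A}
       = measure_pmf.prob (hyperedge_law n d h p q) {x. \<Phi> (adjacency_tensor n d x)}"
proof -
  have "Pi_pmf (node_sets n d) False (\<lambda>e. bernoulli_pmf (if same_community (label_mat n K h) e then p else q))
      = hyperedge_law n d h p q"
    unfolding hyperedge_law_def
  proof (rule Pi_pmf_cong)
    fix e assume "e \<in> node_sets n d"
    then show "bernoulli_pmf (if same_community (label_mat n K h) e then p else q)
             = bernoulli_pmf (edge_prob h p q e)"
      using same_community_label_mat[OF assms, of e] by (simp add: edge_prob_def node_sets_def)
  qed auto
  then show ?thesis by (simp add: hsbm_def vimage_def)
qed

lemma edge_prob_bounds: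
  assumes "0 \<le> q" "q \<le> p" "p \<le> 1"
  shows "0 \<le> edge_prob h p q e \<and> edge_prob h p q e \<le> 1" "edge_prob h p q e \<le> p"
  using assms by (auto simp: edge_prob_def)

lemma prob_compl_ge:
  assumes "measure_pmf.prob M {x. \<not> \<Phi> x} \<le> b"
  shows "measure_pmf.prob M {x. \<Phi> x} \<ge> 1 - b"
proof -
  have "{x. \<Phi> x} = UNIV - {x. \<not> \<Phi> x}" by auto
  then show ?thesis using assms measure_pmf.prob_compl[of "{x. \<not> \<Phi> x}" M] by simp
qed

lemma prob_bad_Un_le:
  assumes "\<And>x. \<not> \<Phi> x \<Longrightarrow> \<not> \<Psi>1 x \<or> \<not> \<Psi>2 x"
    and "measure_pmf.prob M {x. \<not> \<Psi>1 x} \<le> a" "measure_pmf.prob M {x. \<not> \<Psi>2 x} \<le> b"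
  shows "measure_pmf.prob M {x. \<not> \<Phi> x} \<le> a + b"
proof -
  have "measure_pmf.prob M {x. \<not> \<Phi> x} \<le> measure_pmf.prob M ({x. \<not> \<Psi>1 x} \<union> {x. \<not> \<Psi>2 x})"
    using assms(1) by (intro measure_pmf.finite_measure_mono) auto
  also have "\<dots> \<le> measure_pmf.prob M {x. \<not> \<Psi>1 x} + measure_pmf.prob M {x. \<not> \<Psi>2 x}"
    by (intro measure_Un_le) auto
  finally show ?thesis using assms(2,3) by linarith
qed

lemma card_stars:
  assumes "V \<subseteq> {..<n}" "i < n" "d \<ge> 1"
  shows "card (stars n d i V) = card (V - {i}) choose (d - 1)"
proof -
  have fV: "finite (V - {i})" using assms(1) finite_subset by blast
  have "bij_betw (insert i) {f. f \<subseteq> V - {i} \<and> card f = d - 1} (stars n d i V)"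
  proof (rule bij_betw_byWitness[where f' = "\<lambda>e. e - {i}"])
    show "insert i ` {f. f \<subseteq> V - {i} \<and> card f = d - 1} \<subseteq> stars n d i V"
    proof safe
      fix f assume f: "f \<subseteq> V - {i}" "card f = d - 1"
      then have "finite f" "i \<notin> f" using fV finite_subset by auto
      then have "card (insert i f) = d" using f assms(3) by simp
      then show "insert i f \<in> stars n d i V" using f assms by (auto simp: stars_def node_sets_def)
    qed
    show "(\<lambda>e. e - {i}) ` stars n d i V \<subseteq> {f. f \<subseteq> V - {i} \<and> card f = d - 1}"
      by (auto simp: stars_def node_sets_def)
  qed (auto simp: stars_def)
  then have "card (stars n d i V) = card {f. f \<subseteq> V - {i} \<and> card f = d - 1}"
    by (rule bij_betw_same_card[symmetric])
  then show ?thesis using n_subsets[OF fV] by simp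
qed

lemma community_subset [simp]: "community n h k \<subseteq> {..<n}"
  by (auto simp: community_def)

lemma card_community:
  assumes "h \<in> balanced_labellings n K" "k < K"
  shows "card (community n h k) = n div K"
  using assms by (simp add: balanced_labellings_def community_def)

lemma power_le_choose_fact: "(N + 1 - r) ^ r \<le> (N choose r) * fact r"
proof (induction r arbitrary: N)
  case (Suc r)
  have "(N + 1 - Suc r) ^ Suc r = (N - r) * (N - r) ^ r" by simp
  also have "\<dots> \<le> N * (((N - 1) choose r) * fact r)"
  proof (cases "N = 0")
    case False
    then show ?thesis using Suc[of "N - 1"] by (intro mult_mono) auto
  qed simp
  also have "\<dots> = (N choose Suc r) * fact (Suc r)"
  proof -
    have "N * (((N - 1) choose r) * fact r) = (Suc r * (N choose Suc r)) * fact r"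
      using times_binomial_minus1_eq[of "Suc r" N] by simp
    also have "\<dots> = (N choose Suc r) * fact (Suc r)" by (simp only: fact_Suc of_nat_id mult_ac)
    finally show ?thesis .
  qed
  finally show ?case .
qed simp

lemma eventually_choose_ge:
  assumes "\<delta> > 0"
  shows "\<forall>\<^sub>F m in sequentially. (1 - \<delta>) * real m ^ r \<le> real ((m - 1) choose r) * fact r"
proof -
  have "(\<lambda>m. (1 - real r / real m) ^ r) \<longlonglongrightarrow> (1 - 0) ^ r"
    by (intro tendsto_intros lim_const_over_n)
  then have "\<forall>\<^sub>F m in sequentially. 1 - \<delta> < (1 - real r / real m) ^ r"
    using assms by (auto elim: order_tendstoD)
  moreover have "\<forall>\<^sub>F m in sequentially. m \<ge> Suc r" by (rule eventually_ge_at_top)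
  ultimately show ?thesis
  proof eventually_elim
    case (elim m)
    have "(1 - \<delta>) * real m ^ r \<le> (1 - real r / real m) ^ r * real m ^ r"
      using elim by (intro mult_right_mono) auto
    also have "\<dots> = real ((m - r) ^ r)"
      using elim by (simp add: power_mult_distrib[symmetric] of_nat_diff field_simps)
    also have "\<dots> \<le> real (((m - 1) choose r) * fact r)"
      using power_le_choose_fact[of "m - 1" r] elim by (intro of_nat_mono) simp
    finally show ?case by simp
  qed
qed

text \<open>
  The two sets of hyperedges are disjoint and get the weights \<open>- s\<close> and \<open>s\<close> in Chernoff's bound. In the logarithmic
  regime the choice \<open>exp s = sqrt (\<alpha> / \<beta>)\<close> is optimal and makes the exponent, up to lower order terms,
  \<open>- (sqrt \<alpha> - sqrt \<beta>)\<^sup>2 * ln n / (K ^ (d - 1) * fact (d - 1))\<close>.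
\<close>

lemma star_difference_tail:
  assumes "d \<ge> 2" and h: "h \<in> balanced_labellings n K" and i: "i < n" and l: "l < K" "l \<noteq> h i"
    and pq: "0 \<le> q" "q \<le> p" "p \<le> 1" and "s \<ge> 0"
  shows "measure_pmf.prob (hyperedge_law n d h p q)
     {x. (\<Sum>e\<in>stars n d i (community n h (h i)). of_bool (x e))
        - (\<Sum>e\<in>stars n d i (community n h l). of_bool (x e)) < a}
     \<le> exp (q * real (n div K choose (d - 1)) * (exp s - 1)
          - p * real ((n div K - 1) choose (d - 1)) * (1 - exp (- s)) + s * a)"
proof -
  let ?A = "stars n d i (community n h (h i))" and ?B = "stars n d i (community n h l)"
  define w where "w e = (if e \<in> ?A then - s else if e \<in> ?B then s else 0)" for e
  have hi: "h i < K" using h i by (auto simp: balanced_labellings_def labellings_def)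
  have AB: "?A \<inter> ?B = {}"
  proof -
    have "e - {i} \<noteq> {}" if "e \<in> ?A" for e
    proof
      assume "e - {i} = {}"
      then have "card e \<le> 1" using card_mono[of "{i}" e] by auto
      then show False using that \<open>d \<ge> 2\<close> by (simp add: stars_def node_sets_def)
    qed
    then show ?thesis using l(2) by (fastforce simp: stars_def community_def)
  qed
  have sub: "?A \<subseteq> node_sets n d" "?B \<subseteq> node_sets n d" by (auto simp: stars_def)
  have pA: "edge_prob h p q e = p" if "e \<in> ?A" for e
  proof -
    have "h j = h i" if "j \<in> e" for j using \<open>e \<in> ?A\<close> that by (cases "j = i") (auto simp: stars_def community_def)
    then show ?thesis by (simp add: edge_prob_def monochromatic_def)
  qed
  have pB: "edge_prob h p q e = q" if "e \<in> ?B" for e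
  proof -
    have "card e \<noteq> card {i}" using that \<open>d \<ge> 2\<close> by (auto simp: stars_def node_sets_def)
    then have "e \<noteq> {i}" by blast
    moreover have "i \<in> e" using that by (simp add: stars_def)
    ultimately obtain j where "j \<in> e" "j \<noteq> i" by blast
    then have "h j \<noteq> h i" "i \<in> e" using that l by (auto simp: stars_def community_def)
    then show ?thesis using \<open>j \<in> e\<close> by (auto simp: edge_prob_def monochromatic_def)
  qed
  have split: "(\<Sum>e\<in>node_sets n d. F e (w e)) = (\<Sum>e\<in>?A. F e (- s)) + (\<Sum>e\<in>?B. F e s)"
    if "\<And>e. F e 0 = 0" for F :: "nat set \<Rightarrow> real \<Rightarrow> real"
  proof -
    have "(\<Sum>e\<in>node_sets n d. F e (w e)) = (\<Sum>e\<in>?A \<union> ?B. F e (w e))"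
      by (rule sum.mono_neutral_right) (use sub that in \<open>auto simp: w_def\<close>)
    also have "\<dots> = (\<Sum>e\<in>?A. F e (w e)) + (\<Sum>e\<in>?B. F e (w e))"
      using AB by (intro sum.union_disjoint) auto
    also have "(\<Sum>e\<in>?A. F e (w e)) = (\<Sum>e\<in>?A. F e (- s))" by (intro sum.cong) (auto simp: w_def)
    also have "(\<Sum>e\<in>?B. F e (w e)) = (\<Sum>e\<in>?B. F e s)" using AB by (intro sum.cong) (auto simp: w_def)
    finally show ?thesis .
  qed
  have cA: "card ?A = (n div K - 1) choose (d - 1)"
  proof -
    have "i \<in> community n h (h i)" using i by (simp add: community_def)
    then show ?thesis using \<open>d \<ge> 2\<close> card_community[OF h hi] i by (subst card_stars) auto
  qed
  have cB: "card ?B = (n div K) choose (d - 1)"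
  proof -
    have "i \<notin> community n h l" using l by (simp add: community_def)
    then show ?thesis using \<open>d \<ge> 2\<close> card_community[OF h l(1)] i by (subst card_stars) auto
  qed
  have b: "(\<Sum>e\<in>node_sets n d. edge_prob h p q e * (exp (w e) - 1))
      \<le> q * real (n div K choose (d - 1)) * (exp s - 1)
        - p * real ((n div K - 1) choose (d - 1)) * (1 - exp (- s))"
    by (subst split) (simp_all add: pA pB cA cB algebra_simps)
  have W: "(\<Sum>e\<in>node_sets n d. w e * of_bool (x e))
      = s * ((\<Sum>e\<in>?B. of_bool (x e)) - (\<Sum>e\<in>?A. of_bool (x e)))" for x
    by (subst split) (simp_all add: sum_distrib_left[symmetric] sum_negf algebra_simps del: sum_mult_of_bool_eq)
  have "measure_pmf.prob (hyperedge_law n d h p q)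
     {x. (\<Sum>e\<in>?A. of_bool (x e)) - (\<Sum>e\<in>?B. of_bool (x e)) < a}
     \<le> measure_pmf.prob (hyperedge_law n d h p q) {x. - (s * a) \<le> (\<Sum>e\<in>node_sets n d. w e * of_bool (x e))}"
  proof (intro measure_pmf.finite_measure_mono subsetI CollectI)
    fix x assume "x \<in> {x. (\<Sum>e\<in>?A. of_bool (x e)) - (\<Sum>e\<in>?B. of_bool (x e)) < a}"
    then have "s * - a \<le> s * ((\<Sum>e\<in>?B. of_bool (x e)) - (\<Sum>e\<in>?A. of_bool (x e)))"
      using \<open>s \<ge> 0\<close> by (intro mult_left_mono) auto
    then show "- (s * a) \<le> (\<Sum>e\<in>node_sets n d. w e * of_bool (x e))" unfolding W by simp
  qed simp
  also have "\<dots> \<le> exp (q * real (n div K choose (d - 1)) * (exp s - 1)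
        - p * real ((n div K - 1) choose (d - 1)) * (1 - exp (- s)) - - (s * a))"
    unfolding hyperedge_law_def
    by (rule Chernoff_weighted[OF finite_node_sets edge_prob_bounds(1)[OF pq] b])
  finally show ?thesis by simp
qed

lemma eventually_log_param:
  assumes "d \<ge> 2" "0 \<le> \<beta>" "\<beta> \<le> \<alpha>"
  shows "\<forall>\<^sub>F n in sequentially. 0 \<le> log_param \<beta> d n \<and> log_param \<beta> d n \<le> log_param \<alpha> d n \<and> log_param \<alpha> d n \<le> 1"
proof -
  have "(\<lambda>n. \<alpha> * ln (real n) / real n) \<longlonglongrightarrow> 0" by real_asymp
  then have "\<forall>\<^sub>F n in sequentially. \<alpha> * ln (real n) / real n < 1" by (rule order_tendstoD) simp
  moreover have "\<forall>\<^sub>F n in sequentially. n \<ge> (1::nat)" by (rule eventually_ge_at_top)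
  ultimately show ?thesis
  proof eventually_elim
    case (elim n)
    have "\<beta> * ln (real n) \<le> \<alpha> * ln (real n)" using elim assms by (intro mult_right_mono) auto
    moreover have "log_param \<alpha> d n \<le> 1"
    proof -
      have "log_param \<alpha> d n \<le> \<alpha> * ln (real n) / real n"
        unfolding log_param_def using elim assms self_le_power[of "real n" "d - 1"]
        by (intro divide_left_mono) auto
      then show ?thesis using elim by linarith
    qed
    moreover have "0 \<le> log_param \<beta> d n" using elim assms(2) by (simp add: log_param_def)
    ultimately show ?case using elim by (auto simp: log_param_def divide_right_mono)
  qed
qed

text \<open>
  Let \<open>\<eta> > 1\<close> be the quotient in the last assumption. One pair of a node and a wrong community fails with
  probability about \<open>n powr - \<eta>\<close>, and this survives the union over at most \<open>n * K\<close> pairs even if a small positive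
  margin \<open>\<Gamma>\<close> is demanded.
\<close>

lemma prob_no_gap_le:
  fixes \<alpha> \<beta> :: real
  assumes "d \<ge> 2" and "K \<ge> 2" and "\<alpha> > \<beta>" and "\<beta> > 0"
    and snr: "(sqrt \<alpha> - sqrt \<beta>)\<^sup>2 / (real K ^ (d - 1) * fact (d - 1)) > 1"
  obtains \<Gamma> c :: real where "\<Gamma> > 0" "c > 0"
    "\<forall>\<^sub>F n in sequentially. K dvd n \<longrightarrow> (\<forall>h\<in>balanced_labellings n K.
       measure_pmf.prob (hyperedge_law n d h (log_param \<alpha> d n) (log_param \<beta> d n))
         {x. \<not> has_gap n d K x h (\<Gamma> * ln (real n))} \<le> real n powr (- c))"
proof -
  define D where "D = real K ^ (d - 1) * fact (d - 1)"
  define \<eta> where "\<eta> = (sqrt \<alpha> - sqrt \<beta>)\<^sup>2 / D"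
  define c where "c = (\<eta> - 1) / 4"
  define u where "u = sqrt \<alpha> / sqrt \<beta>"
  define s where "s = ln u"
  define \<delta> where "\<delta> = c * D / \<alpha>"
  define \<Gamma> where "\<Gamma> = c * fact (d - 1) / s"
  have D: "D > 0" using \<open>K \<ge> 2\<close> by (simp add: D_def)
  have c: "c > 0" using snr by (simp add: c_def \<eta>_def D_def)
  have u: "u > 1" using assms(3,4) by (simp add: u_def)
  then have s: "s > 0" by (simp add: s_def)
  have \<delta>: "\<delta> > 0" using c D assms by (simp add: \<delta>_def)
  have \<Gamma>: "\<Gamma> > 0" using c s by (simp add: \<Gamma>_def)
  have e1: "\<beta> * u = sqrt \<alpha> * sqrt \<beta>"
    using assms(3,4) by (simp add: u_def divide_simps)
  have e2: "\<alpha> / u = sqrt \<alpha> * sqrt \<beta>"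
    using assms(3,4) by (simp add: u_def divide_simps)
  have sq: "(sqrt \<alpha> - sqrt \<beta>)\<^sup>2 = \<alpha> + \<beta> - 2 * (sqrt \<alpha> * sqrt \<beta>)"
    using assms(3,4) by (simp add: power2_diff)
  \<comment> \<open>The excess \<open>4 * c\<close> in \<open>\<eta> = 1 + 4 * c\<close> is shared between the lower order terms of the binomial
      coefficients, the required margin, the number of communities, and the final bound.\<close>
  have rate: "(\<beta> * (u - 1) - (1 - \<delta>) * \<alpha> * (1 - 1 / u)) / D + s * (\<Gamma> / fact (d - 1)) \<le> - (1 + 2 * c)"
  proof -
    have "\<beta> * (u - 1) - (1 - \<delta>) * \<alpha> * (1 - 1 / u)
        = - (\<eta> * D) + \<delta> * \<alpha> * (1 - 1 / u)"
    proof -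
      have "\<beta> * (u - 1) - (1 - \<delta>) * \<alpha> * (1 - 1 / u)
        = \<beta> * u - \<beta> - \<alpha> + \<alpha> / u + \<delta> * \<alpha> * (1 - 1 / u)" by (simp add: algebra_simps)
      then show ?thesis using D unfolding e1 e2 by (simp add: \<eta>_def sq)
    qed
    also have "\<dots> \<le> - (\<eta> * D) + \<delta> * \<alpha>"
      using u \<delta> assms(3,4) by (simp add: mult_left_le)
    also have "\<dots> = (c - \<eta>) * D" using assms(3,4) by (simp add: \<delta>_def algebra_simps)
    finally have "(\<beta> * (u - 1) - (1 - \<delta>) * \<alpha> * (1 - 1 / u)) / D \<le> c - \<eta>"
      using D by (simp add: divide_simps)
    moreover have "s * (\<Gamma> / fact (d - 1)) = c" using s by (simp add: \<Gamma>_def)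
    moreover have "\<eta> = 1 + 4 * c" by (simp add: c_def field_simps)
    moreover have "x + y \<le> - (1 + 2 * c)" if "x \<le> c - \<eta>" "y = c" "\<eta> = 1 + 4 * c" for x y
      using that by linarith
    ultimately show ?thesis by blast
  qed
  have "filterlim (\<lambda>n. n div K) at_top sequentially"
    using \<open>K \<ge> 2\<close> by (intro filterlim_at_top_div_const_nat) auto
  note ev_m = eventually_compose_filterlim[OF eventually_choose_ge[OF \<delta>, of "d - 1"] this]
  have "filterlim (\<lambda>n. real n powr c) at_top sequentially"
    using c by real_asymp
  then have ev_K: "\<forall>\<^sub>F n in sequentially. real K \<le> real n powr c"
    by (simp add: filterlim_at_top)
  have "\<forall>\<^sub>F n in sequentially. K dvd n \<longrightarrow> (\<forall>h\<in>balanced_labellings n K.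
       measure_pmf.prob (hyperedge_law n d h (log_param \<alpha> d n) (log_param \<beta> d n))
         {x. \<not> has_gap n d K x h (\<Gamma> * ln (real n))} \<le> real n powr (- c))"
    using ev_m ev_K eventually_log_param[OF assms(1) less_imp_le[OF assms(4)] less_imp_le[OF assms(3)]]
      eventually_ge_at_top[of 2]
  proof eventually_elim
    case (elim n)
    show ?case
    proof (intro impI ballI)
      fix h assume dvd: "K dvd n" and h: "h \<in> balanced_labellings n K"
      define L where "L = ln (real n)"
      define m where "m = n div K"
      define M where "M = hyperedge_law n d h (log_param \<alpha> d n) (log_param \<beta> d n)"
      define Bad where "Bad i l = {x. (\<Sum>e\<in>stars n d i (community n h (h i)). of_bool (x e))
          - (\<Sum>e\<in>stars n d i (community n h l). of_bool (x e)) < \<Gamma> * L / fact (d - 1)}" for i l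
      have n2: "n \<ge> 2" using elim by blast
      then have L: "L > 0" by (simp add: L_def)
      have nm: "real n = real K * real m" using dvd_mult_div_cancel[OF dvd] unfolding m_def of_nat_mult[symmetric] by simp
      have m: "m > 0" using nm n2 by (cases "m = 0") auto
      have D_eq: "real m ^ (d - 1) / real n ^ (d - 1) = fact (d - 1) / D"
      proof -
        have cancel: "y / (x * y) = f / (x * f)" if "y \<noteq> 0" "f \<noteq> 0" for x y f :: real
          using that by (metis nonzero_divide_mult_cancel_right)
        show ?thesis unfolding nm D_def power_mult_distrib by (rule cancel) (use m in auto)
      qed
      have pair: "measure_pmf.prob M (Bad i l) \<le> exp (- (1 + 2 * c) * L)"
        if il: "i < n" "l < K" "l \<noteq> h i" for i l
      proof -
        have "log_param \<beta> d n * real (m choose (d - 1)) * (exp s - 1) \<le> \<beta> * L / D * (u - 1)"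
        proof (rule mult_mono)
          have "real ((m choose (d - 1)) * fact (d - 1)) \<le> real (m ^ (d - 1))"
            by (intro of_nat_mono binomial_fact_pow)
          then have "real (m choose (d - 1)) \<le> real m ^ (d - 1) / fact (d - 1)" by (simp add: divide_simps)
          then have "log_param \<beta> d n * real (m choose (d - 1)) \<le> log_param \<beta> d n * (real m ^ (d - 1) / fact (d - 1))"
            using elim by (intro mult_left_mono) auto
          also have "\<dots> = \<beta> * L * (real m ^ (d - 1) / real n ^ (d - 1)) / fact (d - 1)"
            by (simp add: log_param_def L_def)
          also have "\<dots> = \<beta> * L / D" unfolding D_eq by simp
          finally show "log_param \<beta> d n * real (m choose (d - 1)) \<le> \<beta> * L / D" .
          show "exp s - 1 \<le> u - 1" using u by (simp add: s_def)
        qed (use L D assms u s in auto)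
        moreover have "(1 - \<delta>) * \<alpha> * L / D * (1 - 1 / u)
            \<le> log_param \<alpha> d n * real ((m - 1) choose (d - 1)) * (1 - exp (- s))"
        proof -
          have "(1 - \<delta>) * \<alpha> * L / D = \<alpha> * L * ((1 - \<delta>) * (real m ^ (d - 1) / real n ^ (d - 1)) / fact (d - 1))"
            unfolding D_eq by simp
          also have "\<dots> = log_param \<alpha> d n * ((1 - \<delta>) * real m ^ (d - 1) / fact (d - 1))"
            by (simp add: log_param_def L_def)
          also have "\<dots> \<le> log_param \<alpha> d n * real ((m - 1) choose (d - 1))"
            using elim by (intro mult_left_mono) (auto simp: m_def divide_simps)
          finally have "(1 - \<delta>) * \<alpha> * L / D \<le> log_param \<alpha> d n * real ((m - 1) choose (d - 1))" .
          moreover have "1 - exp (- s) = 1 - 1 / u" using u by (simp add: s_def exp_minus divide_inverse)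
          ultimately show ?thesis using u by (simp only:) (intro mult_right_mono, auto)
        qed
        moreover have "measure_pmf.prob M (Bad i l)
          \<le> exp (log_param \<beta> d n * real (m choose (d - 1)) * (exp s - 1)
             - log_param \<alpha> d n * real ((m - 1) choose (d - 1)) * (1 - exp (- s)) + s * (\<Gamma> * L / fact (d - 1)))"
          unfolding M_def Bad_def m_def
          by (rule star_difference_tail[OF assms(1) h il]) (use elim s in auto)
        ultimately have "measure_pmf.prob M (Bad i l)
          \<le> exp (\<beta> * L / D * (u - 1) - (1 - \<delta>) * \<alpha> * L / D * (1 - 1 / u) + s * (\<Gamma> * L / fact (d - 1)))"
          by (elim order_trans) simp
        also have "\<beta> * L / D * (u - 1) - (1 - \<delta>) * \<alpha> * L / D * (1 - 1 / u) + s * (\<Gamma> * L / fact (d - 1))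
          = ((\<beta> * (u - 1) - (1 - \<delta>) * \<alpha> * (1 - 1 / u)) / D + s * (\<Gamma> / fact (d - 1))) * L"
          using D u by (simp add: field_simps)
        also have "exp \<dots> \<le> exp (- (1 + 2 * c) * L)"
          using rate L by (simp only: exp_le_cancel_iff) (intro mult_right_mono, auto)
        finally show ?thesis .
      qed
      have "{x. \<not> has_gap n d K x h (\<Gamma> * ln (real n))} \<subseteq> (\<Union>i\<in>{..<n}. \<Union>l\<in>{..<K} - {h i}. Bad i l)"
        unfolding has_gap_def Bad_def L_def by (auto simp: not_le divide_simps mult_ac)
      then have "measure_pmf.prob M {x. \<not> has_gap n d K x h (\<Gamma> * ln (real n))}
          \<le> measure_pmf.prob M (\<Union>i\<in>{..<n}. \<Union>l\<in>{..<K} - {h i}. Bad i l)"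
        by (intro measure_pmf.finite_measure_mono) auto
      also have "\<dots> \<le> (\<Sum>i\<in>{..<n}. measure_pmf.prob M (\<Union>l\<in>{..<K} - {h i}. Bad i l))"
        by (intro measure_pmf.finite_measure_subadditive_finite) auto
      also have "\<dots> \<le> (\<Sum>i\<in>{..<n}. \<Sum>l\<in>{..<K} - {h i}. measure_pmf.prob M (Bad i l))"
        by (intro sum_mono measure_pmf.finite_measure_subadditive_finite) auto
      also have "\<dots> \<le> (\<Sum>i\<in>{..<n}. \<Sum>l\<in>{..<K} - {h i}. exp (- (1 + 2 * c) * L))"
        by (intro sum_mono pair) auto
      also have "\<dots> \<le> (\<Sum>i\<in>{..<n}. \<Sum>l\<in>{..<K}. exp (- (1 + 2 * c) * L))"
        by (intro sum_mono sum_mono2) auto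
      also have "\<dots> = real n * (real K * exp (- (1 + 2 * c) * L))" by simp
      also have "exp (- (1 + 2 * c) * L) = real n powr (- 1) * real n powr (- c) * real n powr (- c)"
        using elim by (simp add: L_def powr_def exp_add[symmetric] algebra_simps)
      also have "real n * (real K * (real n powr (- 1) * real n powr (- c) * real n powr (- c)))
          = real K * real n powr (- c) * real n powr (- c)"
        using elim by (simp add: powr_minus divide_simps)
      also have "\<dots> \<le> 1 * real n powr (- c)"
        using elim by (intro mult_right_mono) (auto simp: powr_minus divide_simps)
      finally show "measure_pmf.prob (hyperedge_law n d h (log_param \<alpha> d n) (log_param \<beta> d n))
         {x. \<not> has_gap n d K x h (\<Gamma> * ln (real n))} \<le> real n powr (- c)" by (simp add: M_def)
    qed
  qed
  then show thesis using that \<Gamma> c by blast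
qed

section \<open>Perturbation of the tensor power\<close>

text \<open>
  The left-hand sides are the two terms of \<open>sum_squares_blocks_tail\<close> for \<open>n\<close> blocks of mean
  \<open>\<mu> = \<alpha> * r * ln n / n\<close>. If \<open>r \<le> sqrt n\<close> then \<open>\<mu>\<close> is small and, with high probability no
  block sees more than a constant number of events, so that a constant truncation level is possible. If \<open>r > sqrt n\<close> the level has to be of order \<open>ln n\<close>, which is
  affordable because the sum of squares to be bounded is of order \<open>r * ln n\<close>, much larger than \<open>(ln n) ^ 3\<close>.
\<close>

lemma noise_tail_parameters:
  fixes \<alpha> C2 :: real
  assumes "\<alpha> > 0" and C2_def: "C2 = 2 * \<alpha> + 12 * (3 * \<alpha> + 26)\<^sup>2"
  shows "\<forall>\<^sub>F n in sequentially. \<forall>r\<in>{1..n}. \<exists>s\<ge>0. \<exists>l>0.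
     real n * exp (\<alpha> * r * ln n / n * (exp s - 1) - s * l) \<le> exp (- 12 * ln n) \<and>
     exp ((2 * real n * (\<alpha> * r * ln n / n) - C2 * r * ln n) / (l + \<alpha> * r * ln n / n)\<^sup>2) \<le> exp (- 12 * ln n)"
proof -
  have "\<forall>\<^sub>F n in sequentially. ln (real n) \<le> sqrt n" by real_asymp
  moreover have "\<forall>\<^sub>F n in sequentially. (ln (real n))\<^sup>2 \<le> sqrt n" by real_asymp
  ultimately show ?thesis
    using eventually_ge_at_top[of 3]
  proof eventually_elim
    case (elim n)
    define L where "L = ln (real n)"
    define L0 where "L0 = 3 * \<alpha> + 26"
    have n: "n > 0" using elim by simp
    have L: "L > 0" using elim by (simp add: L_def)
    have L0: "L0 > 0" using assms by (simp add: L0_def)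
    have nL: "real n = exp L" using n by (simp add: L_def)
    have "\<exists>s\<ge>0. \<exists>l>0. real n * exp (\<alpha> * r * L / n * (exp s - 1) - s * l) \<le> exp (- 12 * L) \<and>
       exp ((2 * real n * (\<alpha> * r * L / n) - C2 * r * L) / (l + \<alpha> * r * L / n)\<^sup>2) \<le> exp (- 12 * L)"
      if r: "r \<in> {1..n}" for r
    proof -
      define \<mu> where "\<mu> = \<alpha> * r * L / n"
      have \<mu>0: "\<mu> \<ge> 0" using assms L by (simp add: \<mu>_def)
      have r1: "real r \<ge> 1" using r by simp
      have B: "2 * real n * \<mu> - C2 * r * L = - (12 * L0\<^sup>2 * r * L)"
        using n by (simp add: \<mu>_def C2_def L0_def algebra_simps)
      show ?thesis
      proof (cases "real r \<le> sqrt n")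
        case True
        define s where "s = ln (real n / r)"
        define l where "l = 2 * (\<alpha> + 13)"
        have rn: "real r * real r \<le> real n"
          using True mult_mono[OF True True] by simp
        have s: "L / 2 \<le> s"
        proof -
          have "ln (real n) \<le> ln ((real n / r) * (real n / r))"
            using n r1 rn mult_right_mono[OF rn, of "real n"] by (intro ln_mono) (auto simp: divide_simps)
          also have "\<dots> = 2 * s" using n r1 by (subst ln_mult) (auto simp: s_def)
          finally show ?thesis by (simp add: L_def)
        qed
        have es: "exp s = n / r" using n r1 by (simp add: s_def)
        have "\<mu> * (exp s - 1) \<le> \<mu> * exp s" using \<mu>0 by (intro mult_left_mono) auto
        also have "\<dots> = \<alpha> * L" using n r1 by (simp add: es \<mu>_def)
        finally have "\<mu> * (exp s - 1) \<le> \<alpha> * L" .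
        moreover have "L / 2 * l \<le> s * l" using s assms by (intro mult_right_mono) (auto simp: l_def)
        moreover have "L / 2 * l = \<alpha> * L + 13 * L" by (simp add: l_def algebra_simps)
        ultimately have "L + (\<mu> * (exp s - 1) - s * l) \<le> - 12 * L" by linarith
        then have 1: "real n * exp (\<mu> * (exp s - 1) - s * l) \<le> exp (- 12 * L)"
          by (simp only: nL exp_add[symmetric] exp_le_cancel_iff)
        have "r * L \<le> sqrt n * sqrt n" using True elim L by (intro mult_mono) (auto simp: L_def)
        then have "r * L / n \<le> 1" using n by simp
        then have "\<mu> \<le> \<alpha>" using mult_left_mono[of "r * L / n" 1 \<alpha>] assms by (simp add: \<mu>_def)
        then have l\<mu>: "l + \<mu> \<le> L0" "l + \<mu> > 0" using \<mu>0 assms by (auto simp: l_def L0_def)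
        have "12 * L * (l + \<mu>)\<^sup>2 \<le> 12 * L * L0\<^sup>2"
          using l\<mu> L by (intro mult_left_mono power_mono) auto
        also have "\<dots> \<le> 12 * L0\<^sup>2 * r * L" using r1 L L0 by simp
        finally have "(2 * real n * \<mu> - C2 * r * L) / (l + \<mu>)\<^sup>2 \<le> - 12 * L"
          unfolding B using l\<mu>(2) by (simp add: divide_simps)
        then show ?thesis using 1 s L assms unfolding \<mu>_def
          by (intro exI[of _ s] exI[of _ l] conjI) (auto simp: l_def)
      next
        case False
        define l where "l = (2 * \<alpha> + 13) * L"
        have l0: "l > 0" using assms L by (simp add: l_def)
        have \<mu>1: "\<mu> \<le> \<alpha> * L"
        proof -
          have "real r / n \<le> 1" using r n by simp
          then have "\<alpha> * L * (r / n) \<le> \<alpha> * L * 1" using assms L by (intro mult_left_mono) auto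
          then show ?thesis by (simp add: \<mu>_def mult_ac)
        qed
        have "exp 1 - 1 \<le> (2::real)" using exp_le by simp
        then have "\<mu> * (exp 1 - 1) \<le> (\<alpha> * L) * 2" using \<mu>0 \<mu>1 assms L by (intro mult_mono) auto
        then have "L + (\<mu> * (exp 1 - 1) - 1 * l) \<le> - 12 * L" by (simp add: l_def algebra_simps)
        then have 1: "real n * exp (\<mu> * (exp 1 - 1) - 1 * l) \<le> exp (- 12 * L)"
          by (simp only: nL exp_add[symmetric] exp_le_cancel_iff)
        have "l + \<mu> \<le> L0 * L" using \<mu>1 L by (simp add: l_def L0_def algebra_simps)
        then have "12 * L * (l + \<mu>)\<^sup>2 \<le> 12 * L * (L0 * L)\<^sup>2"
          using l0 \<mu>0 L by (intro mult_left_mono power_mono) auto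
        also have "\<dots> = 12 * L0\<^sup>2 * L * L\<^sup>2" by (simp add: power2_eq_square)
        also have "\<dots> \<le> 12 * L0\<^sup>2 * L * r"
          using False elim L by (intro mult_left_mono) (auto simp: L_def)
        finally have "(2 * real n * \<mu> - C2 * r * L) / (l + \<mu>)\<^sup>2 \<le> - 12 * L"
          unfolding B using l0 \<mu>0 by (simp add: divide_simps mult_ac)
        then show ?thesis using 1 l0 unfolding \<mu>_def
          by (intro exI[of _ 1] exI[of _ l] conjI) auto
      qed
    qed
    then show ?case unfolding L_def by blast
  qed
qed

text \<open>
  A hyperedge occurs in the rows of all of its nodes. Fixing the rank of the row index within the hyperedge
  selects one of these rows, so that rows become independent.
\<close>

definition ranked_touching :: "nat \<Rightarrow> nat \<Rightarrow> nat set \<Rightarrow> nat \<Rightarrow> nat \<Rightarrow> nat set set" where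
  "ranked_touching n d S s i = {e \<in> touching n d i S. card {j \<in> e. j < i} = s}"

lemma disjoint_ranked_touching: "disjoint_family_on (ranked_touching n d S s) I"
  unfolding disjoint_family_on_def
proof (intro ballI impI)
  have lt: False if "e \<in> ranked_touching n d S s i" "e \<in> ranked_touching n d S s j" "i < j" for e i j
  proof -
    have e: "e \<in> node_sets n d" "i \<in> e" using that by (auto simp: ranked_touching_def touching_def)
    have "card {k \<in> e. k < i} < card {k \<in> e. k < j}"
      using e(2) \<open>i < j\<close> finite_hyperedge[OF e(1)] by (intro psubset_card_mono) auto
    then show False using that by (simp add: ranked_touching_def)
  qed
  fix i j :: nat assume "i \<noteq> j"
  then consider "i < j" | "j < i" by linarith
  then have "\<not> (e \<in> ranked_touching n d S s i \<and> e \<in> ranked_touching n d S s j)" for e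
    by cases (use lt in \<open>meson+\<close>)
  then show "ranked_touching n d S s i \<inter> ranked_touching n d S s j = {}"
    unfolding disjoint_iff by simp
qed

lemma sum_touching_ranked:
  fixes f :: "nat set \<Rightarrow> real"
  shows "(\<Sum>e\<in>touching n d i S. f e) = (\<Sum>s<d. \<Sum>e\<in>ranked_touching n d S s i. f e)"
  unfolding ranked_touching_def
proof (rule sum.group[where g = "\<lambda>e. card {j \<in> e. j < i}", symmetric])
  show "(\<lambda>e. card {j \<in> e. j < i}) ` touching n d i S \<subseteq> {..<d}"
  proof safe
    fix e assume e: "e \<in> touching n d i S"
    then have fe: "finite e" "card e = d" "i \<in> e"
      using finite_hyperedge[of e n d] by (simp_all add: touching_def node_sets_def)
    then have "card {j \<in> e. j < i} < card e" by (intro psubset_card_mono) auto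
    then show "card {j \<in> e. j < i} < d" using fe by simp
  qed
qed (rule finite_touching finite_lessThan)+

definition star_change :: "nat \<Rightarrow> nat \<Rightarrow> (nat \<Rightarrow> nat) \<Rightarrow> (nat \<Rightarrow> nat) \<Rightarrow> nat \<Rightarrow> nat \<Rightarrow> nat set \<Rightarrow> real" where
  "star_change n d g h i k e =
     of_bool (e \<in> stars n d i (community n h k)) - of_bool (e \<in> stars n d i (community n g k))"

lemma abs_star_change_le: "\<bar>star_change n d g h i k e\<bar> \<le> 1"
  by (auto simp: star_change_def)

lemma sum_star_change:
  "(\<Sum>e\<in>touching n d i (mismatches n g h). star_change n d g h i k e * f e)
   = (\<Sum>e\<in>stars n d i (community n h k). f e) - (\<Sum>e\<in>stars n d i (community n g k). f e)"
proof -
  let ?T = "touching n d i (mismatches n g h)"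
    and ?A = "stars n d i (community n h k)" and ?B = "stars n d i (community n g k)"
  have "(\<Sum>e\<in>?T. star_change n d g h i k e * f e) = (\<Sum>e\<in>node_sets n d. star_change n d g h i k e * f e)"
  proof (rule sum.mono_neutral_left)
    show "\<forall>e\<in>node_sets n d - ?T. star_change n d g h i k e * f e = 0"
      using stars_community_diff[of n d i h k g] stars_community_diff[of n d i g k h]
      by (auto simp: star_change_def)
  qed (auto simp: touching_def)
  also have "\<dots> = (\<Sum>e\<in>node_sets n d. of_bool (e \<in> ?A) * f e) - (\<Sum>e\<in>node_sets n d. of_bool (e \<in> ?B) * f e)"
    by (simp only: star_change_def left_diff_distrib sum_subtractf)
  also have "(\<Sum>e\<in>node_sets n d. of_bool (e \<in> ?A) * f e) = (\<Sum>e\<in>?A. f e)"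
    by (rule sum.mono_neutral_cong_right) (auto simp: stars_def)
  also have "(\<Sum>e\<in>node_sets n d. of_bool (e \<in> ?B) * f e) = (\<Sum>e\<in>?B. f e)"
    by (rule sum.mono_neutral_cong_right) (auto simp: stars_def)
  finally show ?thesis .
qed

text \<open>
  As \<open>d \<ge> 2\<close>, the nodes of a hyperedge other than \<open>i\<close> determine the only community that can contain them.
\<close>

lemma sum_abs_star_change_le:
  assumes "d \<ge> 2"
  shows "(\<Sum>k<K. \<bar>star_change n d g h i k e\<bar>) \<le> 2"
proof -
  have one: "(\<Sum>k<K. of_bool (e \<in> stars n d i (community n f k)) :: real) \<le> 1" for f
  proof -
    have "(\<Sum>k<K. of_bool (e \<in> stars n d i (community n f k)) :: real)
        = real (card {k \<in> {..<K}. e \<in> stars n d i (community n f k)})"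
      by (rule sum_of_bool_class) simp
    also have "card {k \<in> {..<K}. e \<in> stars n d i (community n f k)} \<le> 1"
    proof (rule card_le_Suc0_iff_eq[THEN iffD2, unfolded One_nat_def[symmetric], rotated], intro ballI)
      fix k l assume k: "k \<in> {k \<in> {..<K}. e \<in> stars n d i (community n f k)}"
        and l: "l \<in> {k \<in> {..<K}. e \<in> stars n d i (community n f k)}"
      then have "e \<noteq> {i}" "i \<in> e" using assms by (auto simp: stars_def node_sets_def)
      then obtain j where "j \<in> e" "j \<noteq> i" by blast
      then have "f j = k" "f j = l" using k l by (auto simp: stars_def community_def)
      then show "k = l" by simp
    qed simp
    finally show ?thesis by simp
  qed
  have "(\<Sum>k<K. \<bar>star_change n d g h i k e\<bar>)
     \<le> (\<Sum>k<K. of_bool (e \<in> stars n d i (community n h k)) + of_bool (e \<in> stars n d i (community n g k)))"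
    by (rule sum_mono) (auto simp: star_change_def)
  also have "\<dots> \<le> 2" using one[of h] one[of g] unfolding sum.distrib by linarith
  finally show ?thesis .
qed

lemma edge_prob_split: "edge_prob g p q e = q + (p - q) * of_bool (monochromatic g e)"
  by (simp add: edge_prob_def)

lemma fact_choose_le_power:
  "fact r * real (m choose r) \<le> real m ^ r"
proof -
  have "real ((m choose r) * fact r) \<le> real (m ^ r)" by (intro of_nat_mono binomial_fact_pow)
  then show ?thesis by (simp add: mult.commute)
qed

text \<open>
  For a constant probability only the numbers of hyperedges matter. Communities of \<open>g\<close> and of \<open>h\<close> all have
  \<open>n div K\<close> nodes, so these numbers differ only if \<open>i\<close> itself belongs to the community in one labelling but not
  in the other.
\<close>

lemma uniform_part_bound:
  assumes "d \<ge> 2" and g: "g \<in> balanced_labellings n K" and h: "h \<in> balanced_labellings n K"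
    and "i < n" "k < K"
  shows "\<bar>\<Sum>e\<in>touching n d i (mismatches n g h). star_change n d g h i k e\<bar>
       \<le> real n ^ (d - 2) * \<bar>of_bool (h i = k) - of_bool (g i = k)\<bar>"
proof -
  define m where "m = n div K"
  have card: "card (stars n d i (community n f k)) = (m - of_bool (f i = k)) choose (d - 1)"
    if "f \<in> balanced_labellings n K" for f
    using card_community[OF that \<open>k < K\<close>] \<open>d \<ge> 2\<close> \<open>i < n\<close>
    by (subst card_stars) (auto simp: m_def community_def)
  have eq: "(\<Sum>e\<in>touching n d i (mismatches n g h). star_change n d g h i k e)
      = real ((m - of_bool (h i = k)) choose (d - 1)) - real ((m - of_bool (g i = k)) choose (d - 1))"
    using sum_star_change[of n d g h i k "\<lambda>_. 1"] card[OF h] card[OF g] by simp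
  have diff: "\<bar>real ((m - 1) choose (d - 1)) - real (m choose (d - 1))\<bar> \<le> real n ^ (d - 2)"
  proof (cases m)
    case (Suc m')
    have d1: "d - 1 = Suc (d - 2)" using \<open>d \<ge> 2\<close> by simp
    have "\<bar>real ((m - 1) choose (d - 1)) - real (m choose (d - 1))\<bar> = real (m' choose (d - 2))"
      unfolding d1 Suc by simp
    also have "\<dots> \<le> real (n ^ (d - 2))"
    proof (rule of_nat_mono)
      have "m' \<le> n" using Suc div_le_dividend[of n K] by (simp add: m_def)
      then have "m' ^ (d - 2) \<le> n ^ (d - 2)" by (rule power_mono) simp
      then show "m' choose (d - 2) \<le> n ^ (d - 2)" using choose_le_power[of m' "d - 2"] by linarith
    qed
    finally show ?thesis by simp
  qed simp
  show ?thesis unfolding eq using diff by (auto simp: abs_minus_commute)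
qed

text \<open>
  A monochromatic hyperedge through \<open>i\<close> lies in the community of \<open>i\<close>, so that only the errors in that community
  matter; and each hyperedge changes at most two entries of the row.
\<close>

lemma community_part_bound:
  assumes "d \<ge> 2" and g: "g \<in> balanced_labellings n K" and "i < n"
  shows "(\<Sum>k<K. (fact (d - 1) * (\<Sum>e\<in>touching n d i (mismatches n g h).
            star_change n d g h i k e * of_bool (monochromatic g e)))\<^sup>2)
       \<le> (2 * real (d - 1) * real (n div K) ^ (d - 2) * real (card (mismatches n g h \<inter> community n g (g i))))\<^sup>2"
proof -
  let ?S = "mismatches n g h" and ?V = "community n g (g i)" and ?m = "n div K"
  let ?T = "touching n d i ?S" and ?c = "star_change n d g h i"
  define a where "a k = fact (d - 1) * (\<Sum>e\<in>?T. ?c k e * of_bool (monochromatic g e))" for k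
  have gi: "g i < K" using g \<open>i < n\<close> by (simp add: balanced_labellings_def labellings_def)
  have cnt: "fact (d - 1) * (\<Sum>e\<in>?T. of_bool (monochromatic g e)) \<le> real (d - 1) * real ?m ^ (d - 2) * card (?S \<inter> ?V)"
  proof -
    have "(\<Sum>e\<in>?T. of_bool (monochromatic g e) :: real) = real (card {e \<in> ?T. monochromatic g e})" by (rule sum_of_bool_class) simp
    also have "\<dots> \<le> real (card {e \<in> ?T. e - {i} \<subseteq> ?V})"
    proof (intro of_nat_mono card_mono)
      show "{e \<in> ?T. monochromatic g e} \<subseteq> {e \<in> ?T. e - {i} \<subseteq> ?V}"
        by (auto simp: touching_def node_sets_def community_def monochromatic_def)
    qed simp
    also have "\<dots> \<le> real (card (?S \<inter> ?V) * (?m choose (d - 2)))"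
      using card_touching_in[OF finite_subset[OF community_subset finite_lessThan] \<open>d \<ge> 2\<close>, of n i ?S n g "g i"]
        card_community[OF g gi] by (intro of_nat_mono) simp
    finally have "fact (d - 1) * (\<Sum>e\<in>?T. of_bool (monochromatic g e))
        \<le> fact (d - 1) * real (card (?S \<inter> ?V) * (?m choose (d - 2)))" by (rule mult_left_mono) simp
    also have "fact (d - 1) * real (card (?S \<inter> ?V) * (?m choose (d - 2)))
        = real (d - 1) * (fact (d - 2) * real (?m choose (d - 2))) * card (?S \<inter> ?V)"
    proof -
      have "d - 1 = Suc (d - 2)" using \<open>d \<ge> 2\<close> by simp
      then have "(fact (d - 1) :: real) = real (d - 1) * fact (d - 2)" by (simp only: fact_Suc)
      then show ?thesis by simp
    qed
    also have "\<dots> \<le> real (d - 1) * real ?m ^ (d - 2) * card (?S \<inter> ?V)"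
      by (intro mult_right_mono mult_left_mono fact_choose_le_power) auto
    finally show ?thesis .
  qed
  have "(\<Sum>k<K. (a k)\<^sup>2) = (L2_set a {..<K})\<^sup>2" by (simp add: L2_set_def sum_nonneg)
  also have "\<dots> \<le> (\<Sum>k<K. \<bar>a k\<bar>)\<^sup>2" by (intro power_mono L2_set_le_sum_abs L2_set_nonneg)
  also have "\<dots> \<le> (2 * real (d - 1) * real ?m ^ (d - 2) * card (?S \<inter> ?V))\<^sup>2"
  proof (rule power_mono)
    have "(\<Sum>k<K. \<bar>a k\<bar>) \<le> (\<Sum>k<K. fact (d - 1) * (\<Sum>e\<in>?T. \<bar>?c k e\<bar> * of_bool (monochromatic g e)))"
      unfolding a_def abs_mult by (intro sum_mono mult_mono order_trans[OF sum_abs]) (auto simp: abs_mult)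
    also have "\<dots> = fact (d - 1) * (\<Sum>e\<in>?T. (\<Sum>k<K. \<bar>?c k e\<bar>) * of_bool (monochromatic g e))"
      unfolding sum_distrib_left[symmetric] sum_distrib_right by (subst sum.swap) rule
    also have "\<dots> \<le> fact (d - 1) * (\<Sum>e\<in>?T. 2 * of_bool (monochromatic g e))"
      by (intro mult_left_mono sum_mono mult_right_mono sum_abs_star_change_le \<open>d \<ge> 2\<close>) auto
    also have "\<dots> = 2 * (fact (d - 1) * (\<Sum>e\<in>?T. of_bool (monochromatic g e)))"
      by (simp only: sum_distrib_left[symmetric] mult_ac)
    finally show "(\<Sum>k<K. \<bar>a k\<bar>) \<le> 2 * real (d - 1) * real ?m ^ (d - 2) * card (?S \<inter> ?V)"
      using cnt by linarith
  qed (simp add: sum_nonneg)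
  finally show ?thesis by (simp add: a_def)
qed

text \<open>
  One factor is bounded by the number of all errors. The other one is summed exactly, since each error is counted by
  the \<open>n div K\<close> nodes of its community.
\<close>

lemma sum_card_mismatches_in_community_sq_le:
  assumes g: "g \<in> balanced_labellings n K"
  shows "(\<Sum>i<n. (real (card (mismatches n g h \<inter> community n g (g i))))\<^sup>2)
       \<le> real (n div K) * (real (card (mismatches n g h)))\<^sup>2"
proof -
  let ?S = "mismatches n g h"
  have "(\<Sum>i<n. (real (card (?S \<inter> community n g (g i))))\<^sup>2)
      \<le> (\<Sum>i<n. real (card ?S) * real (card (?S \<inter> community n g (g i))))"
    unfolding power2_eq_square by (intro sum_mono mult_right_mono of_nat_mono card_mono) auto
  also have "\<dots> = real (card ?S) * (\<Sum>i<n. \<Sum>j\<in>?S. of_bool (g j = g i))"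
    unfolding sum_distrib_left[symmetric]
    by (intro arg_cong[of _ _ "(*) _"] sum.cong, simp, subst sum_of_bool_class)
       (auto simp: community_def mismatches_def intro!: arg_cong[of _ _ card])
  also have "(\<Sum>i<n. \<Sum>j\<in>?S. of_bool (g j = g i) :: real) = (\<Sum>j\<in>?S. \<Sum>i<n. of_bool (g j = g i))"
    by (rule sum.swap)
  also have "\<dots> = (\<Sum>j\<in>?S. real (n div K))"
  proof (rule sum.cong[OF refl])
    fix j assume "j \<in> ?S"
    then have j: "g j < K" using g by (auto simp: mismatches_def balanced_labellings_def labellings_def)
    have "{i \<in> {..<n}. g j = g i} = community n g (g j)" by (auto simp: community_def)
    then show "(\<Sum>i<n. of_bool (g j = g i) :: real) = real (n div K)"
      using card_community[OF g j] by (subst sum_of_bool_class) auto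
  qed
  finally show ?thesis by (simp add: power2_eq_square mult_ac)
qed

lemma hyperedge_law_permute:
  assumes "\<sigma> permutes {..<K}"
  shows "hyperedge_law n d (\<sigma> \<circ> h) p q = hyperedge_law n d h p q"
proof -
  have "inj \<sigma>" using permutes_inj[OF assms] .
  then have "monochromatic (\<sigma> \<circ> h) e = monochromatic h e" for e
    by (simp add: monochromatic_def inj_eq)
  then show ?thesis by (simp add: hyperedge_law_def edge_prob_def)
qed

definition noise :: "nat \<Rightarrow> nat \<Rightarrow> (nat \<Rightarrow> nat) \<Rightarrow> (nat \<Rightarrow> nat) \<Rightarrow> real \<Rightarrow> real \<Rightarrow> (nat set \<Rightarrow> bool) \<Rightarrow> nat \<Rightarrow> nat \<Rightarrow> nat \<Rightarrow> real" where
  "noise n d g h p q x k s i = (\<Sum>e\<in>ranked_touching n d (mismatches n g h) s i.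
     star_change n d g h i k e * (of_bool (x e) - edge_prob g p q e))"

lemma frob_norm_eq_L2_set:
  assumes "X \<in> carrier_mat n K"
  shows "frob_norm X = L2_set (\<lambda>(i, k). X $$ (i, k)) ({..<n} \<times> {..<K})"
  using assms by (simp add: frob_norm_def L2_set_def sum.cartesian_product split_def)

lemma L2_set_prod_le:
  assumes "(\<Sum>i<n. \<Sum>k<K. (f i k)\<^sup>2) \<le> b\<^sup>2" "b \<ge> 0"
  shows "L2_set (\<lambda>(i, k). f i k) ({..<n} \<times> {..<K}) \<le> (b :: real)"
proof -
  have "(\<Sum>ik\<in>{..<n} \<times> {..<K}. (case ik of (i, k) \<Rightarrow> f i k)\<^sup>2) = (\<Sum>i<n. \<Sum>k<K. (f i k)\<^sup>2)"
    by (simp add: sum.cartesian_product split_def)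
  then show ?thesis unfolding L2_set_def using assms real_le_lsqrt by (simp add: real_le_lsqrt sum_nonneg)
qed

text \<open>
  Each entry of the difference is split into the centred part, the part of the mean that comes from the
  uniform probability \<open>q\<close>, and the part that comes from the excess \<open>p - q\<close> inside the communities.
\<close>

lemma tensor_difference_bound:
  assumes "d \<ge> 2" and g: "g \<in> balanced_labellings n K" and h: "h \<in> balanced_labellings n K"
    and "0 \<le> q" "q \<le> p"
    and Z: "\<And>k s. k < K \<Longrightarrow> s < d \<Longrightarrow> (\<Sum>i<n. (noise n d g h p q x k s i)\<^sup>2) \<le> b"
  defines "r \<equiv> real (card (mismatches n g h))"
  shows "frob_norm (tensor_power n d K (adjacency_tensor n d x) (label_mat n K h)
                  - tensor_power n d K (adjacency_tensor n d x) (label_mat n K g))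
     \<le> fact (d - 1) * real d * sqrt (real K * b)
       + q * fact (d - 1) * real n ^ (d - 2) * sqrt (2 * r)
       + (p - q) * (2 * real (d - 1) * real (n div K) ^ (d - 2)) * sqrt (real (n div K)) * r"
proof -
  let ?S = "mismatches n g h" and ?A = "adjacency_tensor n d x" and ?I = "{..<n} \<times> {..<K}"
  let ?T = "\<lambda>i. touching n d i ?S" and ?c = "star_change n d g h"
  define Z where "Z i k = (\<Sum>s<d. noise n d g h p q x k s i)" for i k
  define U where "U i k = (\<Sum>e\<in>?T i. ?c i k e)" for i k
  define W where "W i k = (\<Sum>e\<in>?T i. ?c i k e * of_bool (monochromatic g e))" for i k
  have b0: "b \<ge> 0" if "K > 0"
    using Z[of 0 0] that \<open>d \<ge> 2\<close> sum_nonneg[of "{..<n}" "\<lambda>i. (noise n d g h p q x 0 0 i)\<^sup>2"] by force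
  then have Kb: "real K * b \<ge> 0" by (cases "K = 0") auto
  define X where "X = tensor_power n d K ?A (label_mat n K h) - tensor_power n d K ?A (label_mat n K g)"
  have car: "X \<in> carrier_mat n K"
    unfolding X_def by (rule minus_carrier_mat) (simp add: tensor_power_def)
  have entry: "X $$ (i, k) = fact (d - 1) * Z i k + q * fact (d - 1) * U i k + (p - q) * (fact (d - 1) * W i k)"
    if ik: "i < n" "k < K" for i k
  proof -
    have "X $$ (i, k) = tensor_power n d K ?A (label_mat n K h) $$ (i, k)
                      - tensor_power n d K ?A (label_mat n K g) $$ (i, k)"
      using ik by (simp add: X_def tensor_power_def)
    also have "\<dots> = fact (d - 1) * (\<Sum>e\<in>?T i. ?c i k e * of_bool (x e))"
    proof -
      have t: "tensor_power n d K ?A (label_mat n K f) $$ (i, k)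
        = fact (d - 1) * (\<Sum>e\<in>stars n d i (community n f k). of_bool (x e))" for f
        using tensor_power_label_mat[OF ik, of d x f] \<open>d \<ge> 2\<close> by (simp add: community_def)
      show ?thesis unfolding t sum_star_change by (simp only: right_diff_distrib)
    qed
    also have "(\<Sum>e\<in>?T i. ?c i k e * of_bool (x e))
       = (\<Sum>e\<in>?T i. ?c i k e * (of_bool (x e) - edge_prob g p q e) + q * ?c i k e
            + (p - q) * (?c i k e * of_bool (monochromatic g e)))"
      by (intro sum.cong refl) (simp add: edge_prob_split algebra_simps)
    also have "\<dots> = Z i k + q * U i k + (p - q) * W i k"
      unfolding Z_def U_def W_def noise_def sum_touching_ranked[symmetric] sum.distrib sum_distrib_left[symmetric] ..
    finally show ?thesis by (simp add: algebra_simps)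
  qed
  have "frob_norm X = L2_set (\<lambda>ik. (case ik of (i, k) \<Rightarrow> fact (d - 1) * Z i k)
      + ((case ik of (i, k) \<Rightarrow> q * fact (d - 1) * U i k) + (case ik of (i, k) \<Rightarrow> (p - q) * (fact (d - 1) * W i k)))) ?I"
    unfolding frob_norm_eq_L2_set[OF car] by (rule L2_set_cong) (auto simp: entry)
  also have "\<dots> \<le> L2_set (\<lambda>(i, k). fact (d - 1) * Z i k) ?I
      + (L2_set (\<lambda>(i, k). q * fact (d - 1) * U i k) ?I + L2_set (\<lambda>(i, k). (p - q) * (fact (d - 1) * W i k)) ?I)"
    by (intro order_trans[OF L2_set_triangle_ineq] add_left_mono L2_set_triangle_ineq)
  finally have tri: "frob_norm X \<le> \<dots>" .
  have z: "L2_set (\<lambda>(i, k). fact (d - 1) * Z i k) ?I \<le> fact (d - 1) * real d * sqrt (real K * b)"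
  proof (rule L2_set_prod_le)
    have "(\<Sum>i<n. \<Sum>k<K. (Z i k)\<^sup>2) \<le> (\<Sum>i<n. \<Sum>k<K. (\<Sum>s<d. (noise n d g h p q x k s i)\<^sup>2) * real d)"
      unfolding Z_def
      by (intro sum_mono order_trans[OF sum_squared_le_sum_of_squares]) auto
    also have "\<dots> = real d * (\<Sum>k<K. \<Sum>s<d. \<Sum>i<n. (noise n d g h p q x k s i)\<^sup>2)"
      unfolding sum_distrib_right[symmetric]
      by (subst sum.swap, simp only: sum.swap[of _ "{..<d}" "{..<n}"] mult.commute)
    also have "\<dots> \<le> real d * (\<Sum>k<K. \<Sum>s<d. b)" by (intro mult_left_mono sum_mono Z) auto
    finally have "(\<Sum>i<n. \<Sum>k<K. (Z i k)\<^sup>2) \<le> real d * real d * (real K * b)" by (simp add: mult_ac)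
    then have "(fact (d - 1))\<^sup>2 * (\<Sum>i<n. \<Sum>k<K. (Z i k)\<^sup>2) \<le> (fact (d - 1))\<^sup>2 * (real d * real d * (real K * b))"
      by (rule mult_left_mono) simp
    then show "(\<Sum>i<n. \<Sum>k<K. (fact (d - 1) * Z i k)\<^sup>2) \<le> (fact (d - 1) * real d * sqrt (real K * b))\<^sup>2"
      using Kb by (simp add: power_mult_distrib sum_distrib_left power2_eq_square mult_ac)
  qed (use Kb in simp)
  have u: "L2_set (\<lambda>(i, k). q * fact (d - 1) * U i k) ?I \<le> q * fact (d - 1) * real n ^ (d - 2) * sqrt (2 * r)"
  proof (rule L2_set_prod_le)
    let ?y = "q * fact (d - 1) * real n ^ (d - 2)"
    have "(\<Sum>i<n. \<Sum>k<K. (q * fact (d - 1) * U i k)\<^sup>2)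
        \<le> (\<Sum>i<n. \<Sum>k<K. ?y\<^sup>2 * (of_bool (h i = k) - of_bool (g i = k))\<^sup>2)"
    proof (intro sum_mono)
      fix i k assume "i \<in> {..<n}" "k \<in> {..<K}"
      then have "\<bar>U i k\<bar> \<le> real n ^ (d - 2) * \<bar>of_bool (h i = k) - of_bool (g i = k)\<bar>"
        unfolding U_def by (intro uniform_part_bound[OF \<open>d \<ge> 2\<close> g h]) auto
      then have "\<bar>q * fact (d - 1)\<bar> * \<bar>U i k\<bar>
          \<le> \<bar>q * fact (d - 1)\<bar> * (real n ^ (d - 2) * \<bar>of_bool (h i = k) - of_bool (g i = k)\<bar>)"
        by (rule mult_left_mono) simp
      then have "\<bar>q * fact (d - 1) * U i k\<bar> \<le> \<bar>?y * (of_bool (h i = k) - of_bool (g i = k))\<bar>"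
        by (simp add: abs_mult mult.assoc)
      then show "(q * fact (d - 1) * U i k)\<^sup>2 \<le> ?y\<^sup>2 * (of_bool (h i = k) - of_bool (g i = k))\<^sup>2"
        unfolding power_mult_distrib[of ?y, symmetric] abs_le_square_iff .
    qed
    also have "\<dots> = ?y\<^sup>2 * (\<Sum>i<n. \<Sum>k<K. (of_bool (h i = k) - of_bool (g i = k))\<^sup>2)"
      by (simp only: sum_distrib_left)
    also have "(\<Sum>i<n. \<Sum>k<K. (of_bool (h i = k) - of_bool (g i = k) :: real)\<^sup>2) = 2 * r"
    proof -
      have "(\<Sum>i<n. \<Sum>k<K. (of_bool (h i = k) - of_bool (g i = k) :: real)\<^sup>2) = (\<Sum>i<n. 2 * of_bool (h i \<noteq> g i))"
        using g h by (intro sum.cong sum_squares_label_diff) (auto simp: balanced_labellings_def labellings_def)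
      also have "\<dots> = 2 * real (card {i \<in> {..<n}. h i \<noteq> g i})"
        unfolding sum_distrib_left[symmetric] by (subst sum_of_bool_class) auto
      finally show ?thesis by (simp add: r_def mismatches_def)
    qed
    finally show "(\<Sum>i<n. \<Sum>k<K. (q * fact (d - 1) * U i k)\<^sup>2) \<le> (?y * sqrt (2 * r))\<^sup>2"
      by (simp add: power_mult_distrib r_def)
  qed (use \<open>0 \<le> q\<close> in \<open>simp add: r_def\<close>)
  have w: "L2_set (\<lambda>(i, k). (p - q) * (fact (d - 1) * W i k)) ?I
      \<le> (p - q) * (2 * real (d - 1) * real (n div K) ^ (d - 2)) * sqrt (real (n div K)) * r"
  proof (rule L2_set_prod_le)
    let ?y = "2 * real (d - 1) * real (n div K) ^ (d - 2)"
    have "(\<Sum>i<n. \<Sum>k<K. (fact (d - 1) * W i k)\<^sup>2) \<le> (\<Sum>i<n. (?y * real (card (?S \<inter> community n g (g i))))\<^sup>2)"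
      unfolding W_def by (intro sum_mono community_part_bound[OF \<open>d \<ge> 2\<close> g]) auto
    also have "\<dots> = ?y\<^sup>2 * (\<Sum>i<n. (real (card (?S \<inter> community n g (g i))))\<^sup>2)"
      by (simp only: sum_distrib_left power_mult_distrib)
    also have "\<dots> \<le> ?y\<^sup>2 * (real (n div K) * r\<^sup>2)"
      unfolding r_def by (intro mult_left_mono sum_card_mismatches_in_community_sq_le[OF g]) simp
    finally have "(p - q)\<^sup>2 * (\<Sum>i<n. \<Sum>k<K. (fact (d - 1) * W i k)\<^sup>2) \<le> (p - q)\<^sup>2 * (?y\<^sup>2 * (real (n div K) * r\<^sup>2))"
      by (rule mult_left_mono) simp
    moreover have "(\<Sum>i<n. \<Sum>k<K. ((p - q) * (fact (d - 1) * W i k))\<^sup>2)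
        = (p - q)\<^sup>2 * (\<Sum>i<n. \<Sum>k<K. (fact (d - 1) * W i k)\<^sup>2)"
      by (simp only: sum_distrib_left power_mult_distrib[of "p - q"])
    moreover have "((p - q) * ?y * sqrt (real (n div K)) * r)\<^sup>2 = (p - q)\<^sup>2 * (?y\<^sup>2 * (real (n div K) * r\<^sup>2))"
    proof -
      have "((p - q) * y * s * r)\<^sup>2 = (p - q)\<^sup>2 * (y\<^sup>2 * (s\<^sup>2 * r\<^sup>2))" for y s
        by (simp add: power_mult_distrib)
      from this[of ?y "sqrt (real (n div K))"] show ?thesis
        by (simp only: real_sqrt_pow2[OF of_nat_0_le_iff])
    qed
    ultimately show "(\<Sum>i<n. \<Sum>k<K. ((p - q) * (fact (d - 1) * W i k))\<^sup>2)
        \<le> ((p - q) * ?y * sqrt (real (n div K)) * r)\<^sup>2" by simp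
  qed (use \<open>q \<le> p\<close> in \<open>simp add: r_def\<close>)
  show ?thesis using tri z u w unfolding X_def by linarith
qed

text \<open>
  The blocks are the hyperedges that touch an error and in which \<open>i\<close> has rank \<open>t\<close>.
\<close>

lemma noise_tail:
  fixes \<alpha> b s l :: real and g h :: "nat \<Rightarrow> nat"
  assumes "d \<ge> 2" "n > 0" and pq: "0 \<le> q" "q \<le> log_param \<alpha> d n" "log_param \<alpha> d n \<le> 1"
    and "s \<ge> 0" "l > 0"
  defines "\<mu> \<equiv> \<alpha> * real (card (mismatches n g h)) * ln n / n"
  shows "measure_pmf.prob (hyperedge_law n d g (log_param \<alpha> d n) q)
      {x. b \<le> (\<Sum>i<n. (noise n d g h (log_param \<alpha> d n) q x k t i)\<^sup>2)}
    \<le> n * exp (\<mu> * (exp s - 1) - s * l) + exp ((2 * real n * \<mu> - b) / (l + \<mu>)\<^sup>2)"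
proof -
  let ?p = "log_param \<alpha> d n" and ?S = "mismatches n g h"
  let ?E = "ranked_touching n d ?S t" and ?P = "edge_prob g ?p q"
  have p0: "0 \<le> ?p" using pq by linarith
  have d1: "real n ^ (d - Suc 0) = real n * real n ^ (d - 2)"
  proof -
    have "d - Suc 0 = Suc (d - 2)" using \<open>d \<ge> 2\<close> by simp
    then show ?thesis by simp
  qed
  have \<mu>: "real (card ?S * n ^ (d - 2)) * ?p = \<mu>"
    using \<open>n > 0\<close> by (simp add: \<mu>_def log_param_def d1)
  have sum: "(\<Sum>e\<in>?E i. ?P e) \<le> \<mu>" for i
  proof -
    have "(\<Sum>e\<in>?E i. ?P e) \<le> (\<Sum>e\<in>?E i. ?p)" by (intro sum_mono edge_prob_bounds(2)[OF pq])
    also have "\<dots> \<le> (\<Sum>e\<in>touching n d i ?S. ?p)"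
      using p0 by (intro sum_mono2) (auto simp: ranked_touching_def)
    also have "\<dots> = real (card (touching n d i ?S)) * ?p" by simp
    also have "\<dots> \<le> real (card ?S * n ^ (d - 2)) * ?p"
      by (intro mult_right_mono of_nat_mono card_touching_le mismatches_subset \<open>d \<ge> 2\<close> p0)
    finally show ?thesis unfolding \<mu> .
  qed
  have \<mu>0: "\<mu> \<ge> 0" unfolding \<mu>[symmetric] using p0 by (intro mult_nonneg_nonneg) auto
  have "measure_pmf.prob (Pi_pmf (node_sets n d) False (\<lambda>e. bernoulli_pmf (?P e)))
      {x. b \<le> (\<Sum>i\<in>{..<n}. (\<Sum>e\<in>?E i. star_change n d g h i k e * (of_bool (x e) - ?P e))\<^sup>2)}
    \<le> card {..<n} * exp (\<mu> * (exp s - 1) - s * l) + exp ((2 * card {..<n} * \<mu> - b) / (l + \<mu>)\<^sup>2)"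
    by (rule sum_squares_blocks_tail[OF finite_node_sets finite_lessThan _ disjoint_ranked_touching
          edge_prob_bounds(1)[OF pq] abs_star_change_le sum \<mu>0 \<open>s \<ge> 0\<close> \<open>l > 0\<close>])
       (auto simp: ranked_touching_def touching_def)
  then show ?thesis by (simp add: hyperedge_law_def noise_def)
qed

text \<open>
  With \<open>r\<close> errors the noise contributes at most a constant times \<open>sqrt (r * ln n)\<close>, which is the term with \<open>C\<close>.
  The part of the mean from the excess \<open>p - q\<close> is quadratic in the distance \<open>sqrt (2 * r)\<close>; bounding one factor by
  \<open>\<epsilon> * sqrt n\<close> gives the first term. The part from \<open>q\<close> has a factor \<open>ln n / n\<close> and is absorbed by \<open>C\<close>.
\<close>

lemma tensor_power_perturbation:
  assumes "d \<ge> 2" "K \<ge> 2" "\<alpha> > \<beta>" "\<beta> > 0"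
  obtains C :: real where "C > 0"
    "\<forall>\<^sub>F n in sequentially. K dvd n \<longrightarrow> (\<forall>g\<in>balanced_labellings n K. \<forall>h\<in>balanced_labellings n K.
       \<forall>\<epsilon>. sqrt (2 * real (card (mismatches n g h))) \<le> \<epsilon> * sqrt n \<longrightarrow>
         measure_pmf.prob (hyperedge_law n d g (log_param \<alpha> d n) (log_param \<beta> d n))
           {x. frob_norm (tensor_power n d K (adjacency_tensor n d x) (label_mat n K h)
                  - tensor_power n d K (adjacency_tensor n d x) (label_mat n K g))
              \<le> (4 * real (d - 1) * real (n div K) ^ (d - 2) * \<epsilon> * real n / sqrt (real K)
                       * (log_param \<alpha> d n - log_param \<beta> d n)
                     + C * sqrt (ln (real n))) * sqrt (2 * real (card (mismatches n g h)))}
         \<ge> 1 - real n powr (- 10))"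
proof -
  define C2 where "C2 = 2 * \<alpha> + 12 * (3 * \<alpha> + 26)\<^sup>2"
  define C where "C = fact (d - 1) * (real d * sqrt (real K * C2 / 2) + \<beta>)"
  have \<alpha>: "\<alpha> > 0" using assms by simp
  have C2: "C2 > 0" using \<alpha> by (simp add: C2_def add_pos_nonneg)
  have C: "C > 0" using assms C2 by (simp add: C_def add_nonneg_pos)
  have "\<forall>\<^sub>F n in sequentially. 2 * real (d * K) \<le> (real n)\<^sup>2" by real_asymp
  moreover have "\<forall>\<^sub>F n in sequentially. 1 \<le> ln (real n)" by real_asymp
  moreover have "\<forall>\<^sub>F n in sequentially. ln (real n) \<le> n" by real_asymp
  ultimately have "\<forall>\<^sub>F n in sequentially. K dvd n \<longrightarrow> (\<forall>g\<in>balanced_labellings n K. \<forall>h\<in>balanced_labellings n K.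
       \<forall>\<epsilon>. sqrt (2 * real (card (mismatches n g h))) \<le> \<epsilon> * sqrt n \<longrightarrow>
         measure_pmf.prob (hyperedge_law n d g (log_param \<alpha> d n) (log_param \<beta> d n))
           {x. frob_norm (tensor_power n d K (adjacency_tensor n d x) (label_mat n K h)
                  - tensor_power n d K (adjacency_tensor n d x) (label_mat n K g))
              \<le> (4 * real (d - 1) * real (n div K) ^ (d - 2) * \<epsilon> * real n / sqrt (real K)
                       * (log_param \<alpha> d n - log_param \<beta> d n)
                     + C * sqrt (ln (real n))) * sqrt (2 * real (card (mismatches n g h)))}
         \<ge> 1 - real n powr (- 10))"
    using noise_tail_parameters[OF \<alpha> C2_def] eventually_ge_at_top[of 1]
      eventually_log_param[OF assms(1) less_imp_le[OF assms(4)] less_imp_le[OF assms(3)]]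
  proof eventually_elim
    case (elim n)
    note dK = elim(1) and L1 = elim(2) and Ln = elim(3) and params = elim(4) and n1 = elim(5) and lp = elim(6)
    show ?case
    proof (intro impI ballI allI)
      fix g h \<epsilon> assume dvd: "K dvd n" and g: "g \<in> balanced_labellings n K" and h: "h \<in> balanced_labellings n K"
        and \<epsilon>: "sqrt (2 * real (card (mismatches n g h))) \<le> \<epsilon> * sqrt n"
      define p q where "p = log_param \<alpha> d n" and "q = log_param \<beta> d n"
      define r where "r = real (card (mismatches n g h))"
      define L where "L = ln (real n)"
      define m where "m = n div K"
      define Q where "Q = hyperedge_law n d g p q"
      define b where "b = C2 * r * L"
      define Bd where "Bd = (4 * real (d - 1) * real m ^ (d - 2) * \<epsilon> * real n / sqrt (real K) * (p - q) + C * sqrt L) * sqrt (2 * r)"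
      define Good where "Good x \<longleftrightarrow> frob_norm (tensor_power n d K (adjacency_tensor n d x) (label_mat n K h)
                  - tensor_power n d K (adjacency_tensor n d x) (label_mat n K g)) \<le> Bd" for x
      define Bad where "Bad k s = {x. b \<le> (\<Sum>i<n. (noise n d g h p q x k s i)\<^sup>2)}" for k s
      have pq: "0 \<le> q" "q \<le> p" "p \<le> 1" using lp by (auto simp: p_def q_def)
      have r0: "r \<ge> 0" by (simp add: r_def)
      \<comment> \<open>The deterministic bound, valid as soon as none of the noise sums is large.\<close>
      have good: "Good x" if "\<And>k s. k < K \<Longrightarrow> s < d \<Longrightarrow> x \<notin> Bad k s" for x
      proof -
        have "frob_norm (tensor_power n d K (adjacency_tensor n d x) (label_mat n K h)
                  - tensor_power n d K (adjacency_tensor n d x) (label_mat n K g))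
          \<le> fact (d - 1) * real d * sqrt (real K * b)
            + q * fact (d - 1) * real n ^ (d - 2) * sqrt (2 * r)
            + (p - q) * (2 * real (d - 1) * real m ^ (d - 2)) * sqrt (real m) * r"
          unfolding r_def m_def
        proof (rule tensor_difference_bound[OF \<open>d \<ge> 2\<close> g h pq(1,2)])
          fix k s assume "k < K" "s < d"
          from that[OF this] show "(\<Sum>i<n. (noise n d g h p q x k s i)\<^sup>2) \<le> b" by (simp add: Bad_def)
        qed
        moreover have "fact (d - 1) * real d * sqrt (real K * b)
            = fact (d - 1) * real d * sqrt (real K * C2 / 2) * sqrt L * sqrt (2 * r)"
        proof -
          have "real K * b = (real K * C2 / 2) * L * (2 * r)" by (simp add: b_def)
          then show ?thesis by (simp only: real_sqrt_mult mult.assoc)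
        qed
        moreover have "q * fact (d - 1) * real n ^ (d - 2) * sqrt (2 * r)
            \<le> fact (d - 1) * \<beta> * sqrt L * sqrt (2 * r)"
        proof (rule mult_right_mono)
          have "d - 1 = Suc (d - 2)" using \<open>d \<ge> 2\<close> by simp
          then have "q * real n ^ (d - 2) = \<beta> * (L / n)"
            using n1 by (simp add: q_def log_param_def L_def)
          also have "L / n \<le> sqrt L"
          proof -
            have "L / n \<le> 1" using Ln n1 by (simp add: L_def)
            also have "1 \<le> sqrt L" using L1 by (simp add: L_def)
            finally show ?thesis .
          qed
          finally have "q * real n ^ (d - 2) \<le> \<beta> * sqrt L" using assms(4) by (simp add: mult_left_mono)
          then have "fact (d - 1) * (q * real n ^ (d - 2)) \<le> fact (d - 1) * (\<beta> * sqrt L)"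
            by (rule mult_left_mono) simp
          then show "q * fact (d - 1) * real n ^ (d - 2) \<le> fact (d - 1) * \<beta> * sqrt L" by (simp add: mult_ac)
        qed (use r0 in simp)
        moreover have "(p - q) * (2 * real (d - 1) * real m ^ (d - 2)) * sqrt (real m) * r
            \<le> 4 * real (d - 1) * real m ^ (d - 2) * \<epsilon> * real n / sqrt (real K) * (p - q) * sqrt (2 * r)"
        proof -
          have le_four_times: "y \<le> 4 * y" if "0 \<le> y" for y :: real using that by simp
          let ?w = "(p - q) * (real (d - 1) * real m ^ (d - 2)) * sqrt (2 * r)"
          have w0: "?w \<ge> 0" using pq r0 by simp
          have "real n = real K * real m"
            using dvd_mult_div_cancel[OF dvd] unfolding m_def of_nat_mult[symmetric] by simp
          then have "sqrt (real m) = sqrt n / sqrt K"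
            using \<open>K \<ge> 2\<close> by (simp add: real_sqrt_mult)
          then have "sqrt (real m) * sqrt (2 * r) \<le> sqrt n / sqrt K * (\<epsilon> * sqrt n)"
            using \<epsilon> by (simp only: r_def) (intro mult_left_mono, auto)
          also have "\<dots> = \<epsilon> * n / sqrt K" by simp
          finally have le: "sqrt (real m) * sqrt (2 * r) \<le> \<epsilon> * n / sqrt K" .
          have "x * (2 * y * z) * u * r = (x * (y * z) * t) * (u * t)" if "t * t = 2 * r" for x y z u t
          proof -
            have "x * (2 * y * z) * u * r = x * (y * z) * u * (2 * r)" by (simp only: mult_ac)
            also have "\<dots> = x * (y * z) * u * (t * t)" unfolding that ..
            also have "\<dots> = (x * (y * z) * t) * (u * t)" by (simp only: mult_ac)
            finally show ?thesis .
          qed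
          from this[of "sqrt (2 * r)"]
          have "(p - q) * (2 * real (d - 1) * real m ^ (d - 2)) * sqrt (real m) * r
              = ?w * (sqrt (real m) * sqrt (2 * r))" by (simp add: r_def)
          also have "\<dots> \<le> ?w * (\<epsilon> * n / sqrt K)" by (rule mult_left_mono[OF le w0])
          also have "\<dots> \<le> 4 * (?w * (\<epsilon> * n / sqrt K))"
          proof -
            have "0 \<le> sqrt (real m) * sqrt (2 * r)" using r0 by simp
            from mult_nonneg_nonneg[OF w0 order_trans[OF this le]]
            show ?thesis by (rule le_four_times)
          qed
          finally show ?thesis by (simp add: mult_ac)
        qed
        moreover have "Bd = 4 * real (d - 1) * real m ^ (d - 2) * \<epsilon> * real n / sqrt (real K) * (p - q) * sqrt (2 * r)
            + (fact (d - 1) * real d * sqrt (real K * C2 / 2) * sqrt L * sqrt (2 * r)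
            + fact (d - 1) * \<beta> * sqrt L * sqrt (2 * r))"
          by (simp only: Bd_def C_def distrib_left distrib_right mult.assoc)
        ultimately show ?thesis unfolding Good_def by linarith
      qed
      have "measure_pmf.prob Q {x. \<not> Good x} \<le> real n powr (- 10)"
      proof (cases "r = 0")
        case True
        \<comment> \<open>Without errors the two matrices agree and both sides vanish; the tail bound needs at least one.\<close>
        have "mismatches n g h = {}" using True by (simp add: r_def)
        then have "label_mat n K h = label_mat n K g" by (intro label_mat_cong) (auto simp: mismatches_def)
        then have "Good x" for x
          using True by (simp add: Good_def Bd_def frob_norm_def tensor_power_def)
        then show ?thesis by simp
      next
        case False
        have "card (mismatches n g h) \<le> n"
          using card_mono[OF finite_lessThan mismatches_subset[of n g h]] by simp
        with False have "card (mismatches n g h) \<in> {1..n}" by (simp add: r_def Suc_le_eq card_gt_0_iff)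
        with params obtain s l where s: "s \<ge> 0" and l: "l > 0"
          and e1: "real n * exp (\<alpha> * r * L / n * (exp s - 1) - s * l) \<le> exp (- 12 * L)"
          and e2: "exp ((2 * real n * (\<alpha> * r * L / n) - C2 * r * L) / (l + \<alpha> * r * L / n)\<^sup>2) \<le> exp (- 12 * L)"
          unfolding L_def r_def by blast
        have bad: "measure_pmf.prob Q (Bad k t) \<le> 2 * exp (- 12 * L)" for k t
        proof -
          have "measure_pmf.prob Q (Bad k t)
              \<le> real n * exp (\<alpha> * r * L / n * (exp s - 1) - s * l)
                + exp ((2 * real n * (\<alpha> * r * L / n) - b) / (l + \<alpha> * r * L / n)\<^sup>2)"
            unfolding Q_def Bad_def p_def q_def r_def L_def
            by (rule noise_tail[OF \<open>d \<ge> 2\<close> _ pq[unfolded p_def q_def] s l]) (use n1 in simp)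
          also have "\<dots> \<le> exp (- 12 * L) + exp (- 12 * L)" unfolding b_def by (rule add_mono[OF e1 e2])
          finally show ?thesis by (simp only: mult_2)
        qed
        have "{x. \<not> Good x} \<subseteq> (\<Union>k\<in>{..<K}. \<Union>s\<in>{..<d}. Bad k s)"
        proof
          fix x assume "x \<in> {x. \<not> Good x}"
          have "\<exists>k<K. \<exists>s<d. x \<in> Bad k s"
          proof (rule ccontr)
            assume neg: "\<not> (\<exists>k<K. \<exists>s<d. x \<in> Bad k s)"
            have "Good x" by (rule good) (use neg in blast)
            then show False using \<open>x \<in> {x. \<not> Good x}\<close> by simp
          qed
          then show "x \<in> (\<Union>k\<in>{..<K}. \<Union>s\<in>{..<d}. Bad k s)" by (simp add: Bex_def)
        qed
        then have "measure_pmf.prob Q {x. \<not> Good x} \<le> measure_pmf.prob Q (\<Union>k\<in>{..<K}. \<Union>s\<in>{..<d}. Bad k s)"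
          by (intro measure_pmf.finite_measure_mono) auto
        also have "\<dots> \<le> (\<Sum>k\<in>{..<K}. measure_pmf.prob Q (\<Union>s\<in>{..<d}. Bad k s))"
          by (intro measure_pmf.finite_measure_subadditive_finite) auto
        also have "\<dots> \<le> (\<Sum>k\<in>{..<K}. \<Sum>s\<in>{..<d}. measure_pmf.prob Q (Bad k s))"
          by (intro sum_mono measure_pmf.finite_measure_subadditive_finite) auto
        also have "\<dots> \<le> (\<Sum>k\<in>{..<K}. \<Sum>s\<in>{..<d}. 2 * exp (- 12 * L))" by (intro sum_mono bad)
        also have "\<dots> = 2 * real (d * K) * exp (- 12 * L)" by simp
        also have "\<dots> \<le> (real n)\<^sup>2 * exp (- 12 * L)" using dK by (intro mult_right_mono) auto
        also have "\<dots> = real n powr 2 * real n powr (- 12)"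
          using n1 by (simp add: powr_def L_def flip: powr_numeral)
        also have "\<dots> = real n powr (2 + - 12)" by (rule powr_add[symmetric])
        also have "\<dots> = real n powr (- 10)" by simp
        finally show ?thesis .
      qed
      then have "measure_pmf.prob Q {x. Good x} \<ge> 1 - real n powr (- 10)" by (rule prob_compl_ge)
      then show "measure_pmf.prob (hyperedge_law n d g (log_param \<alpha> d n) (log_param \<beta> d n))
           {x. frob_norm (tensor_power n d K (adjacency_tensor n d x) (label_mat n K h)
                  - tensor_power n d K (adjacency_tensor n d x) (label_mat n K g))
              \<le> (4 * real (d - 1) * real (n div K) ^ (d - 2) * \<epsilon> * real n / sqrt (real K)
                       * (log_param \<alpha> d n - log_param \<beta> d n)
                     + C * sqrt (ln (real n))) * sqrt (2 * real (card (mismatches n g h)))}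
         \<ge> 1 - real n powr (- 10)"
        unfolding Good_def Bd_def Q_def p_def q_def r_def L_def m_def .
    qed
  qed
  with C show thesis by (rule that)
qed

section \<open>Exact recovery\<close>

lemma has_gap_permute:
  assumes \<sigma>: "\<sigma> permutes {..<K}" and "has_gap n d K x g \<Delta>"
  shows "has_gap n d K x (\<sigma> \<circ> g) \<Delta>"
proof -
  have com: "community n (\<sigma> \<circ> g) (\<sigma> k) = community n g k" for k
    using permutes_inj[OF \<sigma>] by (auto simp: community_def inj_eq)
  show ?thesis
    unfolding has_gap_def
  proof (intro allI impI)
    fix i l assume i: "i < n" and l: "l < K" "l \<noteq> (\<sigma> \<circ> g) i"
    obtain l' where l': "l' < K" "l = \<sigma> l'"
      using l(1) permutes_image[OF \<sigma>] by (metis imageE lessThan_iff)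
    then have "l' \<noteq> g i" using l(2) by auto
    then have "\<Delta> \<le> fact (d - 1) * ((\<Sum>e\<in>stars n d i (community n g (g i)). of_bool (x e))
        - (\<Sum>e\<in>stars n d i (community n g l'). of_bool (x e)))"
      using assms(2) i l'(1) unfolding has_gap_def by blast
    then show "\<Delta> \<le> fact (d - 1) * ((\<Sum>e\<in>stars n d i (community n (\<sigma> \<circ> g) ((\<sigma> \<circ> g) i)). of_bool (x e))
        - (\<Sum>e\<in>stars n d i (community n (\<sigma> \<circ> g) l). of_bool (x e)))"
      unfolding l'(2) comp_apply[of \<sigma> g i] com .
  qed
qed

lemma gap_bound_of_has_gap:
  assumes "d \<ge> 1" and hs: "hs \<in> balanced_labellings n K" and "\<gamma> \<le> \<Gamma>" "n \<ge> 1"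
    and "measure_pmf.prob (hyperedge_law n d hs (log_param \<alpha> d n) (log_param \<beta> d n))
         {x. \<not> has_gap n d K x hs (\<Gamma> * ln (real n))} \<le> real n powr (- c)"
  shows "gap_bound d K \<alpha> \<beta> \<gamma> c n (label_mat n K hs)"
proof -
  have lab: "hs \<in> labellings n K" using hs by (simp add: balanced_labellings_def)
  define Gap where "Gap A \<longleftrightarrow> (let B = tensor_power n d K A (label_mat n K hs) in
           \<forall>k<K. \<forall>l<K. k \<noteq> l \<longrightarrow>
             (\<forall>i<n. label_mat n K hs $$ (i, k) = 1 \<longrightarrow> B $$ (i, k) - B $$ (i, l) \<ge> \<gamma> * ln (real n)))" for A
  have "Gap (adjacency_tensor n d x)" if "has_gap n d K x hs (\<Gamma> * ln (real n))" for x
    unfolding Gap_def Let_def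
  proof (intro allI impI)
    fix k l i assume k: "k < K" "l < K" "k \<noteq> l" and i: "i < n" and "label_mat n K hs $$ (i, k) = 1"
    then have hi: "hs i = k" by simp
    have "\<gamma> * ln (real n) \<le> \<Gamma> * ln (real n)" using assms(3,4) by (intro mult_right_mono) auto
    also have "\<dots> \<le> fact (d - 1) * ((\<Sum>e\<in>stars n d i (community n hs (hs i)). of_bool (x e))
        - (\<Sum>e\<in>stars n d i (community n hs l). of_bool (x e)))"
      using that i k hi unfolding has_gap_def by blast
    also have "\<dots> = tensor_power n d K (adjacency_tensor n d x) (label_mat n K hs) $$ (i, k)
        - tensor_power n d K (adjacency_tensor n d x) (label_mat n K hs) $$ (i, l)"
      using tensor_power_label_mat[OF i k(1) assms(1), of x hs] tensor_power_label_mat[OF i k(2) assms(1), of x hs]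
      by (simp only: community_def hi right_diff_distrib)
    finally show "\<gamma> * ln (real n) \<le> tensor_power n d K (adjacency_tensor n d x) (label_mat n K hs) $$ (i, k)
        - tensor_power n d K (adjacency_tensor n d x) (label_mat n K hs) $$ (i, l)" .
  qed
  then have "measure_pmf.prob (hyperedge_law n d hs (log_param \<alpha> d n) (log_param \<beta> d n))
        {x. \<not> Gap (adjacency_tensor n d x)}
     \<le> measure_pmf.prob (hyperedge_law n d hs (log_param \<alpha> d n) (log_param \<beta> d n))
         {x. \<not> has_gap n d K x hs (\<Gamma> * ln (real n))}"
    by (intro measure_pmf.finite_measure_mono) auto
  also note assms(5)
  finally have "1 - real n powr (- c) \<le> measure_pmf.prob (hyperedge_law n d hs (log_param \<alpha> d n) (log_param \<beta> d n))
        {x. Gap (adjacency_tensor n d x)}" by (rule prob_compl_ge)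
  then show ?thesis
    unfolding gap_bound_def hsbm_log_def Gap_def[symmetric] prob_hsbm_label_mat[OF lab] .
qed

lemma property_M_exists:
  assumes "d \<ge> 2" "K \<ge> 2" "\<alpha> > \<beta>" "\<beta> > 0"
  obtains C0 :: real where "C0 > 0" "\<And>C. C \<ge> C0 \<Longrightarrow> property_M d K \<alpha> \<beta> C"
proof -
  obtain C0 :: real where C0: "C0 > 0"
    and ev: "\<forall>\<^sub>F n in sequentially. K dvd n \<longrightarrow> (\<forall>g\<in>balanced_labellings n K. \<forall>h\<in>balanced_labellings n K.
       \<forall>\<epsilon>. sqrt (2 * real (card (mismatches n g h))) \<le> \<epsilon> * sqrt n \<longrightarrow>
         measure_pmf.prob (hyperedge_law n d g (log_param \<alpha> d n) (log_param \<beta> d n))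
           {x. frob_norm (tensor_power n d K (adjacency_tensor n d x) (label_mat n K h)
                  - tensor_power n d K (adjacency_tensor n d x) (label_mat n K g))
              \<le> (4 * real (d - 1) * real (n div K) ^ (d - 2) * \<epsilon> * real n / sqrt (real K)
                       * (log_param \<alpha> d n - log_param \<beta> d n)
                     + C0 * sqrt (ln (real n))) * sqrt (2 * real (card (mismatches n g h)))}
         \<ge> 1 - real n powr (- 10))"
    using tensor_power_perturbation[OF assms] by blast
  have "property_M d K \<alpha> \<beta> C" if C: "C \<ge> C0" for C
    unfolding property_M_def using ev eventually_ge_at_top[of 1]
  proof eventually_elim
    case (elim n)
    show ?case
    proof (intro impI ballI)
      fix Hs \<epsilon> H Q
      assume dvd: "K dvd n" and Hs: "Hs \<in> balanced_assignments n K" and H: "H \<in> balanced_assignments n K"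
        and Q: "Q \<in> perm_mats K" and near: "frob_norm (H - Hs * Q) \<le> \<epsilon> * sqrt (real n)"
      obtain hs where hs: "hs \<in> balanced_labellings n K" "Hs = label_mat n K hs"
        using balanced_assignments_label[OF Hs] by blast
      obtain h where h: "h \<in> balanced_labellings n K" "H = label_mat n K h"
        using balanced_assignments_label[OF H] by blast
      obtain \<sigma> where \<sigma>: "\<sigma> permutes {..<K}" and
        mult: "\<And>n h. h \<in> labellings n K \<Longrightarrow> label_mat n K h * Q = label_mat n K (\<sigma> \<circ> h)"
        using perm_mats_cases[OF Q] by blast
      have lab: "hs \<in> labellings n K" "h \<in> labellings n K" using hs(1) h(1) by (auto simp: balanced_labellings_def)
      define g where "g = \<sigma> \<circ> hs"
      have HsQ: "Hs * Q = label_mat n K g" using mult[OF lab(1)] by (simp add: hs(2) g_def)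
      have g: "g \<in> balanced_labellings n K" unfolding g_def by (rule balanced_labellings_permute[OF hs(1) \<sigma>])
      then have labg: "g \<in> labellings n K" by (simp add: balanced_labellings_def)
      have dist: "frob_norm (H - Hs * Q) = sqrt (2 * real (card (mismatches n g h)))"
        using frob_norm_label_diff[OF labg lab(2)] by (simp add: HsQ h(2))
      define R where "R c = (4 * real (d - 1) * real (n div K) ^ (d - 2) * \<epsilon> * real n / sqrt (real K)
                       * (log_param \<alpha> d n - log_param \<beta> d n)
                     + c * sqrt (ln (real n))) * frob_norm (H - Hs * Q)" for c
      have R: "R C0 \<le> R C"
        unfolding R_def using C elim(2) by (intro mult_right_mono add_left_mono) (auto simp: dist)
      have "1 - real n powr (- 10) \<le> measure_pmf.prob (hyperedge_law n d g (log_param \<alpha> d n) (log_param \<beta> d n))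
           {x. frob_norm (tensor_power n d K (adjacency_tensor n d x) H
                  - tensor_power n d K (adjacency_tensor n d x) (Hs * Q)) \<le> R C0}"
        using elim(1)[rule_format, OF dvd g h(1) near[unfolded dist]]
        unfolding R_def dist unfolding HsQ h(2) .
      also have "\<dots> \<le> measure_pmf.prob (hyperedge_law n d g (log_param \<alpha> d n) (log_param \<beta> d n))
           {x. frob_norm (tensor_power n d K (adjacency_tensor n d x) H
                  - tensor_power n d K (adjacency_tensor n d x) (Hs * Q)) \<le> R C}"
        using R by (intro measure_pmf.finite_measure_mono) auto
      also have "hyperedge_law n d g (log_param \<alpha> d n) (log_param \<beta> d n)
          = hyperedge_law n d hs (log_param \<alpha> d n) (log_param \<beta> d n)"
        unfolding g_def by (rule hyperedge_law_permute[OF \<sigma>])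
      also have "measure_pmf.prob (hyperedge_law n d hs (log_param \<alpha> d n) (log_param \<beta> d n))
           {x. frob_norm (tensor_power n d K (adjacency_tensor n d x) H
                  - tensor_power n d K (adjacency_tensor n d x) (Hs * Q)) \<le> R C}
        = measure_pmf.prob (hsbm_log n d \<alpha> \<beta> Hs)
             {A. frob_norm (tensor_power n d K A H - tensor_power n d K A (Hs * Q)) \<le> R C}"
        unfolding hsbm_log_def hs(2) by (rule prob_hsbm_label_mat[OF lab(1), symmetric])
      finally show "1 - real n powr (- 10) \<le> measure_pmf.prob (hsbm_log n d \<alpha> \<beta> Hs)
             {A. frob_norm (tensor_power n d K A H - tensor_power n d K A (Hs * Q))
                 \<le> (4 * real (d - 1) * real (n div K) ^ (d - 2) * \<epsilon> * real n / sqrt (real K)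
                       * (log_param \<alpha> d n - log_param \<beta> d n)
                     + C * sqrt (ln (real n)))
                   * frob_norm (H - Hs * Q)}" unfolding R_def .
    qed
  qed
  with C0 show thesis by (rule that)
qed

lemma perm_mats_finite_nonempty: "finite (perm_mats K)" "perm_mats K \<noteq> {}"
proof -
  have eq: "perm_mats K = (\<lambda>\<pi>. mat K K (\<lambda>(i, j). if i = \<pi> j then 1 else 0)) ` {\<pi>. \<pi> permutes {..<K}}"
    by (auto simp: perm_mats_def)
  show "finite (perm_mats K)" unfolding eq by (intro finite_imageI finite_permutations) simp
  show "perm_mats K \<noteq> {}" unfolding eq using permutes_id by blast
qed

lemma contraction_exponent:
  assumes "n > 0" "1 < ln (real n)" and N: "2 * ln n / ln (ln n) \<le> real N"
  shows "(1 / sqrt (ln n)) ^ N \<le> 1 / real n"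
proof -
  have lL: "ln (ln n) > 0" using assms(2) by simp
  have "(1 / sqrt (ln n)) ^ N = exp (- (real N * (ln (ln n) / 2)))"
  proof -
    have "1 / sqrt (ln n) = exp (- (ln (ln n) / 2))"
    proof -
      have "exp (ln (ln n) / 2) = exp (ln (sqrt (ln n)))" using assms(2) by (simp only: ln_sqrt)
      also have "\<dots> = sqrt (ln n)" using assms(2) by simp
      finally show ?thesis by (simp only: exp_minus inverse_eq_divide)
    qed
    then show ?thesis by (simp only: exp_of_nat_mult[symmetric] mult_minus_right)
  qed
  also have "\<dots> \<le> exp (- ln n)"
  proof -
    have "2 * ln n \<le> real N * ln (ln n)" using N lL by (simp add: divide_simps)
    then show ?thesis by simp
  qed
  also have "\<dots> = 1 / real n" using assms(1) by (simp add: exp_minus divide_inverse)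
  finally show ?thesis .
qed

lemma ptpm_output_near_truth:
  assumes "d \<ge> 1" and hs: "hs \<in> balanced_labellings n K"
    and gap: "has_gap n d K x hs (2 * fact (d - 1) * \<tau>)" and "\<tau> > 0"
    and sc: "scattered n d x \<tau> \<kappa> \<rho>" and \<rho>: "0 \<le> \<rho>" "\<rho> \<le> 1"
    and \<theta>: "0 \<le> \<theta>" "\<theta>\<^sup>2 \<le> \<kappa>" and N: "\<rho> ^ N * (\<kappa> * real n) < 1"
    and H0: "H0 \<in> assignment_mats n K"
    and near: "Min ((\<lambda>Q. frob_norm (H0 - label_mat n K hs * Q)) ` perm_mats K) \<le> \<theta> * sqrt (real n)"
    and out: "ptpm_output n d K (adjacency_tensor n d x) N H0 X"
  shows "\<exists>Q\<in>perm_mats K. X = label_mat n K hs * Q"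
proof -
  obtain h0 where h0: "h0 \<in> labellings n K" "H0 = label_mat n K h0"
    using assignment_mats_label[OF H0] by blast
  have "Min ((\<lambda>Q. frob_norm (H0 - label_mat n K hs * Q)) ` perm_mats K)
      \<in> (\<lambda>Q. frob_norm (H0 - label_mat n K hs * Q)) ` perm_mats K"
    using perm_mats_finite_nonempty by (intro Min_in) auto
  then obtain Q where Q: "Q \<in> perm_mats K"
    and le: "frob_norm (H0 - label_mat n K hs * Q) \<le> \<theta> * sqrt (real n)"
    using near by auto
  obtain \<sigma> where \<sigma>: "\<sigma> permutes {..<K}"
    and mult: "\<And>n h. h \<in> labellings n K \<Longrightarrow> label_mat n K h * Q = label_mat n K (\<sigma> \<circ> h)"
    using perm_mats_cases[OF Q] by blast
  define g where "g = \<sigma> \<circ> hs"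
  have g: "g \<in> balanced_labellings n K" unfolding g_def by (rule balanced_labellings_permute[OF hs \<sigma>])
  have HsQ: "label_mat n K hs * Q = label_mat n K g"
    using mult hs by (simp add: g_def balanced_labellings_def)
  have labg: "g \<in> labellings n K" using g by (simp add: balanced_labellings_def)
  have "sqrt (2 * real (card (mismatches n g h0))) \<le> \<theta> * sqrt (real n)"
    using le frob_norm_label_diff[OF labg h0(1)] by (simp add: HsQ h0(2))
  then have "2 * real (card (mismatches n g h0)) \<le> (\<theta> * sqrt (real n))\<^sup>2"
    by (rule sqrt_le_D)
  also have "\<dots> \<le> \<kappa> * real n"
    using \<theta>(2) by (simp add: power_mult_distrib mult_right_mono)
  finally have init: "2 * real (card (mismatches n g h0)) \<le> \<kappa> * real n" .
  have "X = label_mat n K g"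
    using ptpm_output_exact[OF \<open>d \<ge> 1\<close> g h0(1) has_gap_permute[OF \<sigma> gap, folded g_def] \<open>\<tau> > 0\<close> sc \<rho> init N]
      out unfolding h0(2) .
  then show ?thesis using Q HsQ by (intro bexI[of _ Q]) simp_all
qed

theorem theorem4p9:
  fixes d K :: nat and \<alpha> \<beta> :: real
  assumes "d \<ge> 2" and "K \<ge> 2"
    and "\<alpha> > \<beta>" and "\<beta> > 0"
    and "(sqrt \<alpha> - sqrt \<beta>)\<^sup>2 / (real K ^ (d - 1) * fact (d - 1)) > 1"
  shows "\<exists>\<gamma>>0. \<exists>C>0. property_G d K \<alpha> \<beta> \<gamma> \<and> property_M d K \<alpha> \<beta> C \<and>
    (let \<phi> = phi_const d K \<alpha> \<beta> C; \<theta> = theta_const d K \<alpha> \<beta> \<gamma> in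
     \<forall>c>0. \<exists>c'>0. \<forall>n. \<forall>Hs\<in>balanced_assignments n K.
       K dvd n \<longrightarrow>
       real n > exp (Max {64 * C\<^sup>2 / \<gamma>\<^sup>2, \<gamma>\<^sup>2 / C\<^sup>2, \<phi>\<^sup>2 / \<theta>\<^sup>2, 2 * \<phi>\<^sup>2, 256 * C ^ 4 / \<gamma> ^ 4}) \<longrightarrow>
       gap_bound d K \<alpha> \<beta> \<gamma> c n Hs \<longrightarrow>
       measure_pmf.prob (hsbm_log n d \<alpha> \<beta> Hs)
         {A. \<forall>H0\<in>assignment_mats n K.
               Min ((\<lambda>Q. frob_norm (H0 - Hs * Q)) ` perm_mats K) \<le> \<theta> * sqrt (real n) \<longrightarrow>
               (\<exists>N\<ge>1. int N \<le> \<lceil>2 * ln (ln (real n))\<rceil> + \<lceil>2 * ln (real n) / ln (ln (real n))\<rceil> + 2 \<and>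
                  (\<forall>X. ptpm_output n d K A N H0 X \<longrightarrow> (\<exists>Q\<in>perm_mats K. X = Hs * Q)))}
       \<ge> 1 - real n powr (- c'))"
proof -
  obtain \<Gamma> c0 :: real where \<Gamma>: "\<Gamma> > 0" and c0: "c0 > 0"
    and evG: "\<forall>\<^sub>F n in sequentially. K dvd n \<longrightarrow> (\<forall>h\<in>balanced_labellings n K.
       measure_pmf.prob (hyperedge_law n d h (log_param \<alpha> d n) (log_param \<beta> d n))
         {x. \<not> has_gap n d K x h (\<Gamma> * ln (real n))} \<le> real n powr (- c0))"
    using prob_no_gap_le[OF assms] by blast
  obtain C0 :: real where C0: "C0 > 0" and M: "\<And>C. C \<ge> C0 \<Longrightarrow> property_M d K \<alpha> \<beta> C"
    using property_M_exists[OF assms(1-4)] by blast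
  \<comment> \<open>The gap \<open>\<Gamma> * ln n\<close> is then the \<open>2 * fact (d - 1)\<close>-fold of \<open>\<tau> * ln n\<close>, as the contraction requires.\<close>
  define \<tau> where "\<tau> = \<Gamma> / (2 * fact (d - 1))"
  define \<kappa> where "\<kappa> = exp (- (1 + 2 * real d * (\<alpha> + 5) / \<tau>))"
  define Y where "Y = real K powr (real d - 3 / 2) / (16 * real (d - 1) * (\<alpha> - \<beta>))"
  \<comment> \<open>The second bound makes \<open>\<theta> \<le> \<kappa>\<close>, since \<open>4 * \<theta> \<le> \<gamma> * Y\<close>.\<close>
  define \<gamma> where "\<gamma> = min \<Gamma> (4 * \<kappa> / Y)"
  define \<theta> where "\<theta> = theta_const d K \<alpha> \<beta> \<gamma>"
  \<comment> \<open>Half of the smaller exponent absorbs the factor \<open>2\<close> from adding the two error probabilities.\<close>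
  define c' where "c' = min c0 1 / 2"
  have \<alpha>: "\<alpha> > 0" using assms by simp
  have \<tau>: "\<tau> > 0" using \<Gamma> by (simp add: \<tau>_def)
  have "0 \<le> 2 * real d * (\<alpha> + 5) / \<tau>" using \<tau> \<alpha> by simp
  then have "0 < 1 + 2 * real d * (\<alpha> + 5) / \<tau>" by linarith
  then have \<kappa>: "\<kappa> > 0" "\<kappa> < 1" unfolding \<kappa>_def by simp_all
  have Y: "Y > 0" using assms by (simp add: Y_def)
  have \<gamma>: "\<gamma> > 0" using \<Gamma> \<kappa> Y by (simp add: \<gamma>_def)
  have c': "c' > 0" using c0 by (simp add: c'_def)
  have \<theta>_eq: "\<theta> = 1 / 4 * min (1 / sqrt (real (K * (d - 1)))) (\<gamma> * Y)"
    by (simp add: \<theta>_def theta_const_def Y_def)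
  have \<theta>0: "\<theta> \<ge> 0" unfolding \<theta>_eq using \<gamma> Y by simp
  have "\<gamma> * Y \<le> 4 * \<kappa> / Y * Y" using Y by (intro mult_right_mono) (auto simp: \<gamma>_def)
  then have "\<theta> \<le> \<kappa>" unfolding \<theta>_eq using Y by simp
  then have "\<theta>\<^sup>2 \<le> \<kappa> * 1" unfolding power2_eq_square using \<theta>0 \<kappa> by (intro mult_mono) auto
  then have \<theta>2: "\<theta>\<^sup>2 \<le> \<kappa>" by simp
  define Large where "Large n \<longleftrightarrow> 4 * real d / \<tau> \<le> sqrt (ln (real n)) \<and> 1 < ln (real n) \<and>
      real n powr (- c0) + 1 / real n \<le> real n powr (- c') \<and> 4 \<le> n \<and>
      (0 \<le> log_param \<beta> d n \<and> log_param \<beta> d n \<le> log_param \<alpha> d n \<and> log_param \<alpha> d n \<le> 1) \<and>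
      (K dvd n \<longrightarrow> (\<forall>h\<in>balanced_labellings n K.
       measure_pmf.prob (hyperedge_law n d h (log_param \<alpha> d n) (log_param \<beta> d n))
         {x. \<not> has_gap n d K x h (\<Gamma> * ln (real n))} \<le> real n powr (- c0)))" for n
  have e1: "\<forall>\<^sub>F n in sequentially. 4 * real d / \<tau> \<le> sqrt (ln (real n))" by real_asymp
  have e2: "\<forall>\<^sub>F n in sequentially. 1 < ln (real n)" by real_asymp
  have e3: "\<forall>\<^sub>F n in sequentially. real n powr (- c0) + 1 / real n \<le> real n powr (- c')"
  proof -
    have "\<forall>\<^sub>F n in sequentially. 2 \<le> real n powr c'" using c' by real_asymp
    then show ?thesis
      using eventually_ge_at_top[of 1]
    proof eventually_elim
      case (elim n)
      have "real n powr (- c0) \<le> real n powr (- c' - c')"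
        using elim(2) by (intro powr_mono) (auto simp: c'_def)
      moreover have "1 / real n \<le> real n powr (- c' - c')"
      proof -
        have "1 / real n = real n powr (- 1)" using elim(2) by (simp add: powr_minus divide_inverse)
        also have "\<dots> \<le> real n powr (- c' - c')" using elim(2) by (intro powr_mono) (auto simp: c'_def)
        finally show ?thesis .
      qed
      moreover have "real n powr (- c' - c') = real n powr (- c') / real n powr c'" by (rule powr_diff)
      moreover have "real n powr (- c') / real n powr c' \<le> real n powr (- c') / 2"
        using elim by (intro divide_left_mono) auto
      ultimately show ?case by linarith
    qed
  qed
  have "eventually Large sequentially"
    unfolding Large_def
    by (rule eventually_conj[OF e1 eventually_conj[OF e2 eventually_conj[OF e3 eventually_conj[OF eventually_ge_at_top
         eventually_conj[OF eventually_log_param[OF assms(1) less_imp_le[OF assms(4)] less_imp_le[OF assms(3)]] evG]]]]])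
  then obtain n0 where n0: "\<And>n. n \<ge> n0 \<Longrightarrow> Large n"
    unfolding eventually_sequentially by auto
  \<comment> \<open>Then \<open>C / \<gamma> > n0\<close>, so that the lower bound \<open>exp (64 * C\<^sup>2 / \<gamma>\<^sup>2)\<close> for \<open>n\<close> exceeds \<open>n0\<close>.\<close>
  define C where "C = C0 + \<gamma> * (1 + real n0)"
  have C: "C > 0" "C \<ge> C0" using C0 \<gamma> by (auto simp: C_def add_pos_nonneg)
  have G: "property_G d K \<alpha> \<beta> \<gamma>"
    unfolding property_G_def
  proof (intro exI[of _ c0] conjI c0)
    show "\<forall>\<^sub>F n in sequentially. K dvd n \<longrightarrow> (\<forall>Hs\<in>balanced_assignments n K. gap_bound d K \<alpha> \<beta> \<gamma> c0 n Hs)"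
      using evG eventually_ge_at_top[of 1]
    proof eventually_elim
      case (elim n)
      show ?case
      proof (intro impI ballI)
        fix Hs assume dvd: "K dvd n" and "Hs \<in> balanced_assignments n K"
        then obtain hs where hs: "hs \<in> balanced_labellings n K" "Hs = label_mat n K hs"
          using balanced_assignments_label by blast
        show "gap_bound d K \<alpha> \<beta> \<gamma> c0 n Hs"
          unfolding hs(2)
          by (rule gap_bound_of_has_gap[OF _ hs(1) _ elim(2) elim(1)[rule_format, OF dvd hs(1)]])
             (use assms(1) in \<open>auto simp: \<gamma>_def\<close>)
      qed
    qed
  qed
  have large: "n \<ge> n0"
    if "real n > exp (Max {64 * C\<^sup>2 / \<gamma>\<^sup>2, \<gamma>\<^sup>2 / C\<^sup>2, u, v, w})" for n and u v w :: real
  proof -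
    have "1 + real n0 \<le> C / \<gamma>" using C0 \<gamma> by (simp add: C_def divide_simps)
    then have "(1 + real n0)\<^sup>2 \<le> (C / \<gamma>)\<^sup>2" by (intro power_mono) auto
    moreover have "real n0 \<le> (1 + real n0)\<^sup>2" by (simp add: power2_eq_square algebra_simps)
    moreover have "(C / \<gamma>)\<^sup>2 \<le> 64 * C\<^sup>2 / \<gamma>\<^sup>2" by (simp add: power_divide divide_right_mono)
    moreover have "64 * C\<^sup>2 / \<gamma>\<^sup>2 \<le> Max {64 * C\<^sup>2 / \<gamma>\<^sup>2, \<gamma>\<^sup>2 / C\<^sup>2, u, v, w}" by (intro Max_ge) auto
    ultimately have "real n0 \<le> Max {64 * C\<^sup>2 / \<gamma>\<^sup>2, \<gamma>\<^sup>2 / C\<^sup>2, u, v, w}" by linarith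
    then have "real n0 \<le> exp (Max {64 * C\<^sup>2 / \<gamma>\<^sup>2, \<gamma>\<^sup>2 / C\<^sup>2, u, v, w})"
      using exp_ge_add_one_self[of "Max {64 * C\<^sup>2 / \<gamma>\<^sup>2, \<gamma>\<^sup>2 / C\<^sup>2, u, v, w}"] by linarith
    with that show ?thesis by linarith
  qed
  have main: "measure_pmf.prob (hsbm_log n d \<alpha> \<beta> Hs)
         {A. \<forall>H0\<in>assignment_mats n K.
               Min ((\<lambda>Q. frob_norm (H0 - Hs * Q)) ` perm_mats K) \<le> \<theta> * sqrt (real n) \<longrightarrow>
               (\<exists>N\<ge>1. int N \<le> \<lceil>2 * ln (ln (real n))\<rceil> + \<lceil>2 * ln (real n) / ln (ln (real n))\<rceil> + 2 \<and>
                  (\<forall>X. ptpm_output n d K A N H0 X \<longrightarrow> (\<exists>Q\<in>perm_mats K. X = Hs * Q)))}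
       \<ge> 1 - real n powr (- c')"
    if Hs: "Hs \<in> balanced_assignments n K" and dvd: "K dvd n" and "n \<ge> n0" for n Hs
  proof -
    from n0[OF \<open>n \<ge> n0\<close>, unfolded Large_def] have L: "4 * real d / \<tau> \<le> sqrt (ln (real n))" "1 < ln (real n)"
      and pw: "real n powr (- c0) + 1 / real n \<le> real n powr (- c')" and n4: "n \<ge> 4"
      and lp: "0 \<le> log_param \<beta> d n" "log_param \<beta> d n \<le> log_param \<alpha> d n" "log_param \<alpha> d n \<le> 1"
      and nogap: "\<And>h. h \<in> balanced_labellings n K \<Longrightarrow>
       measure_pmf.prob (hyperedge_law n d h (log_param \<alpha> d n) (log_param \<beta> d n))
         {x. \<not> has_gap n d K x h (\<Gamma> * ln (real n))} \<le> real n powr (- c0)" using dvd by auto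
    obtain hs where hs: "hs \<in> balanced_labellings n K" "Hs = label_mat n K hs"
      using balanced_assignments_label[OF Hs] by blast
    have lab: "hs \<in> labellings n K" using hs(1) by (simp add: balanced_labellings_def)
    define \<rho> where "\<rho> = 1 / sqrt (ln (real n))"
    define N where "N = nat \<lceil>2 * ln (real n) / ln (ln (real n))\<rceil>"
    define success where "success A \<longleftrightarrow> (\<forall>H0\<in>assignment_mats n K.
               Min ((\<lambda>Q. frob_norm (H0 - Hs * Q)) ` perm_mats K) \<le> \<theta> * sqrt (real n) \<longrightarrow>
               (\<exists>N\<ge>1. int N \<le> \<lceil>2 * ln (ln (real n))\<rceil> + \<lceil>2 * ln (real n) / ln (ln (real n))\<rceil> + 2 \<and>
                  (\<forall>X. ptpm_output n d K A N H0 X \<longrightarrow> (\<exists>Q\<in>perm_mats K. X = Hs * Q))))" for A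
    have lnln: "ln (ln (real n)) > 0" using L(2) by simp
    then have pos: "2 * ln (real n) / ln (ln (real n)) > 0" using L(2) by simp
    then have ceil: "0 < \<lceil>2 * ln (real n) / ln (ln (real n))\<rceil>" by (simp only: zero_less_ceiling)
    then have intN: "int N = \<lceil>2 * ln (real n) / ln (ln (real n))\<rceil>" unfolding N_def by linarith
    then have N1: "N \<ge> 1" using ceil by linarith
    have realN: "2 * ln (real n) / ln (ln (real n)) \<le> real N" by (simp add: N_def of_nat_nat real_nat_ceiling_ge)
    have "\<lceil>2 * ln (ln (real n))\<rceil> \<ge> 0" using lnln by simp
    then have Nle: "int N \<le> \<lceil>2 * ln (ln (real n))\<rceil> + \<lceil>2 * ln (real n) / ln (ln (real n))\<rceil> + 2"
      unfolding intN by linarith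
    have \<rho>: "0 \<le> \<rho>" "\<rho> \<le> 1" using L(2) by (auto simp: \<rho>_def divide_simps)
    have "\<rho> ^ N * (\<kappa> * real n) \<le> 1 / real n * (\<kappa> * real n)"
      unfolding \<rho>_def using \<kappa> n4 L(2) realN by (intro mult_right_mono contraction_exponent) auto
    also have "\<dots> < 1" using \<kappa> n4 by simp
    finally have N: "\<rho> ^ N * (\<kappa> * real n) < 1" .
    have ok: "success (adjacency_tensor n d x)"
      if gap: "has_gap n d K x hs (\<Gamma> * ln (real n))"
        and sc: "scattered n d x (\<tau> * ln (real n)) \<kappa> \<rho>" for x
    proof -
      have gap': "has_gap n d K x hs (2 * fact (d - 1) * (\<tau> * ln (real n)))"
        using gap by (simp add: \<tau>_def)
      have \<tau>L: "\<tau> * ln (real n) > 0" using \<tau> L(2) by simp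
      have "\<exists>Q\<in>perm_mats K. X = label_mat n K hs * Q"
        if "H0 \<in> assignment_mats n K"
          "Min ((\<lambda>Q. frob_norm (H0 - label_mat n K hs * Q)) ` perm_mats K) \<le> \<theta> * sqrt (real n)"
          "ptpm_output n d K (adjacency_tensor n d x) N H0 X" for H0 X
        by (rule ptpm_output_near_truth[OF _ hs(1) gap' \<tau>L sc \<rho> \<theta>0 \<theta>2 N that]) (use assms(1) in simp)
      then show ?thesis unfolding success_def hs(2) using N1 Nle by blast
    qed
    have "measure_pmf.prob (hyperedge_law n d hs (log_param \<alpha> d n) (log_param \<beta> d n))
        {x. \<not> success (adjacency_tensor n d x)} \<le> real n powr (- c0) + 1 / real n"
    proof (rule prob_bad_Un_le)
      show "measure_pmf.prob (hyperedge_law n d hs (log_param \<alpha> d n) (log_param \<beta> d n))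
         {x. \<not> has_gap n d K x hs (\<Gamma> * ln (real n))} \<le> real n powr (- c0)" by (rule nogap[OF hs(1)])
      show "measure_pmf.prob (hyperedge_law n d hs (log_param \<alpha> d n) (log_param \<beta> d n))
         {x. \<not> scattered n d x (\<tau> * ln (real n)) \<kappa> \<rho>} \<le> 1 / real n"
        unfolding hyperedge_law_def \<rho>_def
        by (rule prob_not_scattered_le[OF assms(1) \<alpha> \<tau> n4 L(1) edge_prob_bounds[OF lp] \<kappa>_def])
    qed (use ok in blast)
    then have "measure_pmf.prob (hyperedge_law n d hs (log_param \<alpha> d n) (log_param \<beta> d n))
        {x. \<not> success (adjacency_tensor n d x)} \<le> real n powr (- c')" using pw by linarith
    then have "measure_pmf.prob (hyperedge_law n d hs (log_param \<alpha> d n) (log_param \<beta> d n))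
        {x. success (adjacency_tensor n d x)} \<ge> 1 - real n powr (- c')" by (rule prob_compl_ge)
    then have "measure_pmf.prob (hsbm_log n d \<alpha> \<beta> Hs) {A. success A} \<ge> 1 - real n powr (- c')"
      unfolding hsbm_log_def hs(2) prob_hsbm_label_mat[OF lab] .
    then show ?thesis unfolding success_def .
  qed
  show ?thesis
    unfolding Let_def \<theta>_def[symmetric]
  proof (rule exI[of _ \<gamma>], intro conjI \<gamma>, rule exI[of _ C], intro conjI C(1) G M[OF C(2)] allI impI)
    fix c :: real
    show "\<exists>c'>0. \<forall>n. \<forall>Hs\<in>balanced_assignments n K. K dvd n \<longrightarrow>
       real n > exp (Max {64 * C\<^sup>2 / \<gamma>\<^sup>2, \<gamma>\<^sup>2 / C\<^sup>2, (phi_const d K \<alpha> \<beta> C)\<^sup>2 / (theta_const d K \<alpha> \<beta> \<gamma>)\<^sup>2,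
           2 * (phi_const d K \<alpha> \<beta> C)\<^sup>2, 256 * C ^ 4 / \<gamma> ^ 4}) \<longrightarrow>
       gap_bound d K \<alpha> \<beta> \<gamma> c n Hs \<longrightarrow>
       measure_pmf.prob (hsbm_log n d \<alpha> \<beta> Hs)
         {A. \<forall>H0\<in>assignment_mats n K.
               Min ((\<lambda>Q. frob_norm (H0 - Hs * Q)) ` perm_mats K) \<le> theta_const d K \<alpha> \<beta> \<gamma> * sqrt (real n) \<longrightarrow>
               (\<exists>N\<ge>1. int N \<le> \<lceil>2 * ln (ln (real n))\<rceil> + \<lceil>2 * ln (real n) / ln (ln (real n))\<rceil> + 2 \<and>
                  (\<forall>X. ptpm_output n d K A N H0 X \<longrightarrow> (\<exists>Q\<in>perm_mats K. X = Hs * Q)))}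
       \<ge> 1 - real n powr (- c')"
      unfolding \<theta>_def[symmetric]
      by (intro exI[of _ c'] conjI c' allI ballI impI main large)
  qed
qed

end
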